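(* Let $G$ be a compact Lie group with Lie algebra $\mathfrak{g}$, let $\{U(g): g\in G\}$ be a unitary representation of $G$ on a Hilbert space $\mathcal{H}$, and let $|\psi\rangle,|\phi\rangle\in\mathcal{H}$ be unit vectors. If there exists a reversible asymptotic $G$-covariant transformation between $\psi$ and $\phi$ at rate $R=R(\psi\to\phi)>0$, then: (i) $\mathrm{Sym}_G(\psi)=\mathrm{Sym}_G(\phi)$; (ii) $C_{\mathfrak{g}}(\psi)=R\;C_{\mathfrak{g}}(\phi)$; (iii) $\langle\psi|L|\psi\rangle=R\,\langle\phi|L|\phi\rangle$ for every element $L$ of the commutator subalgebra $[\mathfrak{g},\mathfrak{g}]$.
   Context: Unitary representations are (strongly) continuous. On $\mathcal{H}^{\otimes N}$ the group $G$ acts by $U(g)^{\otimes N}$. A quantum channel is a linear, trace-preserving, completely positive map from operators on an input space $\mathcal{H}_{in}$ to operators on an output space $\mathcal{H}_{out}$. Given unitary representations $U_{in},U_{out}$ of $G$ on these spaces, a channel $\mathcal{E}$ is $G$-covariant if $\mathcal{E}(U_{in}(g)XU_{in}^\dagger(g))=U_{out}(g)\mathcal{E}(X)U_{out}^\dagger(g)$ for all $g\in G$ and all $X$. For density operators, $\rho\xrightarrow{G\text{-cov}}\sigma$ means that some $G$-covariant channel maps $\rho$ to $\sigma$. Pure states are identified with their rank-one projectors. There exists an asymptotic $G$-covariant transformation from $\psi$ to $\phi$ at rate $R$ if, with $M(N)=\lfloor NR\rfloor$, there are states $\phi_{M(N)}$ on $\mathcal{H}^{\otimes M(N)}$ with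 $\psi^{\otimes N}\xrightarrow{G\text{-cov}}\phi_{M(N)}$ for every $N$ and $\lim_{N\to\infty}\mathrm{Fid}(\phi_{M(N)},\phi^{\otimes M(N)})=1$, where $\mathrm{Fid}(\rho,\sigma)=\mathrm{tr}\sqrt{\sqrt{\rho}\,\sigma\sqrt{\rho}}$ is the fidelity. There exists a reversible asymptotic $G$-covariant transformation between $\psi$ and $\phi$ at rate $R$ if there is an asymptotic $G$-covariant transformation from $\psi$ to $\phi$ at rate $R$ and one from $\phi$ to $\psi$ at rate $R^{-1}$. $\mathrm{Sym}_G(\psi)=\{g\in G: U(g)|\psi\rangle\langle\psi|U^\dagger(g)=|\psi\rangle\langle\psi|\}$. Let $\{L_k\}$ be a basis of $\mathfrak{g}$; elements of $\mathfrak{g}$ are represented on $\mathcal{H}$ by the corresponding Hermitian generators of the representation $U$ (i.e. $U(\exp(tL))=e^{itL}$, using the same symbol for a Lie algebra element and its Hermitian generator), and the same symbols denote these operators; the expectation values below are assumed to exist (automatic when $\mathcal{H}$ is finite-dimensional). The covariance matrix of $\psi$ is $$[C_{\mathfrak{g}}(\psi)]_{kl}=\tfrac12\langle\psi|L_kL_l+L_lL_k|\psi\rangle-\langle\psi|L_k|\psi\rangle\langle\psi|L_l|\psi\rangle .$$ The commutator subalgebra $[\mathfrak{g},\mathfrak{g}]$ is the linear span of all commutators of elements of $\mathfrak{g}$. *)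

theory Defs
  imports "HOL-Analysis.Analysis" "HOL-Algebra.Group"
begin

section \<open>Smooth maps, Lie groups and their Lie algebras\<close>

text \<open>
  \<open>C\<^sup>k\<close> maps on an open subset of a finite-dimensional normed space, through iterated
  directional derivatives.
\<close>

fun Ck_on :: "nat \<Rightarrow> 'a::real_normed_vector set \<Rightarrow> ('a \<Rightarrow> 'b::real_normed_vector) \<Rightarrow> bool" where
  "Ck_on 0 S f \<longleftrightarrow> continuous_on S f"
| "Ck_on (Suc k) S f \<longleftrightarrow> (\<forall>x\<in>S. f differentiable (at x)) \<and>
     (\<forall>v. Ck_on k S (\<lambda>x. frechet_derivative f (at x) v))"

definition smooth_on :: "'a::real_normed_vector set \<Rightarrow> ('a \<Rightarrow> 'b::real_normed_vector) \<Rightarrow> bool" where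
  "smooth_on S f \<longleftrightarrow> (\<forall>k. Ck_on k S f)"

text \<open>
  A chart is a pair of its domain and its coordinate map. The model space \<open>'e\<close> is a
  finite-dimensional normed space rather than a \<open>euclidean_space\<close> because the latter class
  excludes dimension 0, i.e. the discrete (for compact groups: finite) Lie groups.
\<close>

type_synonym ('g, 'e) chart = "'g set \<times> ('g \<Rightarrow> 'e)"

abbreviation chart_dom :: "('g, 'e) chart \<Rightarrow> 'g set" where "chart_dom \<equiv> fst"
abbreviation coord :: "('g, 'e) chart \<Rightarrow> 'g \<Rightarrow> 'e" where "coord \<equiv> snd"

definition chart_img :: "('g, 'e) chart \<Rightarrow> 'e set" where
  "chart_img c = coord c ` chart_dom c"

definition point :: "('g, 'e) chart \<Rightarrow> 'e \<Rightarrow> 'g" where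
  "point c = inv_into (chart_dom c) (coord c)"

definition smooth_atlas :: "'g topology \<Rightarrow> ('g, 'e::banach) chart set \<Rightarrow> bool" where
  "smooth_atlas T \<A> \<longleftrightarrow>
     (\<exists>B::'e set. finite B \<and> span B = UNIV) \<and>
     (\<Union>c\<in>\<A>. chart_dom c) = topspace T \<and>
     (\<forall>c\<in>\<A>. openin T (chart_dom c) \<and> open (chart_img c) \<and>
        homeomorphic_map (subtopology T (chart_dom c)) (top_of_set (chart_img c)) (coord c)) \<and>
     (\<forall>c\<in>\<A>. \<forall>d\<in>\<A>.
        smooth_on (coord c ` (chart_dom c \<inter> chart_dom d)) (\<lambda>x. coord d (point c x)))"

definition compact_lie_group ::
  "'g monoid \<Rightarrow> 'g topology \<Rightarrow> ('g, 'e::banach) chart set \<Rightarrow> bool" where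
  "compact_lie_group G T \<A> \<longleftrightarrow>
     group G \<and> topspace T = carrier G \<and> compact_space T \<and> Hausdorff_space T \<and> smooth_atlas T \<A> \<and>
     continuous_map (prod_topology T T) T (\<lambda>(g, h). g \<otimes>\<^bsub>G\<^esub> h) \<and>
     continuous_map T T (\<lambda>g. inv\<^bsub>G\<^esub> g) \<and>
     (\<forall>c\<in>\<A>. \<forall>d\<in>\<A>. \<forall>e\<in>\<A>.
        smooth_on {(x, y). x \<in> chart_img c \<and> y \<in> chart_img d \<and>
                           point c x \<otimes>\<^bsub>G\<^esub> point d y \<in> chart_dom e}
          (\<lambda>(x, y). coord e (point c x \<otimes>\<^bsub>G\<^esub> point d y))) \<and>
     (\<forall>c\<in>\<A>. \<forall>d\<in>\<A>.
        smooth_on {x \<in> chart_img c. inv\<^bsub>G\<^esub> (point c x) \<in> chart_dom d}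
          (\<lambda>x. coord d (inv\<^bsub>G\<^esub> (point c x))))"

text \<open>
  The Lie algebra is the tangent space at the identity, identified with the model space \<open>'e\<close>
  through a chart \<open>c\<close> around the identity. The bracket is \<open>[X, Y] = ad X Y\<close>, where \<open>Ad g\<close> is the
  derivative at the identity of the conjugation by \<open>g\<close>, and \<open>ad\<close> is the derivative of \<open>Ad\<close> at the
  identity.
\<close>

definition chart_at_one :: "'g monoid \<Rightarrow> ('g, 'e::banach) chart set \<Rightarrow> ('g, 'e) chart \<Rightarrow> bool" where
  "chart_at_one G \<A> c \<longleftrightarrow> c \<in> \<A> \<and> \<one>\<^bsub>G\<^esub> \<in> chart_dom c"

definition Ad :: "'g monoid \<Rightarrow> ('g, 'e::banach) chart \<Rightarrow> 'g \<Rightarrow> 'e \<Rightarrow> 'e" where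
  "Ad G c g = frechet_derivative
     (\<lambda>y. coord c (g \<otimes>\<^bsub>G\<^esub> point c y \<otimes>\<^bsub>G\<^esub> inv\<^bsub>G\<^esub> g)) (at (coord c \<one>\<^bsub>G\<^esub>))"

definition lie_bracket :: "'g monoid \<Rightarrow> ('g, 'e::banach) chart \<Rightarrow> 'e \<Rightarrow> 'e \<Rightarrow> 'e" where
  "lie_bracket G c X Y = frechet_derivative (\<lambda>x. Ad G c (point c x) Y) (at (coord c \<one>\<^bsub>G\<^esub>)) X"

definition commutator_subalgebra :: "'g monoid \<Rightarrow> ('g, 'e::banach) chart \<Rightarrow> 'e set" where
  "commutator_subalgebra G c = span {lie_bracket G c X Y | X Y. True}"

definition lie_algebra_basis :: "nat \<Rightarrow> (nat \<Rightarrow> 'e::banach) \<Rightarrow> bool" where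
  "lie_algebra_basis d L \<longleftrightarrow>
     inj_on L {..<d} \<and> independent (L ` {..<d}) \<and> span (L ` {..<d}) = UNIV"

text \<open>\<open>\<gamma> t = exp (t X)\<close>: the one-parameter subgroup with velocity \<open>X\<close> at the identity.\<close>

definition one_parameter_subgroup ::
  "'g monoid \<Rightarrow> 'g topology \<Rightarrow> ('g, 'e::banach) chart \<Rightarrow> 'e \<Rightarrow> (real \<Rightarrow> 'g) \<Rightarrow> bool" where
  "one_parameter_subgroup G T c X \<gamma> \<longleftrightarrow>
     continuous_map euclideanreal T \<gamma> \<and> (\<forall>s t. \<gamma> (s + t) = \<gamma> s \<otimes>\<^bsub>G\<^esub> \<gamma> t) \<and>
     ((\<lambda>t. coord c (\<gamma> t)) has_vector_derivative X) (at 0)"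

lemma one_parameter_subgroup_one:
  assumes G: "compact_lie_group G T \<A>" and \<gamma>: "one_parameter_subgroup G T c X \<gamma>"
  shows "\<gamma> t \<in> carrier G" and "\<gamma> 0 = \<one>\<^bsub>G\<^esub>" and "\<gamma> (- t) = inv\<^bsub>G\<^esub> (\<gamma> t)"
proof -
  interpret group G using G by (simp add: compact_lie_group_def)
  have T: "topspace T = carrier G" using G by (simp add: compact_lie_group_def)
  have mem: "\<gamma> s \<in> carrier G" for s
    using \<gamma> T unfolding one_parameter_subgroup_def continuous_map_def by auto
  have add: "\<gamma> (r + s) = \<gamma> r \<otimes>\<^bsub>G\<^esub> \<gamma> s" for r s
    using \<gamma> unfolding one_parameter_subgroup_def by blast
  show "\<gamma> t \<in> carrier G" by (rule mem)
  show 0: "\<gamma> 0 = \<one>\<^bsub>G\<^esub>"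
    using add[of 0 0] mem[of 0] by (metis add.right_neutral l_cancel_one')
  have "\<gamma> (- t) \<otimes>\<^bsub>G\<^esub> \<gamma> t = \<one>\<^bsub>G\<^esub>"
    using add[of "- t" t] 0 by simp
  then show "\<gamma> (- t) = inv\<^bsub>G\<^esub> (\<gamma> t)"
    using mem by (simp add: inv_equality)
qed

lemma one_parameter_subgroup_unique:
  fixes c :: "('g, 'e::banach) chart"
  assumes G: "compact_lie_group G T \<A>" and c: "chart_at_one G \<A> c"
    and \<gamma>1: "one_parameter_subgroup G T c X \<gamma>1" and \<gamma>2: "one_parameter_subgroup G T c X \<gamma>2"
  shows "\<gamma>1 = \<gamma>2"
proof -
  interpret group G using G by (simp add: compact_lie_group_def)
  define p where "p = coord c \<one>\<^bsub>G\<^esub>"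
  define m where "m = (\<lambda>z. coord c (point c (fst z) \<otimes>\<^bsub>G\<^esub> point c (snd z)))"
  define W where "W = {(x, y). x \<in> chart_img c \<and> y \<in> chart_img c \<and>
                           point c x \<otimes>\<^bsub>G\<^esub> point c y \<in> chart_dom c}"
  have T: "topspace T = carrier G" using G by (simp add: compact_lie_group_def)
  have cA: "c \<in> \<A>" and one_c: "\<one>\<^bsub>G\<^esub> \<in> chart_dom c" using c by (auto simp: chart_at_one_def)
  have atlas: "smooth_atlas T \<A>" using G by (simp add: compact_lie_group_def)
  have opn: "openin T (chart_dom c)"
    and hom: "homeomorphic_map (subtopology T (chart_dom c)) (top_of_set (chart_img c)) (coord c)"
    using atlas cA unfolding smooth_atlas_def by auto
  have Dsub: "chart_dom c \<subseteq> carrier G" using opn T openin_subset by fastforce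
  have inj: "inj_on (coord c) (chart_dom c)"
    using homeomorphic_imp_injective_map[OF hom] Dsub T by (simp add: Int_absorb1)
  have pt: "point c (coord c g) = g" if "g \<in> chart_dom c" for g
    using inj that by (simp add: point_def)
  have img: "coord c g \<in> chart_img c" if "g \<in> chart_dom c" for g
    using that by (simp add: chart_img_def)
  have "smooth_on W (\<lambda>(x, y). coord c (point c x \<otimes>\<^bsub>G\<^esub> point c y))"
    using G cA unfolding compact_lie_group_def W_def by blast
  then have "smooth_on W m" by (simp add: m_def case_prod_unfold)
  then have "Ck_on (Suc 0) W m" unfolding smooth_on_def by blast
  then have m_diff: "m differentiable (at z)" if "z \<in> W" for z using that by simp
  have m_eq: "m (coord c g, coord c h) = coord c (g \<otimes>\<^bsub>G\<^esub> h)" if "g \<in> chart_dom c" "h \<in> chart_dom c" for g h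
    using that by (simp add: m_def pt)
  have W_mem: "(coord c g, coord c h) \<in> W"
    if "g \<in> chart_dom c" "h \<in> chart_dom c" "g \<otimes>\<^bsub>G\<^esub> h \<in> chart_dom c" for g h
    using that by (simp add: W_def img pt)
  have cont: "continuous_map euclideanreal T \<gamma>1" "continuous_map euclideanreal T \<gamma>2"
    and add: "\<gamma>1 (s + t) = \<gamma>1 s \<otimes>\<^bsub>G\<^esub> \<gamma>1 t" "\<gamma>2 (s + t) = \<gamma>2 s \<otimes>\<^bsub>G\<^esub> \<gamma>2 t"
    and der: "((\<lambda>t. coord c (\<gamma>1 t)) has_vector_derivative X) (at 0)"
      "((\<lambda>t. coord c (\<gamma>2 t)) has_vector_derivative X) (at 0)" for s t
    using \<gamma>1 \<gamma>2 unfolding one_parameter_subgroup_def by blast+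
  note o1 = one_parameter_subgroup_one[OF G \<gamma>1]
  note o2 = one_parameter_subgroup_one[OF G \<gamma>2]
  define \<omega> where "\<omega> = (\<lambda>t. \<gamma>1 t \<otimes>\<^bsub>G\<^esub> \<gamma>2 (- t))"
  have cont2m: "continuous_map euclideanreal T (\<lambda>t. \<gamma>2 (- t))"
    using continuous_map_compose[OF _ cont(2), of euclideanreal "\<lambda>t. - t"] 
    by (simp add: o_def continuous_intros)
  have mult: "continuous_map euclideanreal T (\<lambda>t. a t \<otimes>\<^bsub>G\<^esub> b t)"
    if "continuous_map euclideanreal T a" "continuous_map euclideanreal T b" for a b
  proof -
    have "continuous_map (prod_topology T T) T (\<lambda>(g, h). g \<otimes>\<^bsub>G\<^esub> h)"
      using G by (simp add: compact_lie_group_def)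
    from continuous_map_compose[OF continuous_map_pairedI[OF that] this] show ?thesis
      by (simp add: o_def)
  qed
  have cont\<omega>: "continuous_map euclideanreal T \<omega>"
    unfolding \<omega>_def by (rule mult[OF cont(1) cont2m])
  have pre: "open {t. a t \<in> chart_dom c}" if "continuous_map euclideanreal T a" for a
    using openin_continuous_map_preimage[OF that opn] by simp
  have \<omega>0: "\<omega> 0 = \<one>\<^bsub>G\<^esub>" by (simp add: \<omega>_def o1 o2)
  have \<omega>mem: "\<omega> t \<in> carrier G" for t by (simp add: \<omega>_def o1 o2)
  have comp: "((\<lambda>t. m (a t, b t)) has_vector_derivative frechet_derivative m (at (a 0, b 0)) (a', b')) (at 0)"
    if "(a has_vector_derivative a') (at 0)" "(b has_vector_derivative b') (at 0)" "(a 0, b 0) \<in> W" for a b a' b'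
  proof -
    have "((\<lambda>t. (a t, b t)) has_vector_derivative (a', b')) (at 0)"
      by (rule has_vector_derivative_Pair[OF that(1,2)])
    moreover have "(m has_derivative frechet_derivative m (at (a 0, b 0))) (at (a 0, b 0))"
      using m_diff[OF that(3)] by (simp add: frechet_derivative_works)
    ultimately show ?thesis
      using vector_derivative_diff_chain_within[of "\<lambda>t. (a t, b t)" "(a', b')" 0 UNIV m]
      by (simp add: o_def has_derivative_at_withinI)
  qed
  have pW: "(p, p) \<in> W" unfolding p_def by (rule W_mem) (simp_all add: one_c)
  let ?D = "frechet_derivative m (at (p, p))"
  have linD: "linear ?D" by (rule linear_frechet_derivative[OF m_diff[OF pW]])
  have D1: "?D (X, 0) = X"
  proof -
    have "((\<lambda>t. m (coord c (\<gamma>1 t), p)) has_vector_derivative ?D (X, 0)) (at 0)"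
      using comp[OF der(1) has_vector_derivative_const[of p]] pW by (simp add: o1 p_def)
    then have "((\<lambda>t. coord c (\<gamma>1 t)) has_vector_derivative ?D (X, 0)) (at 0)"
      by (rule has_vector_derivative_transform_within_open[OF _ pre[OF cont(1)]])
        (auto simp: o1 one_c p_def m_eq)
    then show ?thesis using der(1) vector_derivative_unique_at by blast
  qed
  have D2: "?D (0, X) = X"
  proof -
    have "((\<lambda>t. m (p, coord c (\<gamma>1 t))) has_vector_derivative ?D (0, X)) (at 0)"
      using comp[OF has_vector_derivative_const[of p] der(1)] pW by (simp add: o1 p_def)
    then have "((\<lambda>t. coord c (\<gamma>1 t)) has_vector_derivative ?D (0, X)) (at 0)"
      by (rule has_vector_derivative_transform_within_open[OF _ pre[OF cont(1)]])
        (auto simp: o1 one_c p_def m_eq)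
    then show ?thesis using der(1) vector_derivative_unique_at by blast
  qed
  have "?D (X, - X) = ?D (X, 0) - ?D (0, X)"
    by (simp flip: linear_diff[OF linD])
  then have D0: "?D (X, - X) = 0" by (simp add: D1 D2)
  have der2m: "((\<lambda>t. coord c (\<gamma>2 (- t))) has_vector_derivative - X) (at 0)"
  proof -
    have "((\<lambda>t. - t) has_vector_derivative - 1) (at (0::real))"
      by (auto intro!: derivative_eq_intros)
    from vector_diff_chain_at[OF this, of "\<lambda>t. coord c (\<gamma>2 t)" X] der(2) show ?thesis
      by (simp add: o_def)
  qed
  have der\<omega>: "((\<lambda>t. coord c (\<omega> t)) has_vector_derivative 0) (at 0)"
  proof -
    have "((\<lambda>t. m (coord c (\<gamma>1 t), coord c (\<gamma>2 (- t)))) has_vector_derivative 0) (at 0)"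
      using comp[OF der(1) der2m] pW by (simp add: o1 o2 p_def D0[unfolded p_def])
    then show ?thesis
      by (rule has_vector_derivative_transform_within_open
          [OF _ open_Int[OF pre[OF cont(1)] pre[OF cont2m]]])
        (auto simp: o1 o2(2) one_c m_eq \<omega>_def)
  qed
  have zero: "((\<lambda>t. coord c (\<omega> t)) has_vector_derivative 0) (at t)"
    if t: "\<gamma>1 t \<in> chart_dom c" "\<gamma>2 (- t) \<in> chart_dom c" "\<omega> t \<in> chart_dom c" for t
  proof -
    define u where "u = (\<lambda>h. \<gamma>1 t \<otimes>\<^bsub>G\<^esub> \<omega> h)"
    have contu: "continuous_map euclideanreal T u"
      unfolding u_def using o1(1) T by (intro mult cont\<omega>) simp
    have u0: "u 0 = \<gamma>1 t" by (simp add: u_def \<omega>0 o1)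
    have "(coord c (\<gamma>1 t), p) \<in> W" unfolding p_def by (rule W_mem) (use t one_c o1 in simp_all)
    then have *: "((\<lambda>h. m (coord c (\<gamma>1 t), coord c (\<omega> h))) has_vector_derivative 0) (at 0)"
      using comp[OF has_vector_derivative_const[of "coord c (\<gamma>1 t)"] der\<omega>]
        linear_0[OF linear_frechet_derivative[OF m_diff]]
      by (simp add: \<omega>0 p_def zero_prod_def)
    have "((\<lambda>h. coord c (u h)) has_vector_derivative 0) (at 0)"
      by (rule has_vector_derivative_transform_within_open[OF * pre[OF cont\<omega>]])
        (use t one_c in \<open>auto simp: \<omega>0 m_eq u_def\<close>)
    moreover have "(coord c (\<gamma>1 t), coord c (\<gamma>2 (- t))) \<in> W"
      by (rule W_mem) (use t in \<open>simp_all add: \<omega>_def\<close>)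
    ultimately have **: "((\<lambda>h. m (coord c (u h), coord c (\<gamma>2 (- t)))) has_vector_derivative 0) (at 0)"
      using comp[of "\<lambda>h. coord c (u h)" 0, OF _ has_vector_derivative_const[of "coord c (\<gamma>2 (- t))"]]
        linear_0[OF linear_frechet_derivative[OF m_diff]]
      by (simp add: u0 zero_prod_def)
    have shift: "u h \<otimes>\<^bsub>G\<^esub> \<gamma>2 (- t) = \<omega> (t + h)" for h
    proof -
      have "\<gamma>2 (- (t + h)) = \<gamma>2 (- h) \<otimes>\<^bsub>G\<^esub> \<gamma>2 (- t)" 
        using add(2)[of "- h" "- t"] by (simp add: algebra_simps)
      then show ?thesis by (simp add: u_def \<omega>_def add(1) m_assoc o1(1) o2(1))
    qed
    have "((\<lambda>h. coord c (\<omega> (t + h))) has_vector_derivative 0) (at 0)"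
      by (rule has_vector_derivative_transform_within_open[OF ** pre[OF contu]])
        (use t in \<open>auto simp: u0 m_eq shift\<close>)
    moreover have "((\<lambda>s. s - t) has_vector_derivative 1) (at t)"
      by (auto intro!: derivative_eq_intros)
    ultimately show ?thesis
      using vector_diff_chain_at[of "\<lambda>s. s - t" 1 t "\<lambda>h. coord c (\<omega> (t + h))" 0] by (simp add: o_def)
  qed
  define N where "N = {t. \<gamma>1 t \<in> chart_dom c} \<inter> {t. \<gamma>2 (- t) \<in> chart_dom c} \<inter> {t. \<omega> t \<in> chart_dom c}"
  have "open N" unfolding N_def by (intro open_Int pre cont cont2m cont\<omega>)
  moreover have "0 \<in> N" by (simp add: N_def o1 o2(2) \<omega>0 one_c)
  ultimately obtain e where e: "e > 0" and ball: "ball 0 e \<subseteq> N" by (meson openE)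
  have near: "\<gamma>1 s = \<gamma>2 s" if s: "s \<in> ball 0 e" for s
  proof -
    have "coord c (\<omega> s) = coord c (\<omega> 0)"
    proof (rule has_derivative_zero_unique[of "ball 0 e" "\<lambda>t. coord c (\<omega> t)" s 0])
      fix r :: real assume "r \<in> ball 0 e"
      then have "((\<lambda>t. coord c (\<omega> t)) has_vector_derivative 0) (at r)"
        using ball by (intro zero) (auto simp: N_def)
      then show "((\<lambda>t. coord c (\<omega> t)) has_derivative (\<lambda>h. 0)) (at r within ball 0 e)"
        by (simp add: has_vector_derivative_def has_derivative_at_withinI)
    qed (use s e in auto)
    moreover have "\<omega> s \<in> chart_dom c" using s ball by (auto simp: N_def)
    ultimately have "\<omega> s = \<one>\<^bsub>G\<^esub>"
      using inj one_c unfolding \<omega>0 inj_on_def by blast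
    then show ?thesis
      unfolding \<omega>_def o2(3) using o1(1)[of s] o2(1)[of s] by (metis inv_equality inv_inv inv_closed)
  qed
  have pow: "\<gamma>1 (real n * s) = \<gamma>2 (real n * s)" if "s \<in> ball 0 e" for n s
  proof (induction n)
    case (Suc n)
    then show ?case using near[OF that] by (simp add: distrib_right add)
  qed (simp add: o1 o2)
  show ?thesis
  proof
    fix t
    obtain n where n: "real n > \<bar>t\<bar> / e" using reals_Archimedean2 by blast
    then have "real n > 0" using e by (smt (verit) divide_nonneg_pos)
    then have "t / real n \<in> ball 0 e" using n e by (simp add: field_simps)
    from pow[OF this, of n] show "\<gamma>1 t = \<gamma>2 t" using \<open>real n > 0\<close> by simp
  qed
qed


section \<open>Complex Hilbert spaces\<close>

class complex_hilbert = banach +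
  fixes scaleC :: "complex \<Rightarrow> 'a \<Rightarrow> 'a"  (infixr "*\<^sub>C" 75)
    and cinner :: "'a \<Rightarrow> 'a \<Rightarrow> complex"
  assumes scaleC_add_right: "a *\<^sub>C (x + y) = a *\<^sub>C x + a *\<^sub>C y"
    and scaleC_add_left: "(a + b) *\<^sub>C x = a *\<^sub>C x + b *\<^sub>C x"
    and scaleC_scaleC: "a *\<^sub>C b *\<^sub>C x = (a * b) *\<^sub>C x"
    and scaleR_scaleC: "r *\<^sub>R x = complex_of_real r *\<^sub>C x"
    and cinner_commute: "cinner x y = cnj (cinner y x)"
    and cinner_add_right: "cinner x (y + z) = cinner x y + cinner x z"
    and cinner_scaleC_right: "cinner x (a *\<^sub>C y) = a * cinner x y"
    and cinner_norm: "cinner x x = complex_of_real ((norm x)\<^sup>2)"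

lemma cinner_add_left: "cinner (x + y) z = cinner x z + cinner y z"
  by (metis cinner_add_right cinner_commute complex_cnj_add)

lemma cinner_scaleC_left: "cinner (a *\<^sub>C x) y = cnj a * cinner x y"
  by (metis cinner_scaleC_right cinner_commute complex_cnj_mult)

lemma norm_scaleC: "norm (a *\<^sub>C x) = cmod a * norm x"
proof -
  have "complex_of_real ((norm (a *\<^sub>C x))\<^sup>2) = cnj a * a * complex_of_real ((norm x)\<^sup>2)"
    by (simp only: cinner_norm[symmetric] cinner_scaleC_left cinner_scaleC_right mult.assoc mult.left_commute)
  also have "\<dots> = complex_of_real ((cmod a * norm x)\<^sup>2)"
    using complex_norm_square[of a] by (simp add: power_mult_distrib mult.commute)
  finally have "(norm (a *\<^sub>C x))\<^sup>2 = (cmod a * norm x)\<^sup>2" by (simp only: of_real_eq_iff)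
  then show ?thesis by (simp add: power2_eq_iff_nonneg)
qed

lemma scaleC_zero: "a *\<^sub>C (0 :: 'a::complex_hilbert) = 0"
  using norm_scaleC[of a "0 :: 'a"] by simp

lemma cinner_bound: "cmod (cinner x y) \<le> norm x * norm y"
proof (cases "cinner x y = 0 \<or> x = 0")
  case True
  then show ?thesis
  proof
    assume "x = 0"
    moreover have "cinner 0 y = 0" using cinner_add_left[of 0 0 y] by simp
    ultimately show ?thesis by simp
  qed simp
next
  case False
  define a where "a = - cinner x y / complex_of_real ((norm x)\<^sup>2)"
  have "0 \<le> Re (cinner (y + a *\<^sub>C x) (y + a *\<^sub>C x))" by (simp add: cinner_norm)
  also have "cinner (y + a *\<^sub>C x) (y + a *\<^sub>C x)
     = cinner y y + a * cinner y x + cnj a * cinner x y + cnj a * a * cinner x x"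
    by (simp add: cinner_add_left cinner_add_right cinner_scaleC_left cinner_scaleC_right algebra_simps)
  also have "\<dots>
     = complex_of_real ((norm y)\<^sup>2) - cinner x y * cnj (cinner x y) / complex_of_real ((norm x)\<^sup>2)"
    unfolding cinner_norm cinner_commute[of y x] a_def using False by (simp add: power2_eq_square)
  also have "\<dots> = complex_of_real ((norm y)\<^sup>2 - (cmod (cinner x y))\<^sup>2 / (norm x)\<^sup>2)"
    by (simp add: complex_norm_square[symmetric])
  finally have "(cmod (cinner x y))\<^sup>2 \<le> (norm x * norm y)\<^sup>2"
    using False by (simp add: field_simps power_mult_distrib)
  then show ?thesis by (simp add: power2_le_iff_abs_le)
qed

lemma bounded_linear_cinner_right: "bounded_linear (\<lambda>y. cinner x y)"
  using cinner_bound[of x]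
  by (intro bounded_linear_intro[of _ "norm x"])
    (auto simp: cinner_add_right scaleR_scaleC cinner_scaleC_right scaleR_conv_of_real mult.commute)

definition is_onb :: "'a::complex_hilbert set \<Rightarrow> bool" where
  "is_onb E \<longleftrightarrow> (\<forall>x\<in>E. \<forall>y\<in>E. cinner x y = (if x = y then 1 else 0)) \<and>
     (\<forall>x. (\<forall>e\<in>E. cinner e x = 0) \<longrightarrow> x = 0)"

definition some_onb :: "'a::complex_hilbert set" where
  "some_onb = (SOME E. is_onb E)"

lemma is_onb_some_onb: "is_onb (some_onb :: 'a::complex_hilbert set)"
proof -
  define on where "on = (\<lambda>E::'a set. \<forall>x\<in>E. \<forall>y\<in>E. cinner x y = (if x = y then 1 else 0))"
  have "\<exists>M\<in>Collect on. \<forall>E\<in>Collect on. M \<subseteq> E \<longrightarrow> E = M"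
  proof (rule subset_Zorn')
    fix C assume C: "subset.chain (Collect on) C"
    have "on (\<Union>C)"
      unfolding on_def
    proof (intro ballI)
      fix x y assume "x \<in> \<Union>C" "y \<in> \<Union>C"
      then obtain E F where E: "x \<in> E" "E \<in> C" and F: "y \<in> F" "F \<in> C" by blast
      then have "E \<subseteq> F \<or> F \<subseteq> E" using C by (auto simp: subset_chain_def)
      moreover have "on E" "on F" using C E F by (auto simp: subset_chain_def)
      ultimately show "cinner x y = (if x = y then 1 else 0)"
        using E(1) F(1) unfolding on_def by blast
    qed
    then show "\<Union>C \<in> Collect on" by simp
  qed
  then obtain E where on: "on E" and max: "\<And>F. on F \<Longrightarrow> E \<subseteq> F \<Longrightarrow> F = E" by auto
  have "x = 0" if x: "\<forall>e\<in>E. cinner e x = 0" for x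
  proof (rule ccontr)
    assume "x \<noteq> 0"
    define u where "u = complex_of_real (inverse (norm x)) *\<^sub>C x"
    have "norm u = 1"
      using \<open>x \<noteq> 0\<close> by (simp only: u_def norm_scaleC norm_of_real) simp
    then have uu: "cinner u u = 1" by (simp add: cinner_norm)
    have eu: "cinner e u = 0" "cinner u e = 0" if "e \<in> E" for e
      using x that cinner_commute[of x e] by (auto simp: u_def cinner_scaleC_left cinner_scaleC_right)
    have "on (insert u E)"
      using on uu eu unfolding on_def by (smt (verit) insert_iff zero_neq_one)
    then have "u \<in> E" using max by blast
    then show False using eu uu by fastforce
  qed
  then have "is_onb E" using on unfolding is_onb_def on_def by blast
  then show ?thesis unfolding some_onb_def by (rule someI)
qed

lemma bessel:
  fixes x :: "'a::complex_hilbert"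
  assumes E: "is_onb E" and F: "finite F" "F \<subseteq> E"
  shows "(\<Sum>e\<in>F. (cmod (cinner e x))\<^sup>2) \<le> (norm x)\<^sup>2"
proof -
  define p where "p = (\<Sum>e\<in>F. cinner e x *\<^sub>C e)"
  have right: "cinner y p = (\<Sum>e\<in>F. cinner e x * cinner y e)" for y
    unfolding p_def
    by (simp add: linear_sum[OF bounded_linear.linear[OF bounded_linear_cinner_right]] cinner_scaleC_right)
  have pe: "cinner e p = cinner e x" if "e \<in> F" for e
  proof -
    have "cinner e p = (\<Sum>f\<in>F. if e = f then cinner f x else 0)"
      unfolding right
    proof (rule sum.cong)
      fix f assume "f \<in> F"
      then have "cinner e f = (if e = f then 1 else 0)"
        using E that F(2) by (simp add: is_onb_def subset_iff)
      then show "cinner f x * cinner e f = (if e = f then cinner f x else 0)" by simp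
    qed simp
    then show ?thesis using F(1) that by simp
  qed
  have sq: "(\<Sum>e\<in>F. cinner e x * cnj (cinner e x)) = complex_of_real (\<Sum>e\<in>F. (cmod (cinner e x))\<^sup>2)"
    by (simp add: complex_norm_square[symmetric])
  have xp: "cinner x p = complex_of_real (\<Sum>e\<in>F. (cmod (cinner e x))\<^sup>2)"
    unfolding right sq[symmetric] by (intro sum.cong refl arg_cong2[where f = "(*)"] cinner_commute)
  have "cinner p p = (\<Sum>e\<in>F. cinner e x * cnj (cinner e p))"
    unfolding right[of p] by (intro sum.cong refl arg_cong2[where f = "(*)"] cinner_commute)
  then have pp: "cinner p p = complex_of_real (\<Sum>e\<in>F. (cmod (cinner e x))\<^sup>2)"
    unfolding sq[symmetric] by (simp add: pe)
  have "(cmod (cinner x p))\<^sup>2 \<le> (norm x)\<^sup>2 * (norm p)\<^sup>2"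
    using power_mono[OF cinner_bound[of x p], of 2] by (simp add: power_mult_distrib)
  moreover have "(norm p)\<^sup>2 = (\<Sum>e\<in>F. (cmod (cinner e x))\<^sup>2)"
    using pp unfolding cinner_norm by (simp only: of_real_eq_iff)
  moreover have "cmod (cinner x p) = (\<Sum>e\<in>F. (cmod (cinner e x))\<^sup>2)"
    unfolding xp by (simp only: norm_of_real) (simp add: sum_nonneg)
  ultimately have "(norm p)\<^sup>2 * (norm p)\<^sup>2 \<le> (norm x)\<^sup>2 * (norm p)\<^sup>2"
    by (simp add: power2_eq_square)
  then have "(norm p)\<^sup>2 \<le> (norm x)\<^sup>2"
    by (cases "p = 0") (simp, simp only: mult_le_cancel_right, simp)
  then show ?thesis using \<open>(norm p)\<^sup>2 = _\<close> by simp
qed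

definition bounded_clinear :: "('a::complex_hilbert \<Rightarrow> 'b::complex_hilbert) \<Rightarrow> bool" where
  "bounded_clinear A \<longleftrightarrow> bounded_linear A \<and> (\<forall>c x. A (c *\<^sub>C x) = c *\<^sub>C A x)"

definition adj :: "('a::complex_hilbert \<Rightarrow> 'b::complex_hilbert) \<Rightarrow> 'b \<Rightarrow> 'a" where
  "adj A = (THE B. \<forall>x y. cinner (A x) y = cinner x (B y))"

definition proj :: "'a::complex_hilbert \<Rightarrow> 'a \<Rightarrow> 'a" where
  "proj \<psi> = (\<lambda>x. cinner \<psi> x *\<^sub>C \<psi>)"

definition pos_op :: "('a::complex_hilbert \<Rightarrow> 'a) \<Rightarrow> bool" where
  "pos_op A \<longleftrightarrow> bounded_clinear A \<and> (\<forall>x. cinner x (A x) \<in> \<real>\<^sub>\<ge>\<^sub>0)"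

definition op_sqrt :: "('a::complex_hilbert \<Rightarrow> 'a) \<Rightarrow> 'a \<Rightarrow> 'a" where
  "op_sqrt A = (THE B. pos_op B \<and> B \<circ> B = A)"

definition trace_class :: "('a::complex_hilbert \<Rightarrow> 'a) \<Rightarrow> bool" where
  "trace_class A \<longleftrightarrow> bounded_clinear A \<and>
     (\<lambda>e. cinner e (op_sqrt (adj A \<circ> A) e)) summable_on some_onb"

definition op_trace :: "('a::complex_hilbert \<Rightarrow> 'a) \<Rightarrow> complex" where
  "op_trace A = (\<Sum>\<^sub>\<infinity>e\<in>some_onb. cinner e (A e))"


section \<open>States, channels and fidelity\<close>

text \<open>
  The Hilbert spaces carrying the states are closed subspaces \<open>S\<close> of one ambient Hilbert space.
  An operator on \<open>S\<close> is an operator on the ambient space with range in \<open>S\<close> that vanishes on the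
  orthogonal complement of \<open>S\<close>. Channels act on trace-class operators.
\<close>

definition ops_on :: "'a::complex_hilbert set \<Rightarrow> ('a \<Rightarrow> 'a) set" where
  "ops_on S = {A. bounded_clinear A \<and> range A \<subseteq> S \<and>
     (\<forall>x. (\<forall>y\<in>S. cinner y x = 0) \<longrightarrow> A x = 0)}"

definition trace_class_on :: "'a::complex_hilbert set \<Rightarrow> ('a \<Rightarrow> 'a) set" where
  "trace_class_on S = {A \<in> ops_on S. trace_class A}"

definition states_on :: "'a::complex_hilbert set \<Rightarrow> ('a \<Rightarrow> 'a) set" where
  "states_on S = {\<rho> \<in> trace_class_on S. pos_op \<rho> \<and> op_trace \<rho> = 1}"

definition fidelity :: "('a::complex_hilbert \<Rightarrow> 'a) \<Rightarrow> ('a \<Rightarrow> 'a) \<Rightarrow> real" where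
  "fidelity \<rho> \<sigma> = Re (op_trace (op_sqrt (op_sqrt \<rho> \<circ> \<sigma> \<circ> op_sqrt \<rho>)))"

text \<open>
  Positivity of an \<open>n \<times> n\<close> matrix of operators, as an operator on the \<open>n\<close>-fold direct sum.
\<close>

definition block_pos :: "nat \<Rightarrow> (nat \<Rightarrow> nat \<Rightarrow> 'a::complex_hilbert \<Rightarrow> 'a) \<Rightarrow> bool" where
  "block_pos n X \<longleftrightarrow>
     (\<forall>v::nat \<Rightarrow> 'a. (\<Sum>i<n. \<Sum>j<n. cinner (v i) (X i j (v j))) \<in> \<real>\<^sub>\<ge>\<^sub>0)"

definition quantum_channel ::
  "'a::complex_hilbert set \<Rightarrow> 'a set \<Rightarrow> (('a \<Rightarrow> 'a) \<Rightarrow> 'a \<Rightarrow> 'a) \<Rightarrow> bool" where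
  "quantum_channel S S' \<E> \<longleftrightarrow>
     (\<forall>X \<in> trace_class_on S. \<E> X \<in> trace_class_on S' \<and> op_trace (\<E> X) = op_trace X) \<and>
     (\<forall>X \<in> trace_class_on S. \<forall>Y \<in> trace_class_on S.
        \<E> (\<lambda>x. X x + Y x) = (\<lambda>x. \<E> X x + \<E> Y x)) \<and>
     (\<forall>X \<in> trace_class_on S. \<forall>a. \<E> (\<lambda>x. a *\<^sub>C X x) = (\<lambda>x. a *\<^sub>C \<E> X x)) \<and>
     (\<forall>n X. (\<forall>i<n. \<forall>j<n. X i j \<in> trace_class_on S) \<and> block_pos n X \<longrightarrow>
        block_pos n (\<lambda>i j. \<E> (X i j)))"

definition covariant_channel ::
  "'g monoid \<Rightarrow> 'a::complex_hilbert set \<Rightarrow> ('g \<Rightarrow> 'a \<Rightarrow> 'a) \<Rightarrow> 'a set \<Rightarrow> ('g \<Rightarrow> 'a \<Rightarrow> 'a) \<Rightarrow>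
     (('a \<Rightarrow> 'a) \<Rightarrow> 'a \<Rightarrow> 'a) \<Rightarrow> bool" where
  "covariant_channel G S U S' U' \<E> \<longleftrightarrow> quantum_channel S S' \<E> \<and>
     (\<forall>g \<in> carrier G. \<forall>X \<in> trace_class_on S.
        \<E> (U g \<circ> X \<circ> adj (U g)) = U' g \<circ> \<E> X \<circ> adj (U' g))"


section \<open>Tensor powers\<close>

text \<open>The Hilbert space \<open>\<ell>\<^sup>2('i)\<close> of square-summable families.\<close>

typedef 'i ell2 = "{f :: 'i \<Rightarrow> complex. (\<lambda>i. (cmod (f i))\<^sup>2) summable_on UNIV}"
  morphisms ell2_coeff Abs_ell2
  by (rule exI[of _ "\<lambda>_. 0"]) simp

lemma ell2_eqI: "(\<And>i. ell2_coeff f i = ell2_coeff g i) \<Longrightarrow> f = g"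
  using ell2_coeff_inject by blast

lemma ell2_coeff_summable: "(\<lambda>i. (cmod (ell2_coeff f i))\<^sup>2) summable_on A"
  using ell2_coeff[of f] by (auto intro: summable_on_subset_banach)

lemma ell2_summable_add:
  assumes f: "(\<lambda>i. (cmod (f i))\<^sup>2) summable_on A" and g: "(\<lambda>i. (cmod (g i))\<^sup>2) summable_on A"
  shows "(\<lambda>i. (cmod (f i + g i))\<^sup>2) summable_on A"
proof (rule summable_on_comparison_test)
  show "(\<lambda>i. 2 * (cmod (f i))\<^sup>2 + 2 * (cmod (g i))\<^sup>2) summable_on A"
    by (intro summable_on_add summable_on_cmult_right f g)
  show "(cmod (f i + g i))\<^sup>2 \<le> 2 * (cmod (f i))\<^sup>2 + 2 * (cmod (g i))\<^sup>2" for i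
  proof -
    have "(cmod (f i + g i))\<^sup>2 \<le> (cmod (f i) + cmod (g i))\<^sup>2"
      by (intro power_mono norm_triangle_ineq norm_ge_zero)
    also have "\<dots> \<le> 2 * (cmod (f i))\<^sup>2 + 2 * (cmod (g i))\<^sup>2"
      using sum_squares_bound[of "cmod (f i)" "cmod (g i)"] by (simp add: power2_sum)
    finally show ?thesis .
  qed
qed auto

lemma ell2_summable_cmult:
  "(\<lambda>i. (cmod (f i))\<^sup>2) summable_on A \<Longrightarrow> (\<lambda>i. (cmod (a * f i))\<^sup>2) summable_on A"
  by (simp add: norm_mult power_mult_distrib summable_on_cmult_right)

lemma ell2_summable_mult:
  assumes f: "(\<lambda>i. (cmod (f i))\<^sup>2) summable_on A" and g: "(\<lambda>i. (cmod (g i))\<^sup>2) summable_on A"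
  shows "(\<lambda>i. cnj (f i) * g i) summable_on A"
proof -
  have "(\<lambda>i. cmod (cnj (f i) * g i)) summable_on A"
  proof (rule summable_on_comparison_test)
    show "(\<lambda>i. (cmod (f i))\<^sup>2 + (cmod (g i))\<^sup>2) summable_on A"
      by (intro summable_on_add f g)
    show "cmod (cnj (f i) * g i) \<le> (cmod (f i))\<^sup>2 + (cmod (g i))\<^sup>2" for i
      using sum_squares_bound[of "cmod (f i)" "cmod (g i)"]
        mult_nonneg_nonneg[OF norm_ge_zero[of "f i"] norm_ge_zero[of "g i"]]
      unfolding norm_mult complex_mod_cnj by linarith
  qed auto
  then show ?thesis by (rule abs_summable_summable)
qed

instantiation ell2 :: (type) real_normed_vector
begin

definition "0 = Abs_ell2 (\<lambda>_. 0)"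
definition "f + g = Abs_ell2 (\<lambda>i. ell2_coeff f i + ell2_coeff g i)"
definition "a *\<^sub>R f = Abs_ell2 (\<lambda>i. complex_of_real a * ell2_coeff f i)"
definition "- f = (-1) *\<^sub>R f" for f :: "'a ell2"
definition "f - g = f + (- g)" for f :: "'a ell2"
definition "norm f = sqrt (\<Sum>\<^sub>\<infinity>i. (cmod (ell2_coeff f i))\<^sup>2)"
definition "sgn f = inverse (norm f) *\<^sub>R f" for f :: "'a ell2"
definition "dist f g = norm (f - g)" for f :: "'a ell2"
definition [code del]: "(uniformity :: ('a ell2 \<times> 'a ell2) filter) = (INF e\<in>{0<..}. principal {(x, y). dist x y < e})"
definition [code del]: "open U = (\<forall>x\<in>U. \<forall>\<^sub>F (x', y) in uniformity. x' = x \<longrightarrow> y \<in> U)" for U :: "'a ell2 set"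

lemma coeff_zero [simp]: "ell2_coeff (0 :: 'a ell2) i = 0"
  unfolding zero_ell2_def by (subst Abs_ell2_inverse) auto

lemma coeff_add [simp]: "ell2_coeff (f + g) i = ell2_coeff f i + ell2_coeff g i" for f :: "'a ell2"
  unfolding plus_ell2_def
  by (subst Abs_ell2_inverse) (auto intro: ell2_summable_add ell2_coeff_summable)

lemma coeff_scaleR [simp]: "ell2_coeff (a *\<^sub>R f) i = complex_of_real a * ell2_coeff f i" for f :: "'a ell2"
  unfolding scaleR_ell2_def
  by (subst Abs_ell2_inverse) (auto intro: ell2_summable_cmult ell2_coeff_summable)

lemma coeff_uminus [simp]: "ell2_coeff (- f) i = - ell2_coeff f i" for f :: "'a ell2"
  unfolding uminus_ell2_def by simp

lemma coeff_diff [simp]: "ell2_coeff (f - g) i = ell2_coeff f i - ell2_coeff g i" for f :: "'a ell2"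
  unfolding minus_ell2_def by simp

lemma ell2_norm_sq: "(norm f)\<^sup>2 = (\<Sum>\<^sub>\<infinity>i. (cmod (ell2_coeff f i))\<^sup>2)" for f :: "'a ell2"
  unfolding norm_ell2_def by (simp add: infsum_nonneg)

lemma ell2_norm_nonneg: "0 \<le> norm f" for f :: "'a ell2"
  unfolding norm_ell2_def by (simp add: infsum_nonneg)

lemma ell2_L2_set_le: "finite F \<Longrightarrow> L2_set (\<lambda>i. cmod (ell2_coeff f i)) F \<le> norm f" for f :: "'a ell2"
  unfolding norm_ell2_def L2_set_def
  by (intro real_sqrt_le_mono finite_sum_le_infsum ell2_coeff_summable) auto

lemma ell2_norm_leI:
  fixes f :: "'a ell2"
  assumes "\<And>F. finite F \<Longrightarrow> L2_set (\<lambda>i. cmod (ell2_coeff f i)) F \<le> b"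
  shows "norm f \<le> b"
proof -
  have b: "0 \<le> b" using assms[of "{}"] by simp
  have "(\<Sum>i\<in>F. (cmod (ell2_coeff f i))\<^sup>2) \<le> b\<^sup>2" if "finite F" for F
    using assms[OF that] unfolding L2_set_def by (rule sqrt_le_D)
  then have "(\<Sum>\<^sub>\<infinity>i. (cmod (ell2_coeff f i))\<^sup>2) \<le> b\<^sup>2"
    by (intro infsum_le_finite_sums ell2_coeff_summable) auto
  then show ?thesis unfolding norm_ell2_def using b by (simp add: real_le_lsqrt infsum_nonneg)
qed

lemma ell2_coeff_le_norm: "cmod (ell2_coeff f i) \<le> norm f" for f :: "'a ell2"
  using ell2_L2_set_le[of "{i}" f] by simp

instance
proof
  fix f g h :: "'a ell2" and r s :: real
  show "f + g + h = f + (g + h)" "f + g = g + f" "0 + f = f" "- f + f = 0" "f - g = f + - g"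
    by (rule ell2_eqI; simp)+
  show "r *\<^sub>R (f + g) = r *\<^sub>R f + r *\<^sub>R g" "(r + s) *\<^sub>R f = r *\<^sub>R f + s *\<^sub>R f"
    "r *\<^sub>R s *\<^sub>R f = (r * s) *\<^sub>R f" "1 *\<^sub>R f = f"
    by (rule ell2_eqI; simp add: algebra_simps)+
  show "dist f g = norm (f - g)" by (rule dist_ell2_def)
  show "sgn f = inverse (norm f) *\<^sub>R f" by (rule sgn_ell2_def)
  show "uniformity = (INF e\<in>{0<..}. principal {(x :: 'a ell2, y). dist x y < e})"
    by (rule uniformity_ell2_def)
  show "open U = (\<forall>x\<in>U. \<forall>\<^sub>F (x', y) in uniformity. x' = x \<longrightarrow> y \<in> U)" for U :: "'a ell2 set"
    by (rule open_ell2_def)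
  show "norm f = 0 \<longleftrightarrow> f = 0"
  proof
    assume "norm f = 0"
    then have "cmod (ell2_coeff f i) \<le> 0" for i using ell2_coeff_le_norm[of f i] by simp
    then show "f = 0" by (intro ell2_eqI) simp
  next
    assume "f = 0" then show "norm f = 0" by (simp add: norm_ell2_def)
  qed
  show "norm (f + g) \<le> norm f + norm g"
  proof (rule ell2_norm_leI)
    fix F :: "'a set" assume F: "finite F"
    have "L2_set (\<lambda>i. cmod (ell2_coeff (f + g) i)) F
          \<le> L2_set (\<lambda>i. cmod (ell2_coeff f i) + cmod (ell2_coeff g i)) F"
      by (intro L2_set_mono) (auto intro: norm_triangle_ineq)
    also have "\<dots> \<le> L2_set (\<lambda>i. cmod (ell2_coeff f i)) F + L2_set (\<lambda>i. cmod (ell2_coeff g i)) F"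
      by (rule L2_set_triangle_ineq)
    also have "\<dots> \<le> norm f + norm g"
      by (intro add_mono ell2_L2_set_le F)
    finally show "L2_set (\<lambda>i. cmod (ell2_coeff (f + g) i)) F \<le> norm f + norm g" .
  qed
  show "norm (r *\<^sub>R f) = \<bar>r\<bar> * norm f"
    unfolding norm_ell2_def
    by (simp add: norm_mult power_mult_distrib infsum_cmult_right' real_sqrt_mult)
qed

end

instantiation ell2 :: (type) complex_hilbert
begin

definition "a *\<^sub>C f = Abs_ell2 (\<lambda>i. a * ell2_coeff f i)"
definition "cinner f g = (\<Sum>\<^sub>\<infinity>i. cnj (ell2_coeff f i) * ell2_coeff g i)"

lemma coeff_scaleC [simp]: "ell2_coeff (a *\<^sub>C f) i = a * ell2_coeff f i" for f :: "'a ell2"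
  unfolding scaleC_ell2_def
  by (subst Abs_ell2_inverse) (auto intro: ell2_summable_cmult ell2_coeff_summable)

instance
proof
  fix f g h :: "'a ell2" and a b :: complex and r :: real
  show "a *\<^sub>C (f + g) = a *\<^sub>C f + a *\<^sub>C g" "(a + b) *\<^sub>C f = a *\<^sub>C f + b *\<^sub>C f"
    "a *\<^sub>C b *\<^sub>C f = (a * b) *\<^sub>C f" "r *\<^sub>R f = complex_of_real r *\<^sub>C f"
    by (rule ell2_eqI; simp add: algebra_simps)+
  show "cinner f g = cnj (cinner g f)"
    unfolding cinner_ell2_def by (subst infsum_cnj[symmetric]) (simp add: mult.commute del: infsum_cnj)
  show "cinner f (g + h) = cinner f g + cinner f h"
    unfolding cinner_ell2_def
    by (simp add: distrib_left infsum_add ell2_summable_mult ell2_coeff_summable)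
  show "cinner f (a *\<^sub>C g) = a * cinner f g"
    unfolding cinner_ell2_def by (simp add: infsum_cmult_right' mult.left_commute)
  show "cinner f f = complex_of_real ((norm f)\<^sup>2)"
  proof -
    have "cnj z * z = complex_of_real ((cmod z)\<^sup>2)" for z
      using complex_norm_square[of z] by (simp add: mult.commute)
    then have "cinner f f = (\<Sum>\<^sub>\<infinity>i. complex_of_real ((cmod (ell2_coeff f i))\<^sup>2))"
      unfolding cinner_ell2_def by simp
    also have "\<dots> = complex_of_real (\<Sum>\<^sub>\<infinity>i. (cmod (ell2_coeff f i))\<^sup>2)"
      using ell2_coeff_summable[of f UNIV] summable_on_of_real[OF ell2_coeff_summable[of f UNIV]]
      by (intro infsum_bounded_linear_strong[where h = complex_of_real] bounded_linear_of_real)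
        (rule iffI; assumption)
    finally show ?thesis by (simp only: ell2_norm_sq)
  qed
next
  fix X :: "nat \<Rightarrow> 'a ell2"
  assume X: "Cauchy X"
  have "Cauchy (\<lambda>n. ell2_coeff (X n) i)" for i
    unfolding Cauchy_def
  proof (intro allI impI)
    fix e :: real assume "0 < e"
    with X obtain N where N: "\<And>m n. m \<ge> N \<Longrightarrow> n \<ge> N \<Longrightarrow> dist (X m) (X n) < e"
      unfolding Cauchy_def by blast
    have "dist (ell2_coeff (X m) i) (ell2_coeff (X n) i) < e" if "m \<ge> N" "n \<ge> N" for m n
      using N[OF that] ell2_coeff_le_norm[of "X m - X n" i] by (simp add: dist_norm dist_ell2_def)
    then show "\<exists>M. \<forall>m\<ge>M. \<forall>n\<ge>M. dist (ell2_coeff (X m) i) (ell2_coeff (X n) i) < e" by blast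
  qed
  then have "convergent (\<lambda>n. ell2_coeff (X n) i)" for i by (rule Cauchy_convergent)
  moreover define l where "l = (\<lambda>i. lim (\<lambda>n. ell2_coeff (X n) i))"
  ultimately have l: "(\<lambda>n. ell2_coeff (X n) i) \<longlonglongrightarrow> l i" for i
    by (simp add: convergent_LIMSEQ_iff)
  have tail: "L2_set (\<lambda>i. cmod (ell2_coeff (X m) i - l i)) F \<le> e"
    if N: "\<And>m n. m \<ge> N \<Longrightarrow> n \<ge> N \<Longrightarrow> dist (X m) (X n) < e" and m: "m \<ge> N" and F: "finite F" for m N e F
  proof (rule LIMSEQ_le_const2)
    show "(\<lambda>n. L2_set (\<lambda>i. cmod (ell2_coeff (X m) i - ell2_coeff (X n) i)) F)
            \<longlonglongrightarrow> L2_set (\<lambda>i. cmod (ell2_coeff (X m) i - l i)) F"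
      unfolding L2_set_def by (intro tendsto_intros l)
    show "\<exists>M. \<forall>n\<ge>M. L2_set (\<lambda>i. cmod (ell2_coeff (X m) i - ell2_coeff (X n) i)) F \<le> e"
    proof (intro exI allI impI)
      fix n assume "n \<ge> N"
      then have "norm (X m - X n) < e" using N[OF m] by (simp add: dist_ell2_def)
      then show "L2_set (\<lambda>i. cmod (ell2_coeff (X m) i - ell2_coeff (X n) i)) F \<le> e"
        using ell2_L2_set_le[OF F, of "X m - X n"] by simp
    qed
  qed
  obtain N1 where N1: "\<And>m n. m \<ge> N1 \<Longrightarrow> n \<ge> N1 \<Longrightarrow> dist (X m) (X n) < 1"
    using X zero_less_one unfolding Cauchy_def by blast
  have "(\<lambda>i. (cmod (ell2_coeff (X N1) i - l i))\<^sup>2) summable_on UNIV"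
  proof (rule nonneg_bdd_above_summable_on)
    show "bdd_above (sum (\<lambda>i. (cmod (ell2_coeff (X N1) i - l i))\<^sup>2) ` {F. F \<subseteq> UNIV \<and> finite F})"
    proof (rule bdd_aboveI2)
      fix F :: "'a set" assume "F \<in> {F. F \<subseteq> UNIV \<and> finite F}"
      then have "L2_set (\<lambda>i. cmod (ell2_coeff (X N1) i - l i)) F \<le> 1"
        using tail[OF N1] by auto
      then show "(\<Sum>i\<in>F. (cmod (ell2_coeff (X N1) i - l i))\<^sup>2) \<le> 1\<^sup>2"
        unfolding L2_set_def by (rule sqrt_le_D)
    qed
  qed auto
  then have "(\<lambda>i. (cmod (ell2_coeff (X N1) i + (-1) * (ell2_coeff (X N1) i - l i)))\<^sup>2) summable_on UNIV"
    by (rule ell2_summable_add[OF ell2_coeff_summable ell2_summable_cmult])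
  then have "(\<lambda>i. (cmod (l i))\<^sup>2) summable_on UNIV" by simp
  then have L: "ell2_coeff (Abs_ell2 l) i = l i" for i by (simp add: Abs_ell2_inverse)
  have "X \<longlonglongrightarrow> Abs_ell2 l"
    unfolding LIMSEQ_def
  proof (intro allI impI)
    fix e :: real assume e: "0 < e"
    then have "0 < e / 2" by simp
    with X obtain N where N: "\<And>m n. m \<ge> N \<Longrightarrow> n \<ge> N \<Longrightarrow> dist (X m) (X n) < e / 2"
      unfolding Cauchy_def by blast
    have "dist (X m) (Abs_ell2 l) < e" if m: "m \<ge> N" for m
    proof -
      have "norm (X m - Abs_ell2 l) \<le> e / 2"
        by (rule ell2_norm_leI) (simp only: coeff_diff L tail[OF N m])
      then show ?thesis using e by (simp add: dist_ell2_def)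
    qed
    then show "\<exists>N. \<forall>n\<ge>N. dist (X n) (Abs_ell2 l) < e" by blast
  qed
  then show "convergent X" unfolding convergent_def by blast
qed

end

text \<open>
  All tensor powers of a Hilbert space \<open>\<H>\<close> live in \<open>\<ell>\<^sup>2\<close> over lists of vectors of \<open>\<H>\<close>. With \<open>B\<close> the
  fixed orthonormal basis \<open>some_onb\<close> of \<open>\<H>\<close>, the \<open>N\<close>-th power is the subspace \<open>\<ell>\<^sup>2(B\<^sup>N)\<close>, and
  \<open>x\<^sub>1 \<otimes> \<dots> \<otimes> x\<^sub>N\<close> has the coefficients \<open>\<Prod>\<^sub>k \<langle>b\<^sub>k, x\<^sub>k\<rangle>\<close>.
\<close>

definition tensor_space :: "nat \<Rightarrow> 'h::complex_hilbert list ell2 set" where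
  "tensor_space N = {f. \<forall>bs. ell2_coeff f bs \<noteq> 0 \<longrightarrow> length bs = N \<and> set bs \<subseteq> some_onb}"

definition tensor_vec :: "'h::complex_hilbert list \<Rightarrow> 'h list ell2" where
  "tensor_vec xs = Abs_ell2 (\<lambda>bs. if length bs = length xs \<and> set bs \<subseteq> some_onb
     then (\<Prod>k<length xs. cinner (bs ! k) (xs ! k)) else 0)"

lemma bessel_lists:
  fixes xs :: "'a::complex_hilbert list"
  assumes E: "is_onb E" and F: "finite F" "F \<subseteq> E"
  shows "(\<Sum>bs | set bs \<subseteq> F \<and> length bs = length xs.
            (cmod (\<Prod>k<length xs. cinner (bs ! k) (xs ! k)))\<^sup>2) \<le> (\<Prod>x\<leftarrow>xs. (norm x)\<^sup>2)"
proof (induction xs)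
  case Nil
  have "{bs. set bs \<subseteq> F \<and> length bs = 0} = {[]}" by auto
  then show ?case by simp
next
  case (Cons x xs)
  let ?B = "{bs. set bs \<subseteq> F \<and> length bs = length xs}"
  let ?f = "\<lambda>bs. (cmod (\<Prod>k<length xs. cinner (bs ! k) (xs ! k)))\<^sup>2"
  have "(\<Sum>bs | set bs \<subseteq> F \<and> length bs = length (x # xs).
            (cmod (\<Prod>k<length (x # xs). cinner (bs ! k) ((x # xs) ! k)))\<^sup>2)
      = (\<Sum>(bs, b)\<in>?B \<times> F. (cmod (\<Prod>k<Suc (length xs). cinner ((b # bs) ! k) ((x # xs) ! k)))\<^sup>2)"
    unfolding list.size add_Suc_right add_0_right lists_length_Suc_eq
    by (subst sum.reindex) (auto simp: inj_on_def case_prod_beta)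
  also have "\<dots> = (\<Sum>(bs, b)\<in>?B \<times> F. ?f bs * (cmod (cinner b x))\<^sup>2)"
    by (intro sum.cong refl)
      (simp add: prod.lessThan_Suc_shift norm_mult power_mult_distrib mult.commute case_prod_beta
        del: prod.lessThan_Suc)
  also have "\<dots> = (\<Sum>bs\<in>?B. ?f bs) * (\<Sum>b\<in>F. (cmod (cinner b x))\<^sup>2)"
    by (simp add: sum_product sum.cartesian_product)
  also have "\<dots> \<le> (\<Prod>y\<leftarrow>xs. (norm y)\<^sup>2) * (norm x)\<^sup>2"
    by (intro mult_mono Cons.IH bessel[OF assms] sum_nonneg order_trans[OF _ Cons.IH]) auto
  finally show ?case by (simp add: mult.commute)
qed

lemma coeff_tensor_vec:
  "ell2_coeff (tensor_vec xs) bs = (if length bs = length xs \<and> set bs \<subseteq> some_onb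
     then (\<Prod>k<length xs. cinner (bs ! k) (xs ! k)) else 0)"
proof -
  let ?f = "\<lambda>bs. if length bs = length xs \<and> set bs \<subseteq> some_onb
     then (\<Prod>k<length xs. cinner (bs ! k) (xs ! k)) else 0"
  have "(\<lambda>bs. (cmod (?f bs))\<^sup>2) summable_on UNIV"
  proof (rule nonneg_bdd_above_summable_on)
    show "bdd_above (sum (\<lambda>bs. (cmod (?f bs))\<^sup>2) ` {F. F \<subseteq> UNIV \<and> finite F})"
    proof (rule bdd_aboveI2)
      fix C :: "'a list set" assume "C \<in> {F. F \<subseteq> UNIV \<and> finite F}"
      then have C: "finite C" by simp
      define F where "F = (\<Union>bs\<in>C. set bs) \<inter> some_onb"
      have F: "finite F" "F \<subseteq> some_onb" using C by (auto simp: F_def)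
      let ?B = "{bs. set bs \<subseteq> F \<and> length bs = length xs}"
      have "(\<Sum>bs\<in>C. (cmod (?f bs))\<^sup>2) = (\<Sum>bs\<in>C \<inter> ?B. (cmod (?f bs))\<^sup>2)"
        using C by (intro sum.mono_neutral_right) (auto simp: F_def)
      also have "\<dots> \<le> (\<Sum>bs\<in>?B. (cmod (?f bs))\<^sup>2)"
        using finite_lists_length_eq[OF F(1)] by (intro sum_mono2) auto
      also have "\<dots> = (\<Sum>bs\<in>?B. (cmod (\<Prod>k<length xs. cinner (bs ! k) (xs ! k)))\<^sup>2)"
        using F by (intro sum.cong) auto
      also have "\<dots> \<le> (\<Prod>x\<leftarrow>xs. (norm x)\<^sup>2)"
        by (rule bessel_lists[OF is_onb_some_onb F])
      finally show "(\<Sum>bs\<in>C. (cmod (?f bs))\<^sup>2) \<le> (\<Prod>x\<leftarrow>xs. (norm x)\<^sup>2)" .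
    qed
  qed auto
  then show ?thesis unfolding tensor_vec_def by (simp add: Abs_ell2_inverse)
qed

definition tensor_pow :: "nat \<Rightarrow> 'h::complex_hilbert \<Rightarrow> 'h list ell2" where
  "tensor_pow N x = tensor_vec (replicate N x)"

definition tensor_pow_op :: "nat \<Rightarrow> ('h::complex_hilbert \<Rightarrow> 'h) \<Rightarrow> 'h list ell2 \<Rightarrow> 'h list ell2" where
  "tensor_pow_op N A = (THE W. W \<in> ops_on (tensor_space N) \<and>
     (\<forall>xs. length xs = N \<longrightarrow> W (tensor_vec xs) = tensor_vec (map A xs)))"


section \<open>Unitary representations and asymptotic covariant transformations\<close>

definition unitary_rep ::
  "'g monoid \<Rightarrow> 'g topology \<Rightarrow> ('g \<Rightarrow> 'h::complex_hilbert \<Rightarrow> 'h) \<Rightarrow> bool" where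
  "unitary_rep G T U \<longleftrightarrow>
     (\<forall>g \<in> carrier G. bounded_clinear (U g) \<and> surj (U g) \<and>
        (\<forall>x y. cinner (U g x) (U g y) = cinner x y)) \<and>
     (\<forall>g \<in> carrier G. \<forall>h \<in> carrier G. U (g \<otimes>\<^bsub>G\<^esub> h) = U g \<circ> U h) \<and>
     (\<forall>x. continuous_map T euclidean (\<lambda>g. U g x))"

definition asymptotic_transformation ::
  "'g monoid \<Rightarrow> ('g \<Rightarrow> 'h::complex_hilbert \<Rightarrow> 'h) \<Rightarrow> 'h \<Rightarrow> 'h \<Rightarrow> real \<Rightarrow> bool" where
  "asymptotic_transformation G U \<psi> \<phi> R \<longleftrightarrow>
     (let M = (\<lambda>N::nat. nat \<lfloor>real N * R\<rfloor>) in
      \<exists>\<sigma>. (\<forall>N. \<sigma> N \<in> states_on (tensor_space (M N)) \<and>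
             (\<exists>\<E>. covariant_channel G
                    (tensor_space N) (\<lambda>g. tensor_pow_op N (U g))
                    (tensor_space (M N)) (\<lambda>g. tensor_pow_op (M N) (U g)) \<E> \<and>
                  \<E> (proj (tensor_pow N \<psi>)) = \<sigma> N)) \<and>
          (\<lambda>N. fidelity (\<sigma> N) (proj (tensor_pow (M N) \<phi>))) \<longlonglongrightarrow> 1)"

definition reversible_asymptotic_transformation ::
  "'g monoid \<Rightarrow> ('g \<Rightarrow> 'h::complex_hilbert \<Rightarrow> 'h) \<Rightarrow> 'h \<Rightarrow> 'h \<Rightarrow> real \<Rightarrow> bool" where
  "reversible_asymptotic_transformation G U \<psi> \<phi> R \<longleftrightarrow>
     asymptotic_transformation G U \<psi> \<phi> R \<and> asymptotic_transformation G U \<phi> \<psi> (inverse R)"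

definition Sym_group ::
  "'g monoid \<Rightarrow> ('g \<Rightarrow> 'h::complex_hilbert \<Rightarrow> 'h) \<Rightarrow> 'h \<Rightarrow> 'g set" where
  "Sym_group G U \<psi> = {g \<in> carrier G. U g \<circ> proj \<psi> \<circ> adj (U g) = proj \<psi>}"

text \<open>
  The Hermitian generator \<open>A\<close> of \<open>X\<close> is the (in general unbounded) self-adjoint operator with
  \<open>U (exp (t X)) = e\<^bsup>i t A\<^esup>\<close>. By Stone's theorem its domain consists of the vectors on which
  \<open>t \<mapsto> U (exp (t X)) x\<close> is differentiable at 0, and the derivative is \<open>i A x\<close>.
\<close>

definition generator_rel ::
  "'g monoid \<Rightarrow> 'g topology \<Rightarrow> ('g, 'e::banach) chart \<Rightarrow> ('g \<Rightarrow> 'h::complex_hilbert \<Rightarrow> 'h) \<Rightarrow>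
     'e \<Rightarrow> 'h \<Rightarrow> 'h \<Rightarrow> bool" where
  "generator_rel G T c U X x y \<longleftrightarrow>
     (\<exists>\<gamma>. one_parameter_subgroup G T c X \<gamma> \<and>
        ((\<lambda>t. U (\<gamma> t) x) has_vector_derivative (\<i> *\<^sub>C y)) (at 0))"

definition generator_dom ::
  "'g monoid \<Rightarrow> 'g topology \<Rightarrow> ('g, 'e::banach) chart \<Rightarrow> ('g \<Rightarrow> 'h::complex_hilbert \<Rightarrow> 'h) \<Rightarrow>
     'e \<Rightarrow> 'h set" where
  "generator_dom G T c U X = {x. \<exists>y. generator_rel G T c U X x y}"

definition generator ::
  "'g monoid \<Rightarrow> 'g topology \<Rightarrow> ('g, 'e::banach) chart \<Rightarrow> ('g \<Rightarrow> 'h::complex_hilbert \<Rightarrow> 'h) \<Rightarrow>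
     'e \<Rightarrow> 'h \<Rightarrow> 'h" where
  "generator G T c U X x = (THE y. generator_rel G T c U X x y)"

lemma generator_unique:
  assumes "compact_lie_group G T \<A>" and "chart_at_one G \<A> c"
    and "generator_rel G T c U X x y"
  shows "generator G T c U X x = y"
proof -
  have "y' = y" if "generator_rel G T c U X x y'" for y'
  proof -
    from assms(3) that obtain \<gamma> \<gamma>'
      where \<gamma>: "one_parameter_subgroup G T c X \<gamma>" "((\<lambda>t. U (\<gamma> t) x) has_vector_derivative \<i> *\<^sub>C y) (at 0)"
        and \<gamma>': "one_parameter_subgroup G T c X \<gamma>'" "((\<lambda>t. U (\<gamma>' t) x) has_vector_derivative \<i> *\<^sub>C y') (at 0)"
      unfolding generator_rel_def by blast
    have "\<i> *\<^sub>C y = \<i> *\<^sub>C y'"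
      using \<gamma>(2) \<gamma>'(2) one_parameter_subgroup_unique[OF assms(1,2) \<gamma>(1) \<gamma>'(1)]
        vector_derivative_unique_at by blast
    then have "(- \<i>) *\<^sub>C \<i> *\<^sub>C y = (- \<i>) *\<^sub>C \<i> *\<^sub>C y'" by simp
    then have "1 *\<^sub>C y = 1 *\<^sub>C y'" by (simp add: scaleC_scaleC)
    then show "y' = y" using scaleR_scaleC[of 1 y] scaleR_scaleC[of 1 y'] by simp
  qed
  then show ?thesis unfolding generator_def using assms(3) by blast
qed

lemma generator_symmetric:
  assumes G: "compact_lie_group G T \<A>" and c: "chart_at_one G \<A> c" and U: "unitary_rep G T U"
    and x: "x \<in> generator_dom G T c U X" and y: "y \<in> generator_dom G T c U X"
  shows "cinner (generator G T c U X x) y = cinner x (generator G T c U X y)"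
proof -
  interpret group G using G by (simp add: compact_lie_group_def)
  from x y obtain x' y' where rel: "generator_rel G T c U X x x'" "generator_rel G T c U X y y'"
    unfolding generator_dom_def by blast
  then obtain \<gamma> \<gamma>' where \<gamma>: "one_parameter_subgroup G T c X \<gamma>"
      and dx: "((\<lambda>t. U (\<gamma> t) x) has_vector_derivative \<i> *\<^sub>C x') (at 0)"
      and \<gamma>': "one_parameter_subgroup G T c X \<gamma>'"
      and dy: "((\<lambda>t. U (\<gamma>' t) y) has_vector_derivative \<i> *\<^sub>C y') (at 0)"
    unfolding generator_rel_def by blast
  have eq: "\<gamma>' = \<gamma>" by (rule one_parameter_subgroup_unique[OF G c \<gamma>' \<gamma>])
  note o = one_parameter_subgroup_one[OF G \<gamma>]
  have shift: "cinner x (U (\<gamma> (- t)) y) = cnj (cinner y (U (\<gamma> t) x))" for t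
  proof -
    have "cinner (U (\<gamma> t) x) (U (\<gamma> t) (U (\<gamma> (- t)) y)) = cinner x (U (\<gamma> (- t)) y)"
      using U o(1) unfolding unitary_rep_def by blast
    moreover have "U (\<gamma> t) (U (\<gamma> (- t)) y) = U (\<one>\<^bsub>G\<^esub>) y"
      using U o unfolding unitary_rep_def by (metis comp_apply inv_closed r_inv)
    moreover have "U (\<one>\<^bsub>G\<^esub>) y = y"
    proof -
      obtain z where z: "y = U (\<one>\<^bsub>G\<^esub>) z" using U unfolding unitary_rep_def by (metis one_closed surjD)
      then show ?thesis using U unfolding unitary_rep_def by (metis comp_apply one_closed l_one)
    qed
    ultimately show ?thesis using cinner_commute[of "U (\<gamma> t) x" y] by simp
  qed
  have "((\<lambda>t. - t) has_vector_derivative - 1) (at (0::real))"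
    by (auto intro!: derivative_eq_intros)
  from vector_diff_chain_at[OF this, of "\<lambda>t. U (\<gamma> t) y" "\<i> *\<^sub>C y'"] dy
  have "((\<lambda>t. U (\<gamma> (- t)) y) has_vector_derivative - (\<i> *\<^sub>C y')) (at 0)"
    by (simp add: o_def eq)
  from bounded_linear.has_vector_derivative[OF bounded_linear_cinner_right this, of x]
  have "((\<lambda>t. cinner x (U (\<gamma> (- t)) y)) has_vector_derivative - (\<i> * cinner x y')) (at 0)"
    by (simp add: linear_neg[OF bounded_linear.linear[OF bounded_linear_cinner_right]] cinner_scaleC_right)
  moreover have "((\<lambda>t. cnj (cinner y (U (\<gamma> t) x))) has_vector_derivative cnj (\<i> * cinner y x')) (at 0)"
    using bounded_linear.has_vector_derivative[OF bounded_linear_cnj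
        bounded_linear.has_vector_derivative[OF bounded_linear_cinner_right dx, of y]]
    by (simp add: cinner_scaleC_right)
  ultimately have "- (\<i> * cinner x y') = cnj (\<i> * cinner y x')"
    unfolding shift using vector_derivative_unique_at by blast
  then have "cinner x y' = cinner x' y"
    using cinner_commute[of x' y] by simp
  then show ?thesis
    by (simp add: generator_unique[OF G c rel(1)] generator_unique[OF G c rel(2)])
qed

definition expectation ::
  "'g monoid \<Rightarrow> 'g topology \<Rightarrow> ('g, 'e::banach) chart \<Rightarrow> ('g \<Rightarrow> 'h::complex_hilbert \<Rightarrow> 'h) \<Rightarrow>
     'h \<Rightarrow> 'e \<Rightarrow> complex" where
  "expectation G T c U \<psi> X = cinner \<psi> (generator G T c U X \<psi>)"

text \<open>
  For generators \<open>A\<close>, \<open>B\<close>, the expectation value \<open>\<langle>\<psi>|A B|\<psi>\<rangle>\<close> is read as \<open>\<langle>A \<psi>|B \<psi>\<rangle>\<close>, which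
  exists as soon as \<open>\<psi>\<close> is in the domains of \<open>A\<close> and \<open>B\<close>. Where the products themselves are
  defined on \<open>\<psi>\<close>, in particular on finite-dimensional spaces, both readings agree
  (\<open>covariance_matrix_alt\<close>).
\<close>

definition covariance_matrix ::
  "'g monoid \<Rightarrow> 'g topology \<Rightarrow> ('g, 'e::banach) chart \<Rightarrow> ('g \<Rightarrow> 'h::complex_hilbert \<Rightarrow> 'h) \<Rightarrow>
     (nat \<Rightarrow> 'e) \<Rightarrow> 'h \<Rightarrow> nat \<Rightarrow> nat \<Rightarrow> complex" where
  "covariance_matrix G T c U L \<psi> k l =
     (let A = (\<lambda>k. generator G T c U (L k) \<psi>) in
      (cinner (A k) (A l) + cinner (A l) (A k)) / 2
        - expectation G T c U \<psi> (L k) * expectation G T c U \<psi> (L l))"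

lemma covariance_matrix_alt:
  fixes L :: "nat \<Rightarrow> 'e::banach" and k l :: nat
  assumes "compact_lie_group G T \<A>" and "chart_at_one G \<A> c" and "unitary_rep G T U"
  defines "A \<equiv> generator G T c U (L k)" and "B \<equiv> generator G T c U (L l)"
  assumes "\<psi> \<in> generator_dom G T c U (L k)" and "\<psi> \<in> generator_dom G T c U (L l)"
    and "B \<psi> \<in> generator_dom G T c U (L k)" and "A \<psi> \<in> generator_dom G T c U (L l)"
  shows "covariance_matrix G T c U L \<psi> k l =
    1 / 2 * cinner \<psi> (A (B \<psi>) + B (A \<psi>)) - cinner \<psi> (A \<psi>) * cinner \<psi> (B \<psi>)"
  using generator_symmetric[OF assms(1-3) assms(6,8)] generator_symmetric[OF assms(1-3) assms(7,9)]
  by (simp add: covariance_matrix_def expectation_def A_def B_def cinner_add_right)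

end

theory Submission
  imports Defs
begin

text \<open>
  Let \<open>\<E>\<close> be a covariant channel with \<open>\<E>(\<psi>\<^sup>N) \<approx> \<phi>\<^sup>M\<close>, and apply it to the operators
  \<open>|\<psi>\<^sub>i\<rangle>\<langle>\<psi>\<^sub>j|\<close> formed from \<open>\<psi>\<^sub>i = (U(g\<^sub>i)\<psi>)\<^sup>N\<close>. By complete positivity the Gram
  matrix of the \<open>\<psi>\<^sub>i\<close> is, up to \<open>o(1)\<close>, the entrywise product of the Gram matrix of the
  \<open>\<phi>\<^sub>i = (U(g\<^sub>i)\<phi>)\<^sup>M\<close> with a positive semidefinite matrix whose diagonal tends to 1. Overlaps thus
  cannot shrink in modulus, which compares the symmetry groups. With \<open>g\<^sub>0 = 1\<close>,
  \<open>g\<^sub>1 = exp(t Y/\<surd>N)\<close>, \<open>g\<^sub>2 = exp(s X/\<surd>N)\<close>, reversibility makes the moduli agree in the limit; the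
  positive semidefinite matrix then has unimodular entries and hence rank one, so the three-cycles
  (Bargmann invariants) agree as well. Their limits are exponentials whose mixed \<open>st\<close> coefficient is
  the quantum geometric tensor \<open>\<langle>X\<psi>|Y\<psi>\<rangle> - \<langle>X\<rangle>\<langle>Y\<rangle>\<close>, whence this tensor scales by \<open>R\<close>. Its
  antisymmetric part is \<open>\<langle>[X, Y]\<rangle>\<close> up to a factor, even though \<open>\<psi>\<close> is only assumed to be
  differentiable once along every one-parameter subgroup.
\<close>

section \<open>Hilbert space preliminaries\<close>

text \<open>The N-th power of a single overlap between \<open>\<psi>\<close> and
  \<open>U(exp(t Y/\<surd>N)) \<psi>\<close> has a phase growing like \<open>\<surd>N\<close>, and
  the phases of the entries of the semidefinite matrix are not controlled either. In a cyclic
  product the first-order phases cancel, and positivity fixes the cycle of matrix entries. A cycle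
  of length two is real, so three is the shortest one that sees a phase. Equality of exponentials
  leaves the imaginary part of the exponent open modulo 2 pi; the difference of the two imaginary
  parts is linear in t, and varying t removes the ambiguity. For commutators the obstacle is that
  \<open>X Y \<psi>\<close> need not exist. Instead the expectation of \<open>Ad(exp(sY)) X\<close>
  is differentiated at s = 0, which requires the generator at \<open>\<psi>\<close> to be linear in
  the Lie algebra element. This linearity is a chain rule for the orbit map of
  \<open>\<psi>\<close>, whose differentiability has to be extracted from the derivatives along
  one-parameter subgroups alone.\<close>

lemma cinner_zero_right [simp]: "cinner x 0 = 0"
  using cinner_add_right[of x 0 0] by simp

lemma cinner_zero_left [simp]: "cinner 0 x = 0"
  using cinner_add_left[of 0 0 x] by simp

lemma cinner_minus_right [simp]: "cinner x (- y) = - cinner x y"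
  using cinner_add_right[of x y "- y"] by (simp add: eq_neg_iff_add_eq_0 add.commute)

lemma cinner_minus_left [simp]: "cinner (- x) y = - cinner x y"
  using cinner_add_left[of x "- x" y] by (simp add: eq_neg_iff_add_eq_0 add.commute)

lemma cinner_diff_right: "cinner x (y - z) = cinner x y - cinner x z"
  using cinner_add_right[of x y "- z"] by simp

lemma cinner_diff_left: "cinner (x - y) z = cinner x z - cinner y z"
  using cinner_add_left[of x "- y" z] by simp

lemma cinner_sum_right: "cinner x (\<Sum>i\<in>I. f i) = (\<Sum>i\<in>I. cinner x (f i))"
  by (induction I rule: infinite_finite_induct) (auto simp: cinner_add_right)

lemma cinner_sum_left: "cinner (\<Sum>i\<in>I. f i) x = (\<Sum>i\<in>I. cinner (f i) x)"
  by (induction I rule: infinite_finite_induct) (auto simp: cinner_add_left)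

lemma cinner_scaleR_right: "cinner x (r *\<^sub>R y) = complex_of_real r * cinner x y"
  by (simp add: scaleR_scaleC cinner_scaleC_right)

lemma cinner_scaleR_left: "cinner (r *\<^sub>R x) y = complex_of_real r * cinner x y"
  by (simp add: scaleR_scaleC cinner_scaleC_left)

lemma scaleC_one [simp]: "1 *\<^sub>C (x :: 'a::complex_hilbert) = x"
  using scaleR_scaleC[of 1 x] by simp

lemma scaleC_zero_left [simp]: "0 *\<^sub>C (x :: 'a::complex_hilbert) = 0"
  using scaleR_scaleC[of 0 x] by simp

lemma scaleC_diff_right: "a *\<^sub>C (x - y :: 'a::complex_hilbert) = a *\<^sub>C x - a *\<^sub>C y"
  using scaleC_add_right[of a "x - y" y] by (simp add: eq_diff_eq)

lemma scaleC_sum_right: "a *\<^sub>C (\<Sum>i\<in>I. f i :: 'a::complex_hilbert) = (\<Sum>i\<in>I. a *\<^sub>C f i)"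
  by (induction I rule: infinite_finite_induct) (auto simp: scaleC_add_right scaleC_zero)

lemma cinner_self_eq_0_iff: "cinner x x = 0 \<longleftrightarrow> x = 0"
  by (simp add: cinner_norm)

lemma Re_cinner_self: "Re (cinner x x) = (norm x)\<^sup>2"
  by (simp add: cinner_norm)

lemma cinner_ext:
  assumes "\<And>x. cinner x y = cinner x z"
  shows "y = z"
  using assms[of "y - z"] cinner_self_eq_0_iff[of "y - z"] by (simp add: cinner_diff_right)

lemma bounded_clinear_scaleC: "bounded_linear (\<lambda>x::'a::complex_hilbert. a *\<^sub>C x)"
  by (rule bounded_linear_intro[of _ "cmod a"])
    (auto simp: scaleC_add_right scaleR_scaleC scaleC_scaleC mult.commute norm_scaleC)

lemma bounded_bilinear_cinner: "bounded_bilinear cinner"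
  by (rule bounded_bilinear.intro)
    (auto simp: cinner_add_left cinner_add_right cinner_scaleR_left cinner_scaleR_right
      scaleR_conv_of_real intro!: exI[of _ 1] cinner_bound)

lemmas tendsto_cinner = bounded_bilinear.tendsto[OF bounded_bilinear_cinner]

section \<open>Bounded complex-linear operators, adjoints and rank-one operators\<close>

lemma bounded_clinear_simps:
  assumes "bounded_clinear A"
  shows "A (x + y) = A x + A y" "A (x - y) = A x - A y" "A 0 = 0" "A (a *\<^sub>C x) = a *\<^sub>C A x"
    "A (- x) = - A x" "A (\<Sum>i\<in>I. f i) = (\<Sum>i\<in>I. A (f i))"
  using assms bounded_linear.linear[of A] unfolding bounded_clinear_def
  by (auto simp: linear_add linear_diff linear_0 linear_neg linear_sum)

lemma bounded_clinear_bounded_linear: "bounded_clinear A \<Longrightarrow> bounded_linear A"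
  by (simp add: bounded_clinear_def)

lemma bounded_clinearI:
  assumes "\<And>x y. A (x + y) = A x + A y" "\<And>a x. A (a *\<^sub>C x) = a *\<^sub>C A x" "\<And>x. norm (A x) \<le> norm x * K"
  shows "bounded_clinear A"
  unfolding bounded_clinear_def
  using assms by (auto intro!: bounded_linear_intro[of _ K] simp: scaleR_scaleC)

lemma bounded_clinear_comp:
  "bounded_clinear A \<Longrightarrow> bounded_clinear B \<Longrightarrow> bounded_clinear (A \<circ> B)"
  unfolding bounded_clinear_def using bounded_linear_compose[of A B] by (auto simp: o_def)

lemma bounded_clinear_diff:
  "bounded_clinear A \<Longrightarrow> bounded_clinear B \<Longrightarrow> bounded_clinear (\<lambda>x. A x - B x)"
  unfolding bounded_clinear_def by (auto simp: bounded_linear_sub scaleC_diff_right)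

lemma bounded_clinear_scale:
  "bounded_clinear A \<Longrightarrow> bounded_clinear (\<lambda>x. a *\<^sub>C A x)"
  unfolding bounded_clinear_def
  using bounded_linear_compose[OF bounded_clinear_scaleC, of A a]
  by (auto simp: scaleC_scaleC mult.commute)

lemma bounded_clinear_ident: "bounded_clinear (\<lambda>x::'a::complex_hilbert. x)"
  unfolding bounded_clinear_def by (auto simp: bounded_linear_ident)

text \<open>\<open>adj\<close> is a definite description, and the inner product is nondegenerate;
  exhibiting one map with the adjoint relation therefore identifies it. Every adjoint below is found
  this way.\<close>

lemma adj_eqI:
  assumes "\<And>x y. cinner (A x) y = cinner x (B y)"
  shows "adj A = B"
  unfolding adj_def
proof (rule the_equality)
  fix B' assume B': "\<forall>x y. cinner (A x) y = cinner x (B' y)"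
  show "B' = B"
  proof
    fix y
    show "B' y = B y" by (rule cinner_ext) (use B' assms in metis)
  qed
qed (use assms in blast)

definition rank1 :: "'a::complex_hilbert \<Rightarrow> 'a \<Rightarrow> 'a \<Rightarrow> 'a" where
  "rank1 a b = (\<lambda>x. cinner b x *\<^sub>C a)"

lemma proj_eq_rank1: "proj a = rank1 a a"
  by (simp add: proj_def rank1_def)

lemma bounded_clinear_rank1: "bounded_clinear (rank1 a b)"
proof (rule bounded_clinearI[of _ "norm b * norm a"])
  show "norm (rank1 a b x) \<le> norm x * (norm b * norm a)" for x
    using mult_right_mono[OF cinner_bound[of b x] norm_ge_zero[of a]]
    by (simp add: rank1_def norm_scaleC algebra_simps)
qed (auto simp: rank1_def cinner_add_right scaleC_add_left cinner_scaleC_right scaleC_scaleC)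

lemma adj_rank1: "adj (rank1 a b) = rank1 b a"
  by (rule adj_eqI)
    (simp add: rank1_def cinner_scaleC_left cinner_scaleC_right cinner_commute[of b] mult.commute)

lemma comp_rank1_adj:
  assumes "bounded_clinear A" "\<And>x y. cinner (A x) y = cinner x (B y)"
  shows "A \<circ> rank1 a b \<circ> B = rank1 (A a) (A b)"
  using assms(2) by (auto simp: rank1_def fun_eq_iff bounded_clinear_simps[OF assms(1)])

subsection \<open>Expansion in an orthonormal basis\<close>

lemma norm_sum_orthogonal:
  fixes f :: "'i \<Rightarrow> 'a::complex_hilbert"
  assumes "finite F" "\<And>i j. i \<in> F \<Longrightarrow> j \<in> F \<Longrightarrow> i \<noteq> j \<Longrightarrow> cinner (f i) (f j) = 0"
  shows "(norm (\<Sum>i\<in>F. f i))\<^sup>2 = (\<Sum>i\<in>F. (norm (f i))\<^sup>2)"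
proof -
  have "cinner (\<Sum>i\<in>F. f i) (\<Sum>j\<in>F. f j) = (\<Sum>i\<in>F. \<Sum>j\<in>F. if i = j then cinner (f i) (f i) else 0)"
    unfolding cinner_sum_left cinner_sum_right by (intro sum.cong refl) (use assms(2) in auto)
  also have "\<dots> = (\<Sum>i\<in>F. cinner (f i) (f i))" using assms(1) by simp
  finally have "complex_of_real ((norm (\<Sum>i\<in>F. f i))\<^sup>2) = complex_of_real (\<Sum>i\<in>F. (norm (f i))\<^sup>2)"
    by (simp only: cinner_norm of_real_sum)
  then show ?thesis by (simp only: of_real_eq_iff)
qed

text \<open>A finite \<open>F0\<close> whose squared norms come within \<open>(e/2)^2\<close> of
  their supremum controls every larger partial sum by Pythagoras, so the net of finite sums is
  Cauchy.\<close>

lemma orthogonal_summable_on: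
  fixes f :: "'i \<Rightarrow> 'a::complex_hilbert"
  assumes orth: "\<And>i j. i \<in> E \<Longrightarrow> j \<in> E \<Longrightarrow> i \<noteq> j \<Longrightarrow> cinner (f i) (f j) = 0"
    and bd: "\<And>F. finite F \<Longrightarrow> F \<subseteq> E \<Longrightarrow> (\<Sum>i\<in>F. (norm (f i))\<^sup>2) \<le> b"
  shows "f summable_on E"
proof -
  let ?q = "\<lambda>F. \<Sum>i\<in>F. (norm (f i))\<^sup>2"
  have bdd: "bdd_above (?q ` {F. finite F \<and> F \<subseteq> E})" using bd by (intro bdd_aboveI2[of _ _ b]) auto
  have ne: "{F. finite F \<and> F \<subseteq> E} \<noteq> {}" by auto
  have "cauchy_filter (filtermap (sum f) (finite_subsets_at_top E))"
    unfolding cauchy_filter_metric_filtermap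
  proof (intro allI impI)
    fix e :: real assume e: "e > 0"
    have "(SUP F\<in>{F. finite F \<and> F \<subseteq> E}. ?q F) - (e/2)\<^sup>2 < (SUP F\<in>{F. finite F \<and> F \<subseteq> E}. ?q F)"
      using e by simp
    then obtain F0 where F0: "finite F0" "F0 \<subseteq> E"
      and gt: "(SUP F\<in>{F. finite F \<and> F \<subseteq> E}. ?q F) - (e/2)\<^sup>2 < ?q F0"
      unfolding less_cSUP_iff[OF ne bdd] by blast
    define P where "P = (\<lambda>F. finite F \<and> F0 \<subseteq> F \<and> F \<subseteq> E)"
    have "eventually P (finite_subsets_at_top E)"
      using F0 unfolding P_def eventually_finite_subsets_at_top by blast
    moreover have near: "dist (sum f F) (sum f F0) < e/2" if "P F" for F
    proof -
      from that have F: "finite F" "F0 \<subseteq> F" "F \<subseteq> E" by (auto simp: P_def)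
      have "?q F \<le> (SUP F\<in>{F. finite F \<and> F \<subseteq> E}. ?q F)"
        by (rule cSUP_upper[OF _ bdd]) (use F in auto)
      then have "?q (F - F0) < (e/2)\<^sup>2"
        using gt sum_diff[OF F(1,2), of "\<lambda>i. (norm (f i))\<^sup>2"] by simp
      moreover have "(norm (sum f (F - F0)))\<^sup>2 = ?q (F - F0)"
        by (rule norm_sum_orthogonal) (use F in \<open>auto intro!: orth\<close>)
      ultimately have "norm (sum f (F - F0)) < e/2"
        using e by (metis half_gt_zero less_imp_le norm_ge_zero power2_less_imp_less)
      then show ?thesis using sum_diff[OF F(1,2), of f] by (simp add: dist_norm)
    qed
    moreover have "dist (sum f F) (sum f F') < e" if "P F \<and> P F'" for F F'
      using near[of F] near[of F'] that dist_triangle_half_l[of "sum f F" "sum f F0" e "sum f F'"]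
      by blast
    ultimately show "\<exists>P. eventually P (finite_subsets_at_top E) \<and>
        (\<forall>x y. P x \<and> P y \<longrightarrow> dist (sum f x) (sum f y) < e)" by blast
  qed
  moreover have "complete (UNIV::'a set)"
    by (meson Cauchy_convergent UNIV_I complete_def convergent_def)
  ultimately obtain L where "filtermap (sum f) (finite_subsets_at_top E) \<le> nhds L"
    using cauchy_filter_complete_converges[of "filtermap (sum f) (finite_subsets_at_top E)" UNIV]
    by (auto simp: filtermap_bot_iff)
  then have "(f has_sum L) E" by (simp add: has_sum_def filterlim_def)
  then show ?thesis by (auto simp: summable_on_def)
qed

text \<open>Bessel gives convergence to some \<open>s\<close>; the difference \<open>x - s\<close>
  is orthogonal to all of \<open>E\<close>, so completeness of \<open>E\<close> makes it 0.\<close>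

lemma onb_expansion:
  fixes x :: "'a::complex_hilbert"
  assumes E: "is_onb E"
  shows "((\<lambda>e. cinner e x *\<^sub>C e) has_sum x) E"
proof -
  have on: "\<And>e f. e \<in> E \<Longrightarrow> f \<in> E \<Longrightarrow> cinner e f = (if e = f then 1 else 0)"
    using E by (auto simp: is_onb_def)
  have n1: "norm e = 1" if "e \<in> E" for e
  proof -
    have "complex_of_real ((norm e)\<^sup>2) = of_real 1" using on[OF that that] by (simp add: cinner_norm)
    then have "(norm e)\<^sup>2 = 1" by (simp only: of_real_eq_iff)
    then show ?thesis using norm_ge_zero[of e] by (simp add: power2_eq_1_iff)
  qed
  have "(\<lambda>e. cinner e x *\<^sub>C e) summable_on E"
  proof (rule orthogonal_summable_on[of _ _ "(norm x)\<^sup>2"])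
    fix F assume F: "finite F" "F \<subseteq> E"
    have "(\<Sum>e\<in>F. (norm (cinner e x *\<^sub>C e))\<^sup>2) = (\<Sum>e\<in>F. (cmod (cinner e x))\<^sup>2)"
      by (intro sum.cong) (use F n1 in \<open>auto simp: norm_scaleC\<close>)
    then show "(\<Sum>e\<in>F. (norm (cinner e x *\<^sub>C e))\<^sup>2) \<le> (norm x)\<^sup>2"
      using bessel[OF E F, of x] by simp
  qed (simp add: cinner_scaleC_left cinner_scaleC_right on)
  then obtain s where s: "((\<lambda>e. cinner e x *\<^sub>C e) has_sum s) E" by (auto simp: summable_on_def)
  have "cinner e s = cinner e x" if e: "e \<in> E" for e
  proof (rule has_sum_unique)
    show "((\<lambda>f. cinner e (cinner f x *\<^sub>C f)) has_sum cinner e s) E"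
      by (rule has_sum_bounded_linear[OF bounded_linear_cinner_right s])
    have "((\<lambda>f. cinner e (cinner f x *\<^sub>C f)) has_sum cinner e x) {e}"
      by (rule has_sum_finiteI) (auto simp: cinner_scaleC_right on e)
    then show "((\<lambda>f. cinner e (cinner f x *\<^sub>C f)) has_sum cinner e x) E"
      by (subst (asm) has_sum_cong_neutral) (use e on in \<open>auto simp: cinner_scaleC_right\<close>)
  qed
  then have "\<forall>e\<in>E. cinner e (x - s) = 0" by (simp add: cinner_diff_right)
  then have "x - s = 0" using E unfolding is_onb_def by blast
  then show ?thesis using s by simp
qed

lemma parseval:
  fixes x y :: "'a::complex_hilbert"
  assumes E: "is_onb E"
  shows "((\<lambda>e. cinner x e * cinner e y) has_sum cinner x y) E"
  using has_sum_bounded_linear[OF bounded_linear_cinner_right onb_expansion[OF E, of y], of x]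
  by (simp add: cinner_scaleC_right mult.commute)

lemma bounded_clinear_eq_onb:
  assumes E: "is_onb E" and A: "bounded_clinear A" and B: "bounded_clinear B"
    and eq: "\<And>e. e \<in> E \<Longrightarrow> A e = B e"
  shows "A = B"
proof
  fix x
  have *: "((\<lambda>e. C (cinner e x *\<^sub>C e)) has_sum C x) E" if "bounded_clinear C" for C :: "'a \<Rightarrow> 'b"
    by (rule has_sum_bounded_linear[OF bounded_clinear_bounded_linear[OF that] onb_expansion[OF E]])
  have "((\<lambda>e. A (cinner e x *\<^sub>C e)) has_sum B x) E"
    using *[OF B] by (subst has_sum_cong[where g = "\<lambda>e. B (cinner e x *\<^sub>C e)"])
      (auto simp: bounded_clinear_simps[OF A] bounded_clinear_simps[OF B] eq)
  then show "A x = B x" using *[OF A] has_sum_unique by blast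
qed

lemma has_sum_rank1: "((\<lambda>e. cinner e (rank1 a b e)) has_sum cinner b a) some_onb"
  using parseval[OF is_onb_some_onb, of b a] by (simp add: rank1_def cinner_scaleC_right)

lemma op_trace_rank1: "op_trace (rank1 a b) = cinner b a"
  unfolding op_trace_def by (rule infsumI[OF has_sum_rank1])

subsection \<open>Positivity\<close>

text \<open>Phrased for the four entries of a positive 2-by-2 form, so that it serves positive
  operators, blocks of a channel output and scalar matrices alike. The test vectors (1, 1) and (1,
  i) give hermiticity, the vectors (s q, -1) with real s the determinant inequality.\<close>

lemma psd2_cauchy_schwarz:
  fixes p q q' r :: complex
  assumes psd: "\<And>a b. cnj a * a * p + cnj a * b * q + cnj b * a * q' + cnj b * b * r \<in> \<real>\<^sub>\<ge>\<^sub>0"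
  shows "q' = cnj q" and "(cmod q)\<^sup>2 \<le> Re p * Re r"
proof -
  have p: "Im p = 0" "Re p \<ge> 0" using psd[of 1 0] by (auto simp: complex_nonneg_Reals_iff)
  have r: "Im r = 0" "Re r \<ge> 0" using psd[of 0 1] by (auto simp: complex_nonneg_Reals_iff)
  show q': "q' = cnj q"
    using psd[of 1 1] psd[of 1 \<i>] p r by (auto simp: complex_nonneg_Reals_iff complex_eq_iff)
  have quad: "s\<^sup>2 * (cmod q)\<^sup>2 * Re p - 2 * s * (cmod q)\<^sup>2 + Re r \<ge> 0" for s
  proof -
    have sq: "(cmod q)\<^sup>2 = Re q * Re q + Im q * Im q" using cmod_power2[of q] by (simp only: power2_eq_square)
    show ?thesis
      using psd[of "of_real s * q" "- 1"] p r unfolding q' sq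
      by (simp add: complex_nonneg_Reals_iff power2_eq_square algebra_simps)
  qed
  show "(cmod q)\<^sup>2 \<le> Re p * Re r"
  proof (cases "Re p = 0")
    case True
    have "q = 0"
    proof (rule ccontr)
      assume "q \<noteq> 0"
      \<comment> \<open>With \<open>Re p = 0\<close> the quadratic is affine in s, and this s makes
        it equal to -1.\<close>
      then show False
        using quad[of "(Re r + 1) / (2 * (cmod q)\<^sup>2)"] True by (simp add: power2_eq_square)
    qed
    then show ?thesis using True by simp
  next
    case False
    then have pos: "Re p > 0" using p by simp
    have "(1 / Re p)\<^sup>2 * (cmod q)\<^sup>2 * Re p = (cmod q)\<^sup>2 / Re p"
      using pos by (simp add: power2_eq_square)
    \<comment> \<open>\<open>1 / Re p\<close> minimises the quadratic in s when \<open>q\<close> is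
      nonzero.\<close>
    then have "(cmod q)\<^sup>2 / Re p \<le> Re r" using quad[of "1 / Re p"] by simp
    then show ?thesis using pos by (simp add: pos_divide_le_eq mult.commute)
  qed
qed

lemma pos_op_bounded_clinear: "pos_op A \<Longrightarrow> bounded_clinear A"
  by (simp add: pos_op_def)

lemma pos_op_form:
  assumes "pos_op A"
  shows "cnj a * a * cinner x (A x) + cnj a * b * cinner x (A y) + cnj b * a * cinner y (A x)
    + cnj b * b * cinner y (A y) \<in> \<real>\<^sub>\<ge>\<^sub>0"
proof -
  have "cinner (a *\<^sub>C x + b *\<^sub>C y) (A (a *\<^sub>C x + b *\<^sub>C y)) \<in> \<real>\<^sub>\<ge>\<^sub>0"
    using assms by (simp add: pos_op_def)
  then show ?thesis
    by (simp add: bounded_clinear_simps[OF pos_op_bounded_clinear[OF assms]] cinner_add_left cinner_add_right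
        cinner_scaleC_left cinner_scaleC_right algebra_simps)
qed

lemma pos_op_hermitian: "pos_op A \<Longrightarrow> cinner (A x) y = cinner x (A y)"
  using psd2_cauchy_schwarz(1)[OF pos_op_form[of A], of y x] cinner_commute[of "A x" y] by simp

lemma pos_op_cauchy_schwarz:
  "pos_op A \<Longrightarrow> (cmod (cinner x (A y)))\<^sup>2 \<le> Re (cinner x (A x)) * Re (cinner y (A y))"
  using psd2_cauchy_schwarz(2)[OF pos_op_form[of A], of x y] by simp

lemma pos_op_nonneg: "pos_op A \<Longrightarrow> 0 \<le> Re (cinner x (A x))"
  by (auto simp: pos_op_def complex_nonneg_Reals_iff)

lemma pos_op_eq_0:
  assumes "pos_op A" "Re (cinner x (A x)) = 0"
  shows "A x = 0"
  using pos_op_cauchy_schwarz[OF assms(1), of "A x" x] assms(2) by (simp add: cinner_norm)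

section \<open>Square roots of positive operators\<close>

text \<open>The \<open>c k\<close> are the Taylor coefficients of sqrt(1 - x). Their partial sums
  are the coefficients of (1 - x)^(-1/2), hence nonnegative, which together with the signs bounds
  the sum of all \<open>\<bar>c k\<bar>\<close> by 2. The convolution identity says that the series
  squares to 1 - x and is Vandermonde's identity for 1/2 + 1/2.\<close>

lemma sqrt_one_minus_coefficients:
  obtains c :: "nat \<Rightarrow> real" where "c 0 = 1" and "\<And>k. k > 0 \<Longrightarrow> c k \<le> 0"
    and "\<And>m. 0 \<le> (\<Sum>k\<le>m. c k)"
    and "\<And>n. (\<Sum>k\<le>n. c (n - k) * c k) = (if n = 0 then 1 else if n = 1 then - 1 else 0)"
proof
  define c where "c = (\<lambda>k::nat. ((1/2 :: real) gchoose k) * (- 1) ^ k)"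
  have c_poch: "c k = pochhammer (- 1/2) k / fact k" for k
    by (simp add: c_def gbinomial_pochhammer power_mult_distrib[symmetric])
  show "c 0 = 1" by (simp add: c_def)
  show "c k \<le> 0" if "k > 0" for k
  proof -
    obtain j where j: "k = Suc j" using \<open>k > 0\<close> by (cases k) auto
    have "pochhammer (1/2 :: real) j \<ge> 0" by (intro pochhammer_nonneg) auto
    then show ?thesis unfolding c_poch j pochhammer_rec by (simp add: divide_nonpos_pos)
  qed
  show "0 \<le> (\<Sum>k\<le>m. c k)" for m
  proof -
    have "(\<Sum>k\<le>m. c k) = (- 1) ^ m * ((- 1/2 :: real) gchoose m)"
      unfolding c_def gbinomial_sum_lower_neg by simp
    also have "\<dots> = pochhammer (1/2) m / fact m"
      by (simp add: gbinomial_pochhammer power_mult_distrib[symmetric])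
    also have "\<dots> \<ge> 0" by (intro divide_nonneg_pos pochhammer_nonneg) auto
    finally show ?thesis .
  qed
  show "(\<Sum>k\<le>n. c (n - k) * c k) = (if n = 0 then 1 else if n = 1 then - 1 else 0)" for n
  proof -
    have "(\<Sum>k\<le>n. c (n - k) * c k) = (\<Sum>k\<le>n. ((1/2) gchoose k) * ((1/2) gchoose (n - k)) * (- 1) ^ n)"
      by (intro sum.cong refl) (simp add: c_def mult_ac flip: power_add)
    also have "\<dots> = ((1 :: real) gchoose n) * (- 1) ^ n"
      using gbinomial_Vandermonde[of "1/2 :: real" "1/2" n]
      by (simp add: atLeast0AtMost flip: sum_distrib_right)
    also have "(1 :: real) gchoose n = of_nat (1 choose n)" by (metis binomial_gbinomial of_nat_1)
    finally show ?thesis by (cases n) (auto simp: binomial_eq_0)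
  qed
qed

text \<open>The series of sqrt(1 - x) converges absolutely up to the boundary of the unit disc, so
  it can be evaluated at any contraction \<open>T\<close>. Being a limit of polynomials in
  \<open>T\<close>, the root commutes with whatever commutes with \<open>T\<close>; uniqueness of
  positive roots rests on this.\<close>

lemma pos_op_sqrt_one_minus:
  fixes T :: "'a::complex_hilbert \<Rightarrow> 'a"
  assumes T: "bounded_clinear T" and herm: "\<And>x y. cinner (T x) y = cinner x (T y)"
    and contr: "\<And>x. norm (T x) \<le> norm x"
  obtains S where "pos_op S" "S \<circ> S = (\<lambda>x. x - T x)"
    "\<And>C. bounded_clinear C \<Longrightarrow> C \<circ> T = T \<circ> C \<Longrightarrow> C \<circ> S = S \<circ> C"
proof -
  obtain c :: "nat \<Rightarrow> real" where c0: "c 0 = 1" and cneg: "\<And>k. k > 0 \<Longrightarrow> c k \<le> 0"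
    and csum: "\<And>m. 0 \<le> (\<Sum>k\<le>m. c k)"
    and conv: "\<And>n. (\<Sum>k\<le>n. c (n - k) * c k) = (if n = 0 then 1 else if n = 1 then - 1 else 0)"
    by (rule sqrt_one_minus_coefficients) blast
  have "(\<Sum>k<n. \<bar>c k\<bar>) \<le> 2" for n
  proof -
    have "(\<Sum>k<n. \<bar>c k\<bar>) \<le> (\<Sum>k\<le>n. \<bar>c k\<bar>)" by (intro sum_mono2) auto
    \<comment> \<open>\<open>\<bar>c k\<bar> = - c k\<close> for \<open>k > 0\<close>, while
      \<open>\<bar>c 0\<bar> = 1 = 2 - c 0\<close>.\<close>
    also have "\<dots> = (\<Sum>k\<le>n. (if k = 0 then 2 else 0) - c k)"
      by (intro sum.cong refl) (use c0 cneg in \<open>auto simp: abs_if order.antisym\<close>)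
    also have "\<dots> = 2 - (\<Sum>k\<le>n. c k)" by (simp add: sum_subtractf)
    also have "\<dots> \<le> 2" using csum by simp
    finally show ?thesis .
  qed
  then have "summable (\<lambda>k. \<bar>c k\<bar>)" by (intro summableI_nonneg_bounded[of _ 2]) auto
  then have sumc: "(\<lambda>k. \<bar>c k\<bar>) summable_on UNIV"
    by (simp add: summable_on_UNIV_nonneg_real_iff)
  define P where "P = (\<lambda>n. T ^^ n)"
  have P: "bounded_clinear (P n)" for n
    unfolding P_def
  proof (induction n)
    case (Suc n) then show ?case using bounded_clinear_comp[OF T] by (simp add: o_def)
  qed (simp add: id_def bounded_clinear_ident)
  have PP: "P m (P n x) = P (m + n) x" for m n x by (simp add: P_def funpow_add)
  have P01: "P 0 x = x" "P (Suc 0) x = T x" for x by (auto simp: P_def)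
  have nP: "norm (P n x) \<le> norm x" for n x
    unfolding P_def by (induction n) (auto intro: order_trans[OF contr])
  have hP: "cinner (P n x) y = cinner x (P n y)" for n x y
  proof (induction n arbitrary: y)
    case (Suc n)
    have "P (Suc n) z = T (P n z)" "P (Suc n) z = P n (T z)" for z
      by (simp_all add: P_def funpow_swap1)
    then show ?case using Suc[of "T y"] herm[of "P n x" y] by metis
  qed (simp add: P_def)
  note lin = bounded_clinear_simps
  have ns: "(\<lambda>n. norm (c n *\<^sub>R P n x)) summable_on UNIV" for x
    by (rule summable_on_comparison_test[OF summable_on_cmult_left[OF sumc, of "norm x"]])
      (simp_all add: mult_left_mono nP)
  then have s: "(\<lambda>n. c n *\<^sub>R P n x) summable_on UNIV" for x by (rule abs_summable_summable)
  define S where "S = (\<lambda>x. \<Sum>\<^sub>\<infinity>n. c n *\<^sub>R P n x)"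
  have S: "((\<lambda>n. c n *\<^sub>R P n x) has_sum S x) UNIV" for x
    unfolding S_def using s by simp
  have blS: "bounded_clinear S"
  proof (rule bounded_clinearI)
    show "S (x + y) = S x + S y" for x y
      unfolding S_def infsum_add[OF s s, symmetric] by (simp add: lin[OF P] scaleR_add_right)
    show "S (a *\<^sub>C x) = a *\<^sub>C S x" for a x
      using has_sum_bounded_linear[OF bounded_clinear_scaleC S[of x], of a] S[of "a *\<^sub>C x"]
      by (simp add: lin[OF P] scaleR_scaleC scaleC_scaleC mult.commute has_sum_unique)
    show "norm (S x) \<le> norm x * (\<Sum>\<^sub>\<infinity>k. \<bar>c k\<bar>)" for x
    proof -
      have "norm (S x) \<le> (\<Sum>\<^sub>\<infinity>n. norm (c n *\<^sub>R P n x))"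
        unfolding S_def by (rule norm_infsum_bound[OF ns])
      also have "\<dots> \<le> (\<Sum>\<^sub>\<infinity>k. \<bar>c k\<bar> * norm x)"
        by (rule infsum_mono[OF ns summable_on_cmult_left[OF sumc]]) (auto intro: mult_left_mono nP)
      also have "\<dots> = norm x * (\<Sum>\<^sub>\<infinity>k. \<bar>c k\<bar>)" unfolding infsum_cmult_left' by (rule mult.commute)
      finally show ?thesis .
    qed
  qed
  have comm: "C \<circ> S = S \<circ> C" if C: "bounded_clinear C" and CT: "C \<circ> T = T \<circ> C" for C
  proof
    fix x
    have "C (T z) = T (C z)" for z using fun_cong[OF CT, of z] by simp
    then have "C (P n x) = P n (C x)" for n
      unfolding P_def by (induction n) simp_all
    then have "((\<lambda>n. c n *\<^sub>R P n (C x)) has_sum C (S x)) UNIV"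
      using has_sum_bounded_linear[OF bounded_clinear_bounded_linear[OF C] S[of x]]
      by (simp add: scaleR_scaleC lin[OF C])
    then show "(C \<circ> S) x = (S \<circ> C) x" using S[of "C x"] has_sum_unique by fastforce
  qed
  have SS: "S (S x) = x - T x" for x
  proof -
    let ?f = "\<lambda>(m, k). (c m * c k) *\<^sub>R P (m + k) x"
    have "(\<lambda>z. \<bar>c (fst z)\<bar> * \<bar>c (snd z)\<bar>) summable_on UNIV \<times> UNIV"
    proof (rule summable_on_SigmaI)
      show "((\<lambda>k. \<bar>c (fst (m, k))\<bar> * \<bar>c (snd (m, k))\<bar>) has_sum \<bar>c m\<bar> * (\<Sum>\<^sub>\<infinity>k. \<bar>c k\<bar>)) UNIV" for m
        using has_sum_cmult_right[OF has_sum_infsum[OF sumc]] by simp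
    qed (simp_all add: summable_on_cmult_left sumc)
    then have "(\<lambda>z. \<bar>c (fst z)\<bar> * \<bar>c (snd z)\<bar> * norm x) summable_on UNIV \<times> UNIV"
      by (rule summable_on_cmult_left)
    then have "(\<lambda>z. norm (?f z)) summable_on UNIV \<times> UNIV"
      by (rule summable_on_comparison_test)
        (simp_all add: abs_mult mult_left_mono nP split_beta)
    then have f: "?f summable_on UNIV \<times> UNIV" by (rule abs_summable_summable)
    have "S (S x) = (\<Sum>\<^sub>\<infinity>m. \<Sum>\<^sub>\<infinity>k. ?f (m, k))"
    proof -
      have "c m *\<^sub>R P m (S x) = (\<Sum>\<^sub>\<infinity>k. ?f (m, k))" for m
        using infsumI[OF has_sum_bounded_linear[OF bounded_clinear_bounded_linear[OF
              bounded_clinear_scale[OF P, of "complex_of_real (c m)" m]] S[of x]]]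
        by (simp add: scaleR_scaleC lin[OF P] PP scaleC_scaleC)
      then show ?thesis by (subst S_def) simp
    qed
    also have "\<dots> = infsum ?f (UNIV \<times> UNIV)" by (rule infsum_Sigma_banach[OF f])
    \<comment> \<open>Regrouping by the total degree \<open>n = m + k\<close> produces the
      convolution evaluated by \<open>conv\<close>.\<close>
    also have "\<dots> = infsum (\<lambda>(n, k). (c (n - k) * c k) *\<^sub>R P n x) (Sigma UNIV (\<lambda>n. {..n}))"
      by (rule infsum_reindex_bij_witness[of _ "\<lambda>(n, k). (n - k, k)" "\<lambda>(m, k). (m + k, k)"]) auto
    also have "\<dots> = (\<Sum>\<^sub>\<infinity>n. \<Sum>\<^sub>\<infinity>k\<in>{..n}. (c (n - k) * c k) *\<^sub>R P n x)"
    proof (subst infsum_Sigma_banach[symmetric])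
      have "?f summable_on UNIV \<times> UNIV \<longleftrightarrow>
          (\<lambda>(n, k). (c (n - k) * c k) *\<^sub>R P n x) summable_on Sigma UNIV (\<lambda>n. {..n})"
        by (rule summable_on_reindex_bij_witness[of _ "\<lambda>(n, k). (n - k, k)" "\<lambda>(m, k). (m + k, k)"]) auto
      then show "(\<lambda>(n, k). (c (n - k) * c k) *\<^sub>R P n x) summable_on Sigma UNIV (\<lambda>n. {..n})"
        using f by simp
    qed simp
    also have "\<dots> = (\<Sum>\<^sub>\<infinity>n. (if n = 0 then 1 else if n = 1 then - 1 else 0) *\<^sub>R P n x)"
      by (simp add: conv flip: scaleR_left.sum)
    also have "\<dots> = (\<Sum>\<^sub>\<infinity>n\<in>{0,1}. (if n = 0 then 1 else if n = 1 then - 1 else 0) *\<^sub>R P n x)"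
      by (rule infsum_cong_neutral) auto
    also have "\<dots> = x - T x" by (simp add: P01)
    finally show ?thesis .
  qed
  have "cinner x (S x) \<in> \<real>\<^sub>\<ge>\<^sub>0" for x
  proof -
    have hs: "((\<lambda>n. of_real (c n) * cinner x (P n x)) has_sum cinner x (S x)) UNIV"
      using has_sum_bounded_linear[OF bounded_linear_cinner_right S, of x x]
      by (simp add: cinner_scaleR_right)
    have im: "Im (cinner x (P n x)) = 0" for n
      using hP[of n x x] cinner_commute[of "P n x" x] by (simp add: complex_eq_iff)
    have "((\<lambda>n :: nat. 0 :: real) has_sum Im (cinner x (S x))) UNIV"
      using has_sum_Im[OF hs] im by simp
    then have "Im (cinner x (S x)) = 0" by (rule has_sum_unique) (rule has_sum_0_simp)
    moreover have "(\<lambda>n. c n * Re (cinner x (P n x))) sums Re (cinner x (S x))"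
      using has_sum_imp_sums[OF has_sum_Re[OF hs]] by simp
    then have "0 \<le> Re (cinner x (S x))"
      unfolding sums_def_le
    proof (rule LIMSEQ_le_const, intro exI allI impI)
      fix n
      \<comment> \<open>The coefficients with \<open>k > 0\<close> are nonpositive and
        \<open>Re (cinner x (P k x))\<close> is at most the squared norm of \<open>x\<close>, with
        equality at \<open>k = 0\<close>; so the partial sums dominate a multiple of those in
        \<open>csum\<close>.\<close>
      have "0 \<le> (norm x)\<^sup>2 * (\<Sum>k\<le>n. c k)" using csum by simp
      also have "\<dots> = (\<Sum>k\<le>n. c k * (norm x)\<^sup>2)" unfolding mult.commute[of "(norm x)\<^sup>2"] sum_distrib_right ..
      also have "\<dots> \<le> (\<Sum>k\<le>n. c k * Re (cinner x (P k x)))"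
      proof (rule sum_mono)
        fix k
        have "Re (cinner x (P k x)) \<le> norm x * norm x"
          using complex_Re_le_cmod[of "cinner x (P k x)"] cinner_bound[of x "P k x"]
            mult_left_mono[OF nP[of k x] norm_ge_zero[of x]] by linarith
        then have "Re (cinner x (P k x)) \<le> (norm x)\<^sup>2" by (simp add: power2_eq_square)
        moreover have "Re (cinner x (P 0 x)) = (norm x)\<^sup>2" by (simp add: P01 Re_cinner_self)
        ultimately show "c k * (norm x)\<^sup>2 \<le> c k * Re (cinner x (P k x))"
          using cneg[of k] by (cases "k = 0") (simp_all add: mult_left_mono_neg)
      qed
      finally show "0 \<le> (\<Sum>k\<le>n. c k * Re (cinner x (P k x)))" .
    qed
    ultimately show ?thesis by (simp add: complex_nonneg_Reals_iff)
  qed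
  then have "pos_op S" by (simp add: pos_op_def blS)
  moreover have "S \<circ> S = (\<lambda>x. x - T x)" using SS by (simp add: fun_eq_iff)
  ultimately show ?thesis using comm by (rule that)
qed

text \<open>The operator inequality A^2 \<le> K A, from Cauchy-Schwarz for the form of
  \<open>A\<close> at the pair \<open>A x\<close>, \<open>x\<close>.\<close>

lemma pos_op_norm_sq_le:
  assumes A: "pos_op A" and K: "\<And>x. norm (A x) \<le> norm x * K"
  shows "(norm (A x))\<^sup>2 \<le> K * Re (cinner x (A x))"
proof (cases "A x = 0")
  case False
  have "((norm (A x))\<^sup>2)\<^sup>2 = (cmod (cinner (A x) (A x)))\<^sup>2"
    by (simp only: cinner_norm norm_of_real) simp
  also have "\<dots> \<le> Re (cinner (A x) (A (A x))) * Re (cinner x (A x))"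
    by (rule pos_op_cauchy_schwarz[OF A])
  also have "Re (cinner (A x) (A (A x))) \<le> norm (A x) * (norm (A x) * K)"
    using complex_Re_le_cmod cinner_bound[of "A x" "A (A x)"] mult_left_mono[OF K[of "A x"] norm_ge_zero[of "A x"]]
    by (meson order_trans)
  then have "Re (cinner (A x) (A (A x))) * Re (cinner x (A x))
      \<le> norm (A x) * (norm (A x) * K) * Re (cinner x (A x))"
    by (rule mult_right_mono[OF _ pos_op_nonneg[OF A]])
  finally have "(norm (A x))\<^sup>2 * (norm (A x))\<^sup>2 \<le> (norm (A x))\<^sup>2 * (K * Re (cinner x (A x)))"
    by (simp add: power2_eq_square mult_ac)
  moreover have "(norm (A x))\<^sup>2 > 0" using False by simp
  ultimately show ?thesis by (simp only: mult_le_cancel_left_pos)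
qed simp

text \<open>Rescaling: T = 1 - A/K is a contraction because A^2 \<le> K A, and the root of 1 - T =
  A/K is multiplied by sqrt K.\<close>

lemma pos_op_sqrt_exists:
  assumes A: "pos_op A"
  obtains S where "pos_op S" "S \<circ> S = A" "\<And>C. bounded_clinear C \<Longrightarrow> C \<circ> A = A \<circ> C \<Longrightarrow> C \<circ> S = S \<circ> C"
proof -
  note bA = pos_op_bounded_clinear[OF A]
  obtain K where K: "K > 0" "\<And>x. norm (A x) \<le> norm x * K"
    using bounded_linear.pos_bounded[OF bounded_clinear_bounded_linear[OF bA]] by blast
  define T where "T = (\<lambda>x. x - complex_of_real (1 / K) *\<^sub>C A x)"
  have bT: "bounded_clinear T" unfolding T_def
    by (intro bounded_clinear_diff bounded_clinear_ident bounded_clinear_scale bA)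
  have hT: "cinner (T x) y = cinner x (T y)" for x y
    by (simp add: T_def cinner_diff_left cinner_diff_right cinner_scaleC_left cinner_scaleC_right
        pos_op_hermitian[OF A])
  have nT: "norm (T x) \<le> norm x" for x
  proof -
    have "(norm (T x))\<^sup>2 = Re (cinner (T x) (T x))" by (simp add: Re_cinner_self)
    also have "cinner (T x) (T x) = cinner x x - 2 * of_real (1 / K) * cinner x (A x)
        + (of_real (1 / K))\<^sup>2 * cinner (A x) (A x)"
      unfolding T_def
      by (simp add: cinner_diff_left cinner_diff_right cinner_scaleC_left cinner_scaleC_right
          pos_op_hermitian[OF A, of x x] power2_eq_square algebra_simps del: of_real_divide)
    also have "Re \<dots> = (norm x)\<^sup>2 - 2 / K * Re (cinner x (A x)) + (norm (A x))\<^sup>2 / K\<^sup>2"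
      by (simp add: cinner_norm power_divide flip: of_real_power)
    also have "\<dots> \<le> (norm x)\<^sup>2"
    proof -
      have "(norm (A x))\<^sup>2 / K\<^sup>2 \<le> K * Re (cinner x (A x)) / K\<^sup>2"
        by (intro divide_right_mono pos_op_norm_sq_le[OF A K(2)]) simp
      also have "\<dots> = Re (cinner x (A x)) / K" by (simp add: power2_eq_square)
      also have "\<dots> \<le> 2 / K * Re (cinner x (A x))"
        using pos_op_nonneg[OF A, of x] K(1) by (simp add: divide_right_mono)
      finally show ?thesis by simp
    qed
    finally show ?thesis by (simp add: power2_le_iff_abs_le)
  qed
  obtain S0 where S0: "pos_op S0" "S0 \<circ> S0 = (\<lambda>x. x - T x)"
    "\<And>C. bounded_clinear C \<Longrightarrow> C \<circ> T = T \<circ> C \<Longrightarrow> C \<circ> S0 = S0 \<circ> C"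
    using pos_op_sqrt_one_minus[OF bT hT nT] by blast
  define S where "S = (\<lambda>x. complex_of_real (sqrt K) *\<^sub>C S0 x)"
  note bS0 = pos_op_bounded_clinear[OF S0(1)]
  show ?thesis
  proof
    show "pos_op S"
      using S0(1) K(1) bounded_clinear_scale[OF bS0]
      by (auto simp: pos_op_def S_def cinner_scaleC_right complex_nonneg_Reals_iff)
    have "S0 (S0 x) = complex_of_real (1 / K) *\<^sub>C A x" for x
      using fun_cong[OF S0(2), of x] by (simp add: T_def)
    then show "S \<circ> S = A"
      using K(1) by (auto simp: fun_eq_iff S_def bounded_clinear_simps[OF bS0] scaleC_scaleC
          simp flip: of_real_mult)
    fix C assume C: "bounded_clinear C" "C \<circ> A = A \<circ> C"
    then have "C \<circ> T = T \<circ> C"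
      by (auto simp: fun_eq_iff T_def bounded_clinear_simps[OF C(1)])
    from S0(3)[OF C(1) this] show "C \<circ> S = S \<circ> C"
      by (auto simp: fun_eq_iff S_def bounded_clinear_simps[OF C(1)])
  qed
qed

text \<open>For y = (B - C) x, commutation gives (B + C) y = (B^2 - C^2) x = 0. Both positive forms
  then vanish at y, so B y = C y = 0 and the squared norm of y is the inner product of x with (B -
  C) y, which is 0.\<close>

lemma pos_op_sqrt_unique:
  assumes B: "pos_op B" and C: "pos_op C" and BB: "B \<circ> B = A" and CC: "C \<circ> C = A"
    and comm: "C \<circ> B = B \<circ> C"
  shows "B = C"
proof
  fix x
  note bB = pos_op_bounded_clinear[OF B] and bC = pos_op_bounded_clinear[OF C]
  note lin = bounded_clinear_simps[OF bB] bounded_clinear_simps[OF bC]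
  have sq: "B (B z) = C (C z)" for z using BB CC by (auto simp: fun_eq_iff)
  have cm: "C (B z) = B (C z)" for z using comm by (auto simp: fun_eq_iff)
  define y where "y = B x - C x"
  have "B y + C y = 0" by (simp add: y_def lin sq cm)
  then have "Re (cinner y (B y)) + Re (cinner y (C y)) = 0"
    by (metis cinner_add_right cinner_zero_right plus_complex.sel(1) zero_complex.sel(1))
  then have "Re (cinner y (B y)) = 0" "Re (cinner y (C y)) = 0"
    using pos_op_nonneg[OF B, of y] pos_op_nonneg[OF C, of y] by linarith+
  then have "B y = 0" "C y = 0" using pos_op_eq_0 B C by blast+
  moreover have "cinner y y = cinner x (B y - C y)"
    by (simp add: y_def cinner_diff_left cinner_diff_right pos_op_hermitian[OF B] pos_op_hermitian[OF C] lin)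
  ultimately have "y = 0" by (simp add: cinner_self_eq_0_iff)
  then show "B x = C x" by (simp add: y_def)
qed

text \<open>Any positive \<open>C\<close> with \<open>C \<circ> C = A\<close> commutes with
  \<open>A\<close>, hence with the root built from the power series; this reduces uniqueness to the
  commuting case and makes the description \<open>op_sqrt\<close> meaningful.\<close>

lemma op_sqrt_eqI:
  assumes B: "pos_op B" and BB: "B \<circ> B = A"
  shows "op_sqrt A = B"
proof -
  have "cinner x (A x) = cinner (B x) (B x)" for x
    using BB pos_op_hermitian[OF B, of x "B x"] by (auto simp: fun_eq_iff)
  then have A: "pos_op A"
    using bounded_clinear_comp[OF pos_op_bounded_clinear[OF B] pos_op_bounded_clinear[OF B]] BB
    by (simp add: pos_op_def complex_nonneg_Reals_iff cinner_norm)
  obtain S where S: "pos_op S" "S \<circ> S = A"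
    "\<And>C. bounded_clinear C \<Longrightarrow> C \<circ> A = A \<circ> C \<Longrightarrow> C \<circ> S = S \<circ> C"
    using pos_op_sqrt_exists[OF A] by metis
  have "S = C" if "pos_op C" "C \<circ> C = A" for C
    by (rule pos_op_sqrt_unique[OF S(1) that(1) S(2) that(2)])
      (rule S(3)[OF pos_op_bounded_clinear[OF that(1)]], use that(2) in \<open>auto simp: comp_assoc\<close>)
  then show ?thesis
    unfolding op_sqrt_def by (intro the_equality) (use B BB in auto)
qed

lemma op_sqrt:
  assumes "pos_op A"
  shows "pos_op (op_sqrt A)" and "op_sqrt A \<circ> op_sqrt A = A"
proof -
  obtain S where S: "pos_op S" "S \<circ> S = A" using pos_op_sqrt_exists[OF assms] by metis
  then show "pos_op (op_sqrt A)" "op_sqrt A \<circ> op_sqrt A = A" by (simp_all add: op_sqrt_eqI)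
qed

section \<open>Fidelity with a pure state\<close>

lemma pos_op_scaled_rank1: "0 \<le> r \<Longrightarrow> pos_op (\<lambda>x. complex_of_real r *\<^sub>C rank1 a a x)"
proof -
  assume "0 \<le> r"
  moreover have "cinner x (complex_of_real r *\<^sub>C rank1 a a x) = complex_of_real (r * (cmod (cinner a x))\<^sup>2)" for x
    using complex_norm_square[of "cinner a x"] cinner_commute[of x a]
    by (simp add: rank1_def cinner_scaleC_right)
  ultimately show ?thesis
    by (simp add: pos_op_def bounded_clinear_scale[OF bounded_clinear_rank1] complex_nonneg_Reals_iff
        del: of_real_mult of_real_power)
qed

text \<open>Rank-one operators satisfy (|a><a|)^2 = |a|^2 |a><a|. At \<open>a = 0\<close> the
  convention \<open>1 / 0 = 0\<close> is harmless, as the operator is 0.\<close>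

lemma op_sqrt_rank1: "op_sqrt (rank1 a a) = (\<lambda>x. complex_of_real (1 / norm a) *\<^sub>C rank1 a a x)"
proof (rule op_sqrt_eqI)
  show "pos_op (\<lambda>x. complex_of_real (1 / norm a) *\<^sub>C rank1 a a x)"
    by (rule pos_op_scaled_rank1) simp
  show "(\<lambda>x. complex_of_real (1 / norm a) *\<^sub>C rank1 a a x) \<circ> (\<lambda>x. complex_of_real (1 / norm a) *\<^sub>C rank1 a a x)
      = rank1 a a"
    by (cases "a = 0")
      (auto simp: fun_eq_iff rank1_def scaleC_zero scaleC_scaleC cinner_scaleC_right cinner_norm power2_eq_square)
qed

text \<open>Sandwiching the projector of \<open>w\<close> between two copies of the root of
  \<open>s\<close> gives the rank-one operator of \<open>op_sqrt s w\<close>, and the trace of its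
  root is the norm of that vector.\<close>

lemma fidelity_proj:
  assumes s: "pos_op s"
  shows "fidelity s (proj w) = sqrt (Re (cinner w (s w)))"
proof -
  let ?q = "op_sqrt s"
  let ?u = "?q w"
  have eq: "?q \<circ> rank1 w w \<circ> ?q = rank1 ?u ?u"
    by (rule comp_rank1_adj) (use op_sqrt[OF s] in \<open>auto simp: pos_op_bounded_clinear pos_op_hermitian\<close>)
  have "op_trace (op_sqrt (rank1 ?u ?u)) = of_real (norm ?u)"
  proof -
    have "((\<lambda>e. cinner e (complex_of_real (1 / norm ?u) *\<^sub>C rank1 ?u ?u e)) has_sum
        of_real (1 / norm ?u) * cinner ?u ?u) some_onb"
      unfolding cinner_scaleC_right by (intro has_sum_cmult_right has_sum_rank1)
    then show ?thesis
      unfolding op_trace_def op_sqrt_rank1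
      by (subst infsumI, assumption) (simp add: cinner_norm power2_eq_square)
  qed
  moreover have "(norm ?u)\<^sup>2 = Re (cinner w (s w))"
    using pos_op_hermitian[OF op_sqrt(1)[OF s], of w ?u] fun_cong[OF op_sqrt(2)[OF s], of w]
    by (simp flip: Re_cinner_self)
  then have "norm ?u = sqrt (Re (cinner w (s w)))" by (metis norm_ge_zero real_sqrt_abs abs_of_nonneg)
  ultimately show ?thesis unfolding fidelity_def proj_eq_rank1 eq by simp
qed

text \<open>With \<open>a\<close> normalised, the product of the adjoint with the operator is
  \<open>rank1 b b\<close>, whose square root is explicit.\<close>

lemma trace_class_rank1:
  assumes "norm a = 1"
  shows "trace_class (rank1 a b)"
proof -
  have "adj (rank1 a b) \<circ> rank1 a b = rank1 b b"
    unfolding adj_rank1 using assms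
    by (auto simp: rank1_def fun_eq_iff cinner_scaleC_right cinner_norm)
  moreover have "(\<lambda>e. cinner e (complex_of_real (1 / norm b) *\<^sub>C rank1 b b e)) summable_on some_onb"
    unfolding cinner_scaleC_right
    by (intro summable_on_cmult_right) (use has_sum_rank1 has_sum_imp_summable in blast)
  ultimately show ?thesis
    by (simp add: trace_class_def bounded_clinear_rank1 op_sqrt_rank1)
qed

section \<open>Tensor powers of unitary operators\<close>

text \<open>The indexed form fits the vectors \<open>tensor_vec (map A' cs)\<close>, which are
  orthonormal as a family. The proof is nonnegativity of the squared distance from \<open>x\<close>
  to its projection \<open>u\<close>.\<close>

lemma bessel_family:
  fixes g :: "'i \<Rightarrow> 'a::complex_hilbert"
  assumes F: "finite F" and on: "\<And>i j. i \<in> F \<Longrightarrow> j \<in> F \<Longrightarrow> cinner (g i) (g j) = (if i = j then 1 else 0)"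
  shows "(\<Sum>i\<in>F. (cmod (cinner (g i) x))\<^sup>2) \<le> (norm x)\<^sup>2"
proof -
  define u where "u = (\<Sum>i\<in>F. cinner (g i) x *\<^sub>C g i)"
  have gu: "cinner (g i) u = cinner (g i) x" if "i \<in> F" for i
  proof -
    have "cinner (g i) u = (\<Sum>j\<in>F. if i = j then cinner (g j) x else 0)"
      unfolding u_def cinner_sum_right cinner_scaleC_right
      by (intro sum.cong refl) (simp add: on that)
    then show ?thesis using F that by simp
  qed
  have sq: "cnj z * z = complex_of_real ((cmod z)\<^sup>2)" for z
    using complex_norm_square[of z] by (simp add: mult.commute)
  have uz: "cinner u z = (\<Sum>i\<in>F. cnj (cinner (g i) x) * cinner (g i) z)" for z
    unfolding u_def cinner_sum_left cinner_scaleC_left ..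
  have "cinner u x = of_real (\<Sum>i\<in>F. (cmod (cinner (g i) x))\<^sup>2)"
    unfolding uz sq by simp
  moreover have "cinner u u = cinner u x" unfolding uz by (intro sum.cong refl) (simp add: gu)
  moreover have "cinner x u = cnj (cinner u x)" by (rule cinner_commute)
  ultimately have "cinner (x - u) (x - u) = cinner x x - of_real (\<Sum>i\<in>F. (cmod (cinner (g i) x))\<^sup>2)"
    by (simp add: cinner_diff_left cinner_diff_right)
  then have "Re (cinner (x - u) (x - u)) = (norm x)\<^sup>2 - (\<Sum>i\<in>F. (cmod (cinner (g i) x))\<^sup>2)"
    by (simp add: cinner_norm del: of_real_power)
  then show ?thesis using Re_cinner_self[of "x - u"] by (metis diff_ge_0_iff_ge zero_le_power2)
qed

subsection \<open>The standard basis\<close>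

definition ket :: "'i \<Rightarrow> 'i ell2" where
  "ket i = Abs_ell2 (\<lambda>j. if j = i then 1 else 0)"

lemma coeff_ket: "ell2_coeff (ket i) j = (if j = i then 1 else 0)"
proof -
  have "(\<lambda>j. (cmod (if j = i then 1 else 0))\<^sup>2) summable_on UNIV"
    by (rule finite_nonzero_values_imp_summable_on) (rule finite_subset[of _ "{i}"], auto)
  then show ?thesis unfolding ket_def by (subst Abs_ell2_inverse) auto
qed

lemma cinner_ket: "cinner (ket i) f = ell2_coeff f i"
proof -
  have "cinner (ket i) f = (\<Sum>\<^sub>\<infinity>j\<in>{i}. cnj (ell2_coeff (ket i) j) * ell2_coeff f j)"
    unfolding cinner_ell2_def by (rule infsum_cong_neutral) (auto simp: coeff_ket)
  then show ?thesis by (simp add: coeff_ket)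
qed

lemma is_onb_range_ket: "is_onb (range ket)"
proof -
  have "ket i = ket j \<longleftrightarrow> i = j" for i j :: 'a
    using coeff_ket[of i i] coeff_ket[of j i] by (auto split: if_splits)
  then show ?thesis
    by (auto simp: is_onb_def cinner_ket coeff_ket intro!: ell2_eqI)
qed

definition basis_lists :: "nat \<Rightarrow> 'h::complex_hilbert list set" where
  "basis_lists N = {bs. length bs = N \<and> set bs \<subseteq> some_onb}"

lemma some_onb_orthonormal:
  "x \<in> some_onb \<Longrightarrow> y \<in> some_onb \<Longrightarrow> cinner x y = (if x = y then 1 else 0)"
  using is_onb_some_onb by (auto simp: is_onb_def)

lemma tensor_vec_basis:
  assumes "bs \<in> basis_lists N"
  shows "tensor_vec bs = ket bs"
proof (rule ell2_eqI)
  fix cs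
  have bs: "length bs = N" "set bs \<subseteq> some_onb" using assms by (auto simp: basis_lists_def)
  show "ell2_coeff (tensor_vec bs) cs = ell2_coeff (ket bs) cs"
  proof (cases "cs \<in> basis_lists N")
    case True
    then have cs: "length cs = N" "set cs \<subseteq> some_onb" by (auto simp: basis_lists_def)
    have "ell2_coeff (tensor_vec bs) cs = (\<Prod>k<N. if cs ! k = bs ! k then 1 else 0)"
      using bs cs by (auto simp: coeff_tensor_vec some_onb_orthonormal subset_iff intro!: prod.cong)
    also have "\<dots> = (if cs = bs then 1 else 0)"
    proof (cases "cs = bs")
      case False
      then obtain k where "k < N" "cs ! k \<noteq> bs ! k" using bs cs nth_equalityI by metis
      then have "(\<Prod>k<N. if cs ! k = bs ! k then 1 else 0) = (0 :: complex)"
        by (intro prod_zero) auto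
      then show ?thesis using False by simp
    qed simp
    finally show ?thesis by (simp add: coeff_ket)
  next
    case False
    then show ?thesis using assms by (auto simp: coeff_tensor_vec coeff_ket basis_lists_def)
  qed
qed

lemma tensor_vec_in_space: "tensor_vec xs \<in> tensor_space (length xs)"
  by (auto simp: tensor_space_def coeff_tensor_vec split: if_splits)

lemma coeff_tensor_vec_Cons:
  "ell2_coeff (tensor_vec (x # xs)) (b # cs) =
    (if b \<in> some_onb then cinner b x * ell2_coeff (tensor_vec xs) cs else 0)"
  by (auto simp: coeff_tensor_vec prod.lessThan_Suc_shift simp del: prod.lessThan_Suc)

text \<open>Induction on the length: splitting lists as \<open>b # cs\<close> turns the inner
  product into a double sum, and Parseval evaluates the sum over \<open>b\<close>. Square
  summability of both coefficient families supplies the joint summability for Fubini.\<close>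

lemma cinner_tensor_vec:
  fixes xs ys :: "'a::complex_hilbert list"
  assumes "length xs = length ys"
  shows "cinner (tensor_vec xs) (tensor_vec ys) = (\<Prod>k<length xs. cinner (xs ! k) (ys ! k))"
  using assms
proof (induction xs ys rule: list_induct2)
  case Nil
  have "cinner (tensor_vec []) (tensor_vec ([] :: 'a list)) =
      (\<Sum>\<^sub>\<infinity>bs\<in>{[]}. cnj (ell2_coeff (tensor_vec ([] :: 'a list)) bs) * ell2_coeff (tensor_vec []) bs)"
    unfolding cinner_ell2_def by (rule infsum_cong_neutral) (auto simp: coeff_tensor_vec)
  then show ?case by (simp add: coeff_tensor_vec)
next
  case (Cons x xs y ys)
  let ?f = "\<lambda>bs. cnj (ell2_coeff (tensor_vec (x # xs)) bs) * ell2_coeff (tensor_vec (y # ys)) bs"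
  let ?g = "\<lambda>bs. cnj (ell2_coeff (tensor_vec xs) bs) * ell2_coeff (tensor_vec ys) bs"
  let ?h = "\<lambda>(b, cs). (cinner x b * cinner b y) * ?g cs"
  let ?cons = "\<lambda>(b, cs). b # cs :: 'a list"
  let ?S = "some_onb \<times> (UNIV :: 'a list set)"
  have inj: "inj_on ?cons ?S" by (auto simp: inj_on_def)
  have fh: "(?f \<circ> ?cons) z = ?h z" if "z \<in> ?S" for z
    using that cinner_commute[of x "fst z"] by (auto simp: coeff_tensor_vec_Cons)
  have "?f summable_on ?cons ` ?S" by (intro ell2_summable_mult ell2_coeff_summable)
  then have sum: "?h summable_on ?S"
    unfolding summable_on_reindex[OF inj] using fh by (subst (asm) summable_on_cong) auto
  have "cinner (tensor_vec (x # xs)) (tensor_vec (y # ys)) = infsum ?f (?cons ` ?S)"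
    unfolding cinner_ell2_def
  proof (rule infsum_cong_neutral)
    fix bs assume "bs \<in> UNIV - ?cons ` ?S"
    then have "\<not> (length bs = Suc (length xs) \<and> set bs \<subseteq> some_onb)"
      by (cases bs) (auto simp: image_iff)
    then show "?f bs = 0" by (auto simp: coeff_tensor_vec)
  qed auto
  also have "\<dots> = infsum ?h ?S"
    unfolding infsum_reindex[OF inj] using fh by (intro infsum_cong) auto
  also have "\<dots> = (\<Sum>\<^sub>\<infinity>b\<in>some_onb. \<Sum>\<^sub>\<infinity>cs. ?h (b, cs))"
    by (rule infsum_Sigma_banach[OF sum, symmetric])
  also have "\<dots> = (\<Sum>\<^sub>\<infinity>b\<in>some_onb. (cinner x b * cinner b y) * cinner (tensor_vec xs) (tensor_vec ys))"
    unfolding cinner_ell2_def by (simp only: case_prod_conv infsum_cmult_right')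
  also have "\<dots> = cinner x y * cinner (tensor_vec xs) (tensor_vec ys)"
    unfolding infsum_cmult_left' using infsumI[OF parseval[OF is_onb_some_onb, of x y]] by simp
  finally show ?case
    using Cons by (simp add: prod.lessThan_Suc_shift del: prod.lessThan_Suc)
qed

subsection \<open>Existence of the tensor power\<close>

text \<open>Carries the inverse explicitly as a witness for the adjoint, which keeps the definite
  description \<open>adj\<close> out of the tensor constructions.\<close>

definition unitary_pair :: "('a::complex_hilbert \<Rightarrow> 'a) \<Rightarrow> ('a \<Rightarrow> 'a) \<Rightarrow> bool" where
  "unitary_pair A A' \<longleftrightarrow> (\<forall>x y. cinner (A x) y = cinner x (A' y)) \<and> (\<forall>x. A' (A x) = x) \<and> (\<forall>x. A (A' x) = x)"

lemma unitary_pair_sym: "unitary_pair A A' \<Longrightarrow> unitary_pair A' A"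
  unfolding unitary_pair_def by metis

lemma unitary_pair_cinner: "unitary_pair A A' \<Longrightarrow> cinner (A x) (A y) = cinner x y"
  unfolding unitary_pair_def by metis

lemma unitary_pair_norm:
  assumes "unitary_pair A A'"
  shows "norm (A x) = norm x"
proof -
  have "complex_of_real ((norm (A x))\<^sup>2) = complex_of_real ((norm x)\<^sup>2)"
    using unitary_pair_cinner[OF assms, of x x] by (simp only: cinner_norm)
  then have "(norm (A x))\<^sup>2 = (norm x)\<^sup>2" by (simp only: of_real_eq_iff)
  then show ?thesis by simp
qed

text \<open>The tensor power of \<open>A\<close> through its matrix elements: its coefficient at a
  basis list \<open>cs\<close> is obtained by moving the operator to the left argument, where it
  becomes \<open>A'\<close> applied to each entry of \<open>cs\<close>. This defines it on all of
  the space at once instead of by extension from product vectors.\<close>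

definition tensor_lift :: "nat \<Rightarrow> ('h::complex_hilbert \<Rightarrow> 'h) \<Rightarrow> 'h list ell2 \<Rightarrow> 'h list ell2" where
  "tensor_lift N A' f =
     Abs_ell2 (\<lambda>cs. if cs \<in> basis_lists N then cinner (tensor_vec (map A' cs)) f else 0)"

context
  fixes A A' :: "'h::complex_hilbert \<Rightarrow> 'h" and N :: nat
  assumes AA': "unitary_pair A A'"
begin

lemma tensor_vec_map_orthonormal:
  assumes "bs \<in> basis_lists N" "cs \<in> basis_lists N"
  shows "cinner (tensor_vec (map A' bs)) (tensor_vec (map A' cs)) = (if bs = cs then 1 else 0)"
proof -
  have len: "length bs = N" "length cs = N" using assms by (auto simp: basis_lists_def)
  have "cinner (tensor_vec (map A' bs)) (tensor_vec (map A' cs)) = cinner (tensor_vec bs) (tensor_vec cs)"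
    using len unitary_pair_cinner[OF unitary_pair_sym[OF AA']]
    by (simp add: cinner_tensor_vec)
  then show ?thesis
    using assms by (auto simp: tensor_vec_basis cinner_ket coeff_ket)
qed

lemma tensor_lift_bessel:
  assumes "finite F"
  shows "(\<Sum>cs\<in>F. (cmod (if cs \<in> basis_lists N then cinner (tensor_vec (map A' cs)) f else 0))\<^sup>2) \<le> (norm f)\<^sup>2"
proof -
  have "(\<Sum>cs\<in>F. (cmod (if cs \<in> basis_lists N then cinner (tensor_vec (map A' cs)) f else 0))\<^sup>2)
      = (\<Sum>cs\<in>F \<inter> basis_lists N. (cmod (cinner (tensor_vec (map A' cs)) f))\<^sup>2)"
    using assms by (intro sum.mono_neutral_cong_right) auto
  also have "\<dots> \<le> (norm f)\<^sup>2"
    by (rule bessel_family) (use assms tensor_vec_map_orthonormal in auto)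
  finally show ?thesis .
qed

lemma coeff_tensor_lift:
  "ell2_coeff (tensor_lift N A' f) cs =
    (if cs \<in> basis_lists N then cinner (tensor_vec (map A' cs)) f else 0)"
proof -
  have "(\<lambda>cs. (cmod (if cs \<in> basis_lists N then cinner (tensor_vec (map A' cs)) f else 0))\<^sup>2) summable_on UNIV"
    using tensor_lift_bessel by (intro nonneg_bdd_above_summable_on bdd_aboveI2[of _ _ "(norm f)\<^sup>2"]) auto
  then show ?thesis unfolding tensor_lift_def by (subst Abs_ell2_inverse) auto
qed

lemma tensor_lift_in_ops_on: "tensor_lift N A' \<in> ops_on (tensor_space N)"
proof -
  have "bounded_clinear (tensor_lift N A')"
  proof (rule bounded_clinearI[of _ 1])
    fix f :: "'h list ell2"
    show "norm (tensor_lift N A' f) \<le> norm f * 1"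
    proof (rule ell2_norm_leI)
      fix F :: "'h list set" assume "finite F"
      from real_sqrt_le_mono[OF tensor_lift_bessel[OF this, of f]]
      show "L2_set (\<lambda>i. cmod (ell2_coeff (tensor_lift N A' f) i)) F \<le> norm f * 1"
        unfolding L2_set_def coeff_tensor_lift by simp
    qed
  qed (rule ell2_eqI; simp add: coeff_tensor_lift cinner_add_right cinner_scaleC_right)+
  moreover have "range (tensor_lift N A') \<subseteq> tensor_space N"
    by (auto simp: tensor_space_def coeff_tensor_lift basis_lists_def split: if_splits)
  moreover have "tensor_lift N A' f = 0" if "\<forall>y\<in>tensor_space N. cinner y f = 0" for f
  proof (rule ell2_eqI)
    fix cs
    have "cinner (tensor_vec (map A' cs)) f = 0" if "cs \<in> basis_lists N"
      using that \<open>\<forall>y\<in>tensor_space N. cinner y f = 0\<close> tensor_vec_in_space[of "map A' cs"]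
      by (simp add: basis_lists_def)
    then show "ell2_coeff (tensor_lift N A' f) cs = ell2_coeff 0 cs" by (simp add: coeff_tensor_lift)
  qed
  ultimately show ?thesis by (auto simp: ops_on_def)
qed

lemma tensor_lift_tensor_vec:
  assumes "length xs = N"
  shows "tensor_lift N A' (tensor_vec xs) = tensor_vec (map A xs)"
proof (rule ell2_eqI)
  fix cs
  have "cinner (A' x) y = cinner x (A y)" for x y
    using unitary_pair_sym[OF AA'] by (auto simp: unitary_pair_def)
  then show "ell2_coeff (tensor_lift N A' (tensor_vec xs)) cs = ell2_coeff (tensor_vec (map A xs)) cs"
    using assms by (auto simp: coeff_tensor_lift coeff_tensor_vec basis_lists_def cinner_tensor_vec)
qed

end

text \<open>Kets of basis lists are product vectors, and all other kets are orthogonal to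
  \<open>tensor_space N\<close>, where both operators vanish by definition of \<open>ops_on\<close>.
  This is the uniqueness behind \<open>tensor_pow_op\<close>.\<close>

lemma ops_on_tensor_space_eqI:
  assumes V: "V \<in> ops_on (tensor_space N)" and W: "W \<in> ops_on (tensor_space N)"
    and eq: "\<And>xs. length xs = N \<Longrightarrow> V (tensor_vec xs) = W (tensor_vec xs)"
  shows "V = W"
proof (rule bounded_clinear_eq_onb[OF is_onb_range_ket])
  show "bounded_clinear V" "bounded_clinear W" using V W by (auto simp: ops_on_def)
  fix e :: "'a list ell2" assume "e \<in> range ket"
  then obtain bs where e: "e = ket bs" by blast
  show "V e = W e"
  proof (cases "bs \<in> basis_lists N")
    case True
    then show ?thesis using eq[of bs] tensor_vec_basis[OF True] by (simp add: e basis_lists_def)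
  next
    case False
    have "cinner y (ket bs) = 0" if "y \<in> tensor_space N" for y
      using that False cinner_commute[of y "ket bs"]
      by (auto simp: cinner_ket tensor_space_def basis_lists_def)
    then show ?thesis using V W by (simp add: ops_on_def e)
  qed
qed

lemma tensor_pow_op_eq_lift:
  assumes "unitary_pair A A'"
  shows "tensor_pow_op N A = tensor_lift N A'"
  unfolding tensor_pow_op_def
proof (rule the_equality)
  fix W assume W: "W \<in> ops_on (tensor_space N) \<and> (\<forall>xs. length xs = N \<longrightarrow> W (tensor_vec xs) = tensor_vec (map A xs))"
  then show "W = tensor_lift N A'"
    using tensor_lift_in_ops_on[OF assms] tensor_lift_tensor_vec[OF assms]
    by (intro ops_on_tensor_space_eqI) auto
qed (use tensor_lift_in_ops_on[OF assms] tensor_lift_tensor_vec[OF assms] in auto)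

lemma tensor_pow_op_bounded_clinear: "unitary_pair A A' \<Longrightarrow> bounded_clinear (tensor_pow_op N A)"
  using tensor_lift_in_ops_on[of A A' N] by (simp add: tensor_pow_op_eq_lift ops_on_def)

lemma tensor_pow_op_tensor_pow:
  "unitary_pair A A' \<Longrightarrow> tensor_pow_op N A (tensor_pow N x) = tensor_pow N (A x)"
  by (simp add: tensor_pow_op_eq_lift tensor_pow_def tensor_lift_tensor_vec)

text \<open>On the ket of a basis list the claim is the defining coefficient formula of
  \<open>tensor_lift\<close>; on every other ket both sides are 0. Expansion of \<open>y\<close> in
  kets extends it.\<close>

lemma tensor_pow_op_adjoint:
  assumes A: "unitary_pair A A'"
  shows "cinner (tensor_pow_op N A x) y = cinner x (tensor_pow_op N A' y)"
proof -
  note A' = unitary_pair_sym[OF A]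
  let ?W = "tensor_pow_op N A" and ?W' = "tensor_pow_op N A'"
  have ket: "cinner (?W x) (ket bs) = cinner x (?W' (ket bs))" for bs
  proof (cases "bs \<in> basis_lists N")
    case True
    then have "?W' (ket bs) = tensor_vec (map A' bs)"
      using tensor_lift_tensor_vec[OF A', of bs N] tensor_vec_basis[OF True]
      by (simp add: tensor_pow_op_eq_lift[OF A'] basis_lists_def)
    then show ?thesis
      using True cinner_commute[of "?W x" "ket bs"] cinner_commute[of x "tensor_vec (map A' bs)"]
      by (simp add: cinner_ket tensor_pow_op_eq_lift[OF A] coeff_tensor_lift[OF A])
  next
    case False
    have "cinner z (ket bs) = 0" if "z \<in> tensor_space N" for z
      using that False cinner_commute[of z "ket bs"]
      by (auto simp: cinner_ket tensor_space_def basis_lists_def)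
    then have "?W' (ket bs) = 0"
      using tensor_lift_in_ops_on[OF A', of N] by (simp add: tensor_pow_op_eq_lift[OF A'] ops_on_def)
    then show ?thesis
      using False cinner_commute[of "?W x" "ket bs"]
      by (simp add: cinner_ket tensor_pow_op_eq_lift[OF A] coeff_tensor_lift[OF A])
  qed
  have bl: "bounded_clinear ?W'" by (rule tensor_pow_op_bounded_clinear[OF A'])
  have 1: "((\<lambda>e. cinner (?W x) (cinner e y *\<^sub>C e)) has_sum cinner (?W x) y) (range ket)"
    by (rule has_sum_bounded_linear[OF bounded_linear_cinner_right onb_expansion[OF is_onb_range_ket]])
  have "((\<lambda>e. cinner x (?W' (cinner e y *\<^sub>C e))) has_sum cinner x (?W' y)) (range ket)"
    by (rule has_sum_bounded_linear[OF bounded_linear_cinner_right has_sum_bounded_linear[OF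
        bounded_clinear_bounded_linear[OF bl] onb_expansion[OF is_onb_range_ket]]])
  then have "((\<lambda>e. cinner (?W x) (cinner e y *\<^sub>C e)) has_sum cinner x (?W' y)) (range ket)"
    by (rule has_sum_cong[THEN iffD1, rotated])
      (auto simp: bounded_clinear_simps[OF bl] cinner_scaleC_right ket)
  with 1 show ?thesis by (rule has_sum_unique)
qed

lemma tensor_pow_in_space: "tensor_pow N x \<in> tensor_space N"
  using tensor_vec_in_space[of "replicate N x"] by (simp add: tensor_pow_def)

lemma cinner_tensor_pow: "cinner (tensor_pow N x) (tensor_pow N y) = cinner x y ^ N"
  by (simp add: tensor_pow_def cinner_tensor_vec)

lemma norm_tensor_pow: "norm (tensor_pow N x) = norm x ^ N"
proof -
  have "complex_of_real ((norm (tensor_pow N x))\<^sup>2) = complex_of_real ((norm x ^ N)\<^sup>2)"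
    using cinner_tensor_pow[of N x x] by (simp add: cinner_norm power_mult[symmetric] mult.commute)
  then have "(norm (tensor_pow N x))\<^sup>2 = (norm x ^ N)\<^sup>2" by (simp only: of_real_eq_iff)
  then show ?thesis by (simp add: power2_eq_iff_nonneg)
qed

section \<open>Gram matrices under channels\<close>

text \<open>The finite Cauchy-Schwarz bound is uniform in the finite set, so it yields absolute
  summability together with the estimate. It bounds the error terms when a trace is compared with
  its compression.\<close>

lemma has_sum_cauchy_schwarz:
  fixes h :: "'i \<Rightarrow> complex" and f g :: "'i \<Rightarrow> real"
  assumes f: "(f has_sum a) E" and g: "(g has_sum b) E"
    and nn: "\<And>e. e \<in> E \<Longrightarrow> 0 \<le> f e" "\<And>e. e \<in> E \<Longrightarrow> 0 \<le> g e"
    and h: "\<And>e. e \<in> E \<Longrightarrow> (cmod (h e))\<^sup>2 \<le> f e * g e"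
  shows "h summable_on E" and "cmod (infsum h E) \<le> sqrt a * sqrt b"
proof -
  have fin: "(\<Sum>e\<in>F. cmod (h e)) \<le> sqrt a * sqrt b" if F: "finite F" "F \<subseteq> E" for F
  proof -
    have "(\<Sum>e\<in>F. cmod (h e)) \<le> (\<Sum>e\<in>F. \<bar>sqrt (f e)\<bar> * \<bar>sqrt (g e)\<bar>)"
    proof (rule sum_mono)
      fix e assume "e \<in> F"
      then have "e \<in> E" using F by blast
      then show "cmod (h e) \<le> \<bar>sqrt (f e)\<bar> * \<bar>sqrt (g e)\<bar>"
        using real_sqrt_le_mono[OF h[of e]] nn[of e] by (simp add: real_sqrt_mult)
    qed
    also have "\<dots> \<le> L2_set (\<lambda>e. sqrt (f e)) F * L2_set (\<lambda>e. sqrt (g e)) F"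
      by (rule L2_set_mult_ineq)
    also have "L2_set (\<lambda>e. sqrt (f e)) F = sqrt (\<Sum>e\<in>F. f e)"
      unfolding L2_set_def using F nn(1) by (intro arg_cong[where f = sqrt] sum.cong) auto
    also have "L2_set (\<lambda>e. sqrt (g e)) F = sqrt (\<Sum>e\<in>F. g e)"
      unfolding L2_set_def using F nn(2) by (intro arg_cong[where f = sqrt] sum.cong) auto
    also have "sqrt (\<Sum>e\<in>F. f e) * sqrt (\<Sum>e\<in>F. g e) \<le> sqrt a * sqrt b"
      using finite_sum_le_has_sum[OF f] finite_sum_le_has_sum[OF g] F nn
      by (intro mult_mono real_sqrt_le_mono) (auto intro!: sum_nonneg has_sum_nonneg[OF f])
    finally show ?thesis .
  qed
  have ns: "(\<lambda>e. cmod (h e)) summable_on E"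
    by (rule nonneg_bdd_above_summable_on) (auto intro!: bdd_aboveI2[of _ _ "sqrt a * sqrt b"] fin)
  then show "h summable_on E" by (rule abs_summable_summable)
  have "cmod (infsum h E) \<le> (\<Sum>\<^sub>\<infinity>e\<in>E. cmod (h e))" by (rule norm_infsum_bound[OF ns])
  also have "\<dots> \<le> sqrt a * sqrt b" by (rule infsum_le_finite_sums[OF ns fin])
  finally show "cmod (infsum h E) \<le> sqrt a * sqrt b" .
qed

definition psd_matrix :: "nat \<Rightarrow> (nat \<Rightarrow> nat \<Rightarrow> complex) \<Rightarrow> bool" where
  "psd_matrix n c \<longleftrightarrow> (\<forall>a. (\<Sum>i<n. \<Sum>j<n. cnj (a i) * a j * c i j) \<in> \<real>\<^sub>\<ge>\<^sub>0)"

text \<open>A divergent \<open>infsum\<close> is 0 by convention, so a nonzero value certifies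
  convergence.\<close>

lemma has_sum_op_trace:
  assumes "op_trace s \<noteq> 0"
  shows "((\<lambda>e. cinner e (s e)) has_sum op_trace s) some_onb"
  using assms unfolding op_trace_def by (metis has_sum_infsum infsum_not_exists)

text \<open>With \<open>P\<close> the projection onto \<open>w\<close>, these are the traces of P s
  P and (1 - P) s (1 - P): a state that nearly passes the test \<open>w\<close> has little weight on
  the complement.\<close>

lemma has_sum_compression:
  fixes s :: "'a::complex_hilbert \<Rightarrow> 'a"
  assumes s: "pos_op s" "op_trace s = 1" and w: "norm w = 1"
  defines "P \<equiv> \<lambda>x. cinner w x *\<^sub>C w"
  shows "((\<lambda>e. cinner (P e) (s (P e))) has_sum cinner w (s w)) some_onb"
    and "((\<lambda>e. cinner (e - P e) (s (e - P e))) has_sum 1 - cinner w (s w)) some_onb"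
proof -
  note lin = bounded_clinear_simps[OF pos_op_bounded_clinear[OF s(1)]]
  have wc: "cnj (cinner w e) = cinner e w" for e by (metis cinner_commute)
  have "((\<lambda>e. (cinner w e * cinner e w) * cinner w (s w)) has_sum cinner w w * cinner w (s w)) some_onb"
    by (intro has_sum_cmult_left parseval is_onb_some_onb)
  then show PP: "((\<lambda>e. cinner (P e) (s (P e))) has_sum cinner w (s w)) some_onb"
    using w by (simp add: P_def lin cinner_scaleC_left cinner_scaleC_right wc cinner_norm mult_ac)
  have "((\<lambda>e. cinner (s w) e * cinner e w) has_sum cinner (s w) w) some_onb"
    by (rule parseval[OF is_onb_some_onb])
  then have P1: "((\<lambda>e. cinner (P e) (s e)) has_sum cinner w (s w)) some_onb"
    by (simp add: P_def cinner_scaleC_left wc pos_op_hermitian[OF s(1)] mult_ac)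
  have "((\<lambda>e. cinner w e * cinner e (s w)) has_sum cinner w (s w)) some_onb"
    by (rule parseval[OF is_onb_some_onb])
  then have P2: "((\<lambda>e. cinner e (s (P e))) has_sum cinner w (s w)) some_onb"
    by (simp add: P_def lin cinner_scaleC_right)
  have "((\<lambda>e. cinner e (s e)) has_sum 1) some_onb" using has_sum_op_trace[of s] s(2) by simp
  from has_sum_add[OF has_sum_add[OF this PP] has_sum_uminusI[OF has_sum_add[OF P1 P2]]]
  show "((\<lambda>e. cinner (e - P e) (s (e - P e))) has_sum 1 - cinner w (s w)) some_onb"
    by (simp add: lin cinner_diff_left cinner_diff_right algebra_simps)
qed

lemma quantum_channel_block_pos:
  "quantum_channel S S' \<E> \<Longrightarrow> (\<And>i j. i < n \<Longrightarrow> j < n \<Longrightarrow> X i j \<in> trace_class_on S) \<Longrightarrow> block_pos n X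
    \<Longrightarrow> block_pos n (\<lambda>i j. \<E> (X i j))"
  unfolding quantum_channel_def by blast

lemma quantum_channel_trace:
  "quantum_channel S S' \<E> \<Longrightarrow> X \<in> trace_class_on S \<Longrightarrow>
    \<E> X \<in> trace_class_on S' \<and> op_trace (\<E> X) = op_trace X"
  unfolding quantum_channel_def by blast

text \<open>The quadratic form is the squared modulus of the sum of all
  \<open>cinner (v j) (x j)\<close>.\<close>

lemma block_pos_rank1: "block_pos n (\<lambda>i j. rank1 (v i) (v j))"
  unfolding block_pos_def
proof
  fix x :: "nat \<Rightarrow> 'a"
  define z where "z = (\<Sum>j<n. cinner (v j) (x j))"
  have "(\<Sum>i<n. \<Sum>j<n. cinner (x i) (rank1 (v i) (v j) (x j))) = cnj z * z"
    unfolding z_def cnj_sum sum_product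
    by (intro sum.cong refl) (simp add: rank1_def cinner_scaleC_right cinner_commute[of _ "v _"])
  also have "cnj z * z = of_real ((cmod z)\<^sup>2)" using complex_norm_square[of z] by (simp add: mult.commute)
  finally show "(\<Sum>i<n. \<Sum>j<n. cinner (x i) (rank1 (v i) (v j) (x j))) \<in> \<real>\<^sub>\<ge>\<^sub>0"
    by (simp add: complex_nonneg_Reals_iff del: of_real_power)
qed

text \<open>
  Complete positivity makes \<open>\<langle>w\<^sub>i|\<E>(|v\<^sub>i\<rangle>\<langle>v\<^sub>j|)|w\<^sub>j\<rangle>\<close> a positive semidefinite matrix. When
  \<open>\<E>(|v\<^sub>i\<rangle>\<langle>v\<^sub>i|)\<close> is almost \<open>|w\<^sub>i\<rangle>\<langle>w\<^sub>i|\<close>, the block \<open>\<E>(|v\<^sub>i\<rangle>\<langle>v\<^sub>j|)\<close> is almost a multiple of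
  \<open>|w\<^sub>i\<rangle>\<langle>w\<^sub>j|\<close>, and taking traces compares the two Gram matrices.
\<close>

lemma channel_gram_matrix:
  fixes v w :: "nat \<Rightarrow> 'a::complex_hilbert"
  assumes E: "quantum_channel S S' \<E>" and S: "\<And>a x. x \<in> S \<Longrightarrow> a *\<^sub>C x \<in> S"
    and v: "\<And>i. i < n \<Longrightarrow> v i \<in> S" "\<And>i. i < n \<Longrightarrow> norm (v i) = 1"
    and w: "\<And>i. i < n \<Longrightarrow> norm (w i) = 1"
    and near: "\<And>i. i < n \<Longrightarrow> 1 - \<eta> \<le> Re (cinner (w i) (\<E> (rank1 (v i) (v i)) (w i)))"
  defines "c \<equiv> \<lambda>i j. cinner (w i) (\<E> (rank1 (v i) (v j)) (w j))"
  shows "psd_matrix n c"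
    and "i < n \<Longrightarrow> Re (c i i) \<le> 1"
    and "i < n \<Longrightarrow> j < n \<Longrightarrow> cmod (cinner (v j) (v i) - c i j * cinner (w j) (w i)) \<le> 2 * sqrt \<eta>"
proof -
  define Y where "Y = (\<lambda>i j. \<E> (rank1 (v i) (v j)))"
  have cY: "c i j = cinner (w i) (Y i j (w j))" for i j by (simp add: c_def Y_def)
  have tc: "rank1 (v i) (v j) \<in> trace_class_on S" if "i < n" "j < n" for i j
    using v that S by (auto simp: trace_class_on_def ops_on_def bounded_clinear_rank1 trace_class_rank1)
      (auto simp: rank1_def)
  have bY: "bounded_clinear (Y i j)" if "i < n" "j < n" for i j
    using quantum_channel_trace[OF E tc[OF that]] by (auto simp: Y_def trace_class_on_def ops_on_def)
  have bp: "block_pos n Y"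
    unfolding Y_def by (rule quantum_channel_block_pos[OF E tc block_pos_rank1])
  show "psd_matrix n c"
    unfolding psd_matrix_def
  proof
    fix a :: "nat \<Rightarrow> complex"
    have "(\<Sum>i<n. \<Sum>j<n. cnj (a i) * a j * c i j) = (\<Sum>i<n. \<Sum>j<n. cinner (a i *\<^sub>C w i) (Y i j (a j *\<^sub>C w j)))"
      by (intro sum.cong refl)
        (auto simp: cY bounded_clinear_simps[OF bY] cinner_scaleC_left cinner_scaleC_right)
    also have "\<dots> \<in> \<real>\<^sub>\<ge>\<^sub>0" using bp unfolding block_pos_def by (rule allE)
    finally show "(\<Sum>i<n. \<Sum>j<n. cnj (a i) * a j * c i j) \<in> \<real>\<^sub>\<ge>\<^sub>0" .
  qed
  have cs: "(cmod (cinner x (Y i j y)))\<^sup>2 \<le> Re (cinner x (Y i i x)) * Re (cinner y (Y j j y))"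
    if ij: "i < n" "j < n" for i j x y
  proof (rule psd2_cauchy_schwarz(2)[where q' = "cinner y (Y j i x)"])
    fix a b
    \<comment> \<open>The indices \<open>i\<close> and \<open>j\<close> are made into a 2-by-2 block
      matrix of their own, which also covers \<open>i = j\<close>.\<close>
    define k where "k = (\<lambda>l::nat. if l = 0 then i else j)"
    define u where "u = (\<lambda>l::nat. if l = 0 then a *\<^sub>C x else b *\<^sub>C y)"
    have "block_pos 2 (\<lambda>l m. Y (k l) (k m))"
      unfolding Y_def using ij
      by (intro quantum_channel_block_pos[OF E tc] block_pos_rank1[of 2 "\<lambda>l. v (k l)"]) (auto simp: k_def)
    then have "(\<Sum>l<2. \<Sum>m<2. cinner (u l) (Y (k l) (k m) (u m))) \<in> \<real>\<^sub>\<ge>\<^sub>0"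
      unfolding block_pos_def by (rule allE)
    then show "cnj a * a * cinner x (Y i i x) + cnj a * b * cinner x (Y i j y)
        + cnj b * a * cinner y (Y j i x) + cnj b * b * cinner y (Y j j y) \<in> \<real>\<^sub>\<ge>\<^sub>0"
      using ij by (simp add: numeral_2_eq_2 u_def k_def bounded_clinear_simps[OF bY] cinner_scaleC_left
          cinner_scaleC_right algebra_simps)
  qed
  have pos: "pos_op (Y i i)" if "i < n" for i
  proof -
    have "block_pos 1 (\<lambda>l m. Y i i)"
      unfolding Y_def using that
      by (intro quantum_channel_block_pos[OF E tc] block_pos_rank1[of 1 "\<lambda>l. v i"]) auto
    then have "cinner x (Y i i x) \<in> \<real>\<^sub>\<ge>\<^sub>0" for x
      unfolding block_pos_def by (auto dest: spec[of _ "\<lambda>_. x"])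
    then show ?thesis using bY[OF that that] by (simp add: pos_op_def)
  qed
  have tr: "op_trace (Y i j) = cinner (v j) (v i)" if "i < n" "j < n" for i j
    using quantum_channel_trace[OF E tc[OF that]] by (simp add: Y_def op_trace_rank1)
  have tr1: "op_trace (Y i i) = 1" if "i < n" for i
    using tr[OF that that] v(2)[OF that] by (simp add: cinner_norm)
  define P where "P = (\<lambda>i x. cinner (w i) x *\<^sub>C w i)"
  have hP: "((\<lambda>e. Re (cinner (P i e) (Y i i (P i e)))) has_sum Re (c i i)) some_onb"
    and hQ: "((\<lambda>e. Re (cinner (e - P i e) (Y i i (e - P i e)))) has_sum 1 - Re (c i i)) some_onb"
    if "i < n" for i
    using has_sum_compression[OF pos tr1 w, OF that that that, THEN has_sum_Re]
    unfolding P_def cY by simp_all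
  have hY: "((\<lambda>e. Re (cinner e (Y i i e))) has_sum 1) some_onb" if "i < n" for i
    using has_sum_Re[OF has_sum_op_trace[of "Y i i"]] tr1[OF that] by simp
  show c1: "Re (c i i) \<le> 1" if "i < n" for i
    using has_sum_nonneg[OF hQ[OF that]] pos_op_nonneg[OF pos[OF that]] by simp
  show "cmod (cinner (v j) (v i) - c i j * cinner (w j) (w i)) \<le> 2 * sqrt \<eta>" if ij: "i < n" "j < n"
  proof -
    \<comment> \<open>With \<open>Y = Y i j\<close>, the trace is split as tr((1 - P_i) Y) + tr(P_i
      Y (1 - P_j)) + tr(P_i Y P_j). Each of the first two is at most \<open>sqrt \<eta>\<close> by
      Cauchy-Schwarz, since the diagonal blocks have little weight off \<open>w i\<close> and
      \<open>w j\<close>; the third is \<open>c i j * cinner (w j) (w i)\<close>.\<close>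
    let ?f = "\<lambda>e. cinner (e - P i e) (Y i j e)"
    let ?g = "\<lambda>e. cinner (P i e) (Y i j (e - P j e))"
    let ?h = "\<lambda>e. cinner (P i e) (Y i j (P j e))"
    note csf = has_sum_cauchy_schwarz[OF hQ[OF ij(1)] hY[OF ij(2)], of ?f]
    note csg = has_sum_cauchy_schwarz[OF hP[OF ij(1)] hQ[OF ij(2)], of ?g]
    have f: "?f summable_on some_onb" "cmod (infsum ?f some_onb) \<le> sqrt (1 - Re (c i i)) * sqrt 1"
      using csf cs[OF ij] pos_op_nonneg[OF pos[OF ij(1)]] pos_op_nonneg[OF pos[OF ij(2)]] by blast+
    have g: "?g summable_on some_onb" "cmod (infsum ?g some_onb) \<le> sqrt (Re (c i i)) * sqrt (1 - Re (c j j))"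
      using csg cs[OF ij] pos_op_nonneg[OF pos[OF ij(1)]] pos_op_nonneg[OF pos[OF ij(2)]] by blast+
    have "((\<lambda>e. c i j * (cinner (w j) e * cinner e (w i))) has_sum c i j * cinner (w j) (w i)) some_onb"
      by (intro has_sum_cmult_right parseval is_onb_some_onb)
    then have h: "(?h has_sum c i j * cinner (w j) (w i)) some_onb"
      by (simp add: P_def cY bounded_clinear_simps[OF bY[OF ij]] cinner_scaleC_left
          cinner_scaleC_right cinner_commute[symmetric] mult_ac)
    have "((\<lambda>e. ?f e + ?g e + ?h e) has_sum infsum ?f some_onb + infsum ?g some_onb + c i j * cinner (w j) (w i)) some_onb"
      by (intro has_sum_add has_sum_infsum f g h)
    then have "((\<lambda>e. cinner e (Y i j e)) has_sum infsum ?f some_onb + infsum ?g some_onb + c i j * cinner (w j) (w i)) some_onb"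
      by (simp add: bounded_clinear_simps[OF bY[OF ij]] cinner_diff_left cinner_diff_right)
    then have "op_trace (Y i j) = infsum ?f some_onb + infsum ?g some_onb + c i j * cinner (w j) (w i)"
      unfolding op_trace_def by (rule infsumI)
    then have "cmod (cinner (v j) (v i) - c i j * cinner (w j) (w i)) \<le> cmod (infsum ?f some_onb) + cmod (infsum ?g some_onb)"
      using norm_triangle_ineq by (simp add: tr[OF ij])
    also have "\<dots> \<le> sqrt (1 - Re (c i i)) + sqrt (Re (c i i)) * sqrt (1 - Re (c j j))"
      using f(2) g(2) by simp
    also have "\<dots> \<le> sqrt \<eta> + 1 * sqrt \<eta>"
      using near[OF ij(1)] near[OF ij(2)] c1[OF ij(1)] c1[OF ij(2)]
      by (intro add_mono mult_mono) (auto simp: c_def)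
    finally show ?thesis by simp
  qed
qed

section \<open>Covariant channels on tensor powers of orbit vectors\<close>

lemma unitary_rep_one:
  assumes "group G" "unitary_rep G T U"
  shows "U \<one>\<^bsub>G\<^esub> x = x"
proof -
  interpret group G by fact
  \<comment> \<open>\<open>U \<one>\<close> is idempotent and surjective, hence the
    identity.\<close>
  obtain z where "x = U \<one>\<^bsub>G\<^esub> z" using assms(2) one_closed unfolding unitary_rep_def by (metis surjD)
  then show ?thesis using assms(2) unfolding unitary_rep_def by (metis comp_apply one_closed l_one)
qed

lemma unitary_rep_pair:
  assumes "group G" "unitary_rep G T U" "g \<in> carrier G"
  shows "unitary_pair (U g) (U (inv\<^bsub>G\<^esub> g))"
proof -
  interpret group G by fact
  have U: "\<And>g h x. g \<in> carrier G \<Longrightarrow> h \<in> carrier G \<Longrightarrow> U (g \<otimes>\<^bsub>G\<^esub> h) x = U g (U h x)"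
    and iso: "\<And>g x y. g \<in> carrier G \<Longrightarrow> cinner (U g x) (U g y) = cinner x y"
    using assms(2) by (auto simp: unitary_rep_def)
  note one = unitary_rep_one[OF assms(1,2)]
  have "U (inv\<^bsub>G\<^esub> g) (U g x) = x" "U g (U (inv\<^bsub>G\<^esub> g) x) = x" for x
    using U[of "inv\<^bsub>G\<^esub> g" g x] U[of g "inv\<^bsub>G\<^esub> g" x] assms(3) one by auto
  then show ?thesis unfolding unitary_pair_def using iso[OF assms(3)] by metis
qed

text \<open>The group elements may depend on \<open>N\<close>, so that they can approach the
  identity at rate \<open>1/\<surd>N\<close>. The error parameter is
  \<open>\<eta> = 1 - F N\<close>, where \<open>F N\<close> is the square of the fidelity.\<close>

lemma asymptotic_transformation_gram:
  fixes U :: "'g \<Rightarrow> 'h::complex_hilbert \<Rightarrow> 'h" and g :: "nat \<Rightarrow> nat \<Rightarrow> 'g"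
  assumes G: "group G" and U: "unitary_rep G T U" and \<psi>: "norm \<psi> = 1" and \<phi>: "norm \<phi> = 1"
    and asym: "asymptotic_transformation G U \<psi> \<phi> R"
    and g: "\<And>N i. i < n \<Longrightarrow> g N i \<in> carrier G"
  obtains c where "\<And>N. psd_matrix n (c N)"
    and "\<And>N i. i < n \<Longrightarrow> Re (c N i i) \<le> 1"
    and "\<And>i. i < n \<Longrightarrow> (\<lambda>N. Re (c N i i)) \<longlonglongrightarrow> 1"
    and "\<And>i j. i < n \<Longrightarrow> j < n \<Longrightarrow>
      (\<lambda>N. cinner (U (g N j) \<psi>) (U (g N i) \<psi>) ^ N -
           c N i j * cinner (U (g N j) \<phi>) (U (g N i) \<phi>) ^ nat \<lfloor>real N * R\<rfloor>) \<longlonglongrightarrow> 0"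
proof -
  define M where "M = (\<lambda>N::nat. nat \<lfloor>real N * R\<rfloor>)"
  from asym obtain \<sigma> where \<sigma>: "\<And>N. \<sigma> N \<in> states_on (tensor_space (M N))"
    and ex: "\<forall>N. \<exists>\<E>. covariant_channel G (tensor_space N) (\<lambda>g. tensor_pow_op N (U g))
                    (tensor_space (M N)) (\<lambda>g. tensor_pow_op (M N) (U g)) \<E> \<and>
                  \<E> (proj (tensor_pow N \<psi>)) = \<sigma> N"
    and fid: "(\<lambda>N. fidelity (\<sigma> N) (proj (tensor_pow (M N) \<phi>))) \<longlonglongrightarrow> 1"
    unfolding asymptotic_transformation_def Let_def M_def by blast
  from ex obtain \<E> where cov: "\<And>N. covariant_channel G (tensor_space N) (\<lambda>g. tensor_pow_op N (U g))
                    (tensor_space (M N)) (\<lambda>g. tensor_pow_op (M N) (U g)) (\<E> N)"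
    and E\<psi>: "\<And>N. \<E> N (proj (tensor_pow N \<psi>)) = \<sigma> N"
    by metis
  have E: "quantum_channel (tensor_space N) (tensor_space (M N)) (\<E> N)" for N
    using cov by (simp add: covariant_channel_def)
  have up: "unitary_pair (U (g N i)) (U (inv\<^bsub>G\<^esub> (g N i)))" if "i < n" for N i
    by (rule unitary_rep_pair[OF G U g[OF that]])
  define F where "F = (\<lambda>N. Re (cinner (tensor_pow (M N) \<phi>) (\<sigma> N (tensor_pow (M N) \<phi>))))"
  have "(\<lambda>N. sqrt (F N)) \<longlonglongrightarrow> 1"
    using fid \<sigma> by (simp add: fidelity_proj states_on_def F_def)
  then have "(\<lambda>N. (sqrt (F N))\<^sup>2) \<longlonglongrightarrow> 1\<^sup>2" by (intro tendsto_power)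
  moreover have "F N \<ge> 0" for N using \<sigma> by (simp add: F_def pos_op_nonneg states_on_def)
  ultimately have F1: "F \<longlonglongrightarrow> 1" by simp
  define v where "v = (\<lambda>N i. tensor_pow N (U (g N i) \<psi>))"
  define w where "w = (\<lambda>N i. tensor_pow (M N) (U (g N i) \<phi>))"
  define c where "c = (\<lambda>N i j. cinner (w N i) (\<E> N (rank1 (v N i) (v N j)) (w N j)))"
  have nU: "norm (U (g N i) x) = norm x" if "i < n" for N i x
    by (rule unitary_pair_norm[OF up[OF that]])
  have nv: "norm (v N i) = 1" and nw: "norm (w N i) = 1" if "i < n" for N i
    using nU[OF that] \<psi> \<phi> by (simp_all add: v_def w_def norm_tensor_pow)
  have tspace: "a *\<^sub>C x \<in> tensor_space m" if "x \<in> tensor_space m" for m a and x :: "'h list ell2"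
    using that by (auto simp: tensor_space_def)
  \<comment> \<open>Covariance enters here: the image of the rotated input is the rotated image, so
    rotating back makes every diagonal entry equal to the one at the identity.\<close>
  have diag: "cinner (w N i) (\<E> N (rank1 (v N i) (v N i)) (w N i)) =
      cinner (tensor_pow (M N) \<phi>) (\<sigma> N (tensor_pow (M N) \<phi>))" if i: "i < n" for N i
  proof -
    let ?A = "tensor_pow_op N (U (g N i))" and ?B = "tensor_pow_op (M N) (U (g N i))"
    let ?A' = "tensor_pow_op N (U (inv\<^bsub>G\<^esub> (g N i)))" and ?B' = "tensor_pow_op (M N) (U (inv\<^bsub>G\<^esub> (g N i)))"
    have adjA: "adj ?A = ?A'" and adjB: "adj ?B = ?B'"
      by (rule adj_eqI, rule tensor_pow_op_adjoint[OF up[OF i]])+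
    let ?x = "tensor_pow N \<psi>" and ?y = "tensor_pow (M N) \<phi>"
    have X: "rank1 ?x ?x \<in> trace_class_on (tensor_space N)"
      using \<psi> tspace[OF tensor_pow_in_space] tensor_pow_in_space[of N \<psi>]
      by (auto simp: trace_class_on_def ops_on_def bounded_clinear_rank1 trace_class_rank1 norm_tensor_pow)
        (auto simp: rank1_def)
    have "?A \<circ> rank1 ?x ?x \<circ> ?A' = rank1 (v N i) (v N i)"
      using comp_rank1_adj[OF tensor_pow_op_bounded_clinear[OF up[OF i]] tensor_pow_op_adjoint[OF up[OF i]]]
      by (simp add: v_def tensor_pow_op_tensor_pow[OF up[OF i]])
    then have "\<E> N (rank1 (v N i) (v N i)) = ?B \<circ> \<sigma> N \<circ> ?B'"
      using cov[of N] g[OF i] X E\<psi>[of N]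
      unfolding covariant_channel_def proj_eq_rank1 adjA[symmetric] adjB[symmetric] by metis
    moreover have "?B' (w N i) = ?y"
      using tensor_pow_op_tensor_pow[OF unitary_pair_sym[OF up[OF i]]] up[OF i]
      by (simp add: w_def unitary_pair_def)
    moreover have "cinner (w N i) (?B z) = cinner (?B' (w N i)) z" for z
      using tensor_pow_op_adjoint[OF unitary_pair_sym[OF up[OF i]]] by simp
    ultimately show ?thesis by simp
  qed
  have near: "1 - (1 - F N) \<le> Re (cinner (w N i) (\<E> N (rank1 (v N i) (v N i)) (w N i)))" if "i < n" for N i
    by (simp add: diag[OF that] F_def)
  have vS: "v N i \<in> tensor_space N" for N i by (simp add: v_def tensor_pow_in_space)
  show ?thesis
  proof
    show "psd_matrix n (c N)" for N
      unfolding c_def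
      by (rule channel_gram_matrix(1)[OF E, where \<eta> = "1 - F N"]) (use tspace vS nv nw near in auto)
    show "Re (c N i i) \<le> 1" if "i < n" for N i
      unfolding c_def
      by (rule channel_gram_matrix(2)[OF E, where \<eta> = "1 - F N" and n = n]) (use tspace vS nv nw near that in auto)
    show "(\<lambda>N. Re (c N i i)) \<longlonglongrightarrow> 1" if "i < n" for i
      using F1 by (simp add: c_def diag[OF that] F_def)
    fix i j assume ij: "i < n" "j < n"
    have "cmod (cinner (v N j) (v N i) - c N i j * cinner (w N j) (w N i)) \<le> 2 * sqrt (1 - F N)" for N
      unfolding c_def
      by (rule channel_gram_matrix(3)[OF E, where n = n]) (use tspace vS nv nw near ij in auto)
    then have "\<forall>\<^sub>F N in sequentially. cmod (cinner (v N j) (v N i) - c N i j * cinner (w N j) (w N i)) \<le> 2 * sqrt (1 - F N)"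
      by simp
    moreover have "(\<lambda>N. 2 * sqrt (1 - F N)) \<longlonglongrightarrow> 0"
      using tendsto_mult_left[OF tendsto_real_sqrt[OF tendsto_diff[OF tendsto_const F1]], of 2 1] by simp
    ultimately have "(\<lambda>N. cinner (v N j) (v N i) - c N i j * cinner (w N j) (w N i)) \<longlonglongrightarrow> 0"
      by (rule Lim_null_comparison)
    then show "(\<lambda>N. cinner (U (g N j) \<psi>) (U (g N i) \<psi>) ^ N -
           c N i j * cinner (U (g N j) \<phi>) (U (g N i) \<phi>) ^ nat \<lfloor>real N * R\<rfloor>) \<longlonglongrightarrow> 0"
      by (simp add: v_def w_def cinner_tensor_pow M_def)
  qed
qed

section \<open>Limits of powers of Gram matrices\<close>

text \<open>Caratheodory's form of the derivative of \<open>Ln\<close> at 1 writes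
  \<open>Ln z = g z * (z - 1)\<close> with \<open>g\<close> continuous at 1 and
  \<open>g 1 = 1\<close>. Then \<open>m * Ln z\<close> is the product of \<open>m / N\<close>,
  \<open>g z\<close> and \<open>N * (z - 1)\<close>, each of which converges.\<close>

lemma power_tendsto_exp:
  fixes z :: "nat \<Rightarrow> complex"
  assumes z: "(\<lambda>N. of_nat N * (z N - 1)) \<longlonglongrightarrow> w" and m: "(\<lambda>N. real (m N) / real N) \<longlonglongrightarrow> r"
  shows "(\<lambda>N. z N ^ m N) \<longlonglongrightarrow> exp (of_real r * w)"
proof -
  have "(\<lambda>N. inverse (of_nat N) * (of_nat N * (z N - 1))) \<longlonglongrightarrow> 0 * w"
    by (intro tendsto_mult z lim_inverse_n)
  moreover have "\<forall>\<^sub>F N in sequentially. inverse (of_nat N) * (of_nat N * (z N - 1)) = z N - 1"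
    using eventually_gt_at_top[of 0] by eventually_elim simp
  ultimately have "(\<lambda>N. z N - 1) \<longlonglongrightarrow> 0" using Lim_transform_eventually by fastforce
  then have z1: "z \<longlonglongrightarrow> 1" using LIM_zero_iff by blast
  have "DERIV Ln 1 :> 1" using has_field_derivative_Ln[of 1] by simp
  then obtain g where g: "\<And>z. Ln z - Ln 1 = g z * (z - 1)" "isCont g 1" "g 1 = 1"
    unfolding CARAT_DERIV by blast
  have gz: "(\<lambda>N. g (z N)) \<longlonglongrightarrow> 1" using isCont_tendsto_compose[OF g(2) z1] g(3) by simp
  have "(\<lambda>N. of_real (real (m N) / real N) * (g (z N) * (of_nat N * (z N - 1)))) \<longlonglongrightarrow> of_real r * (1 * w)"
    by (intro tendsto_mult tendsto_of_real m gz z)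
  then have "(\<lambda>N. exp (of_real (real (m N) / real N) * (g (z N) * (of_nat N * (z N - 1))))) \<longlonglongrightarrow> exp (of_real r * (1 * w))"
    by (rule tendsto_exp)
  moreover have "\<forall>\<^sub>F N in sequentially.
      exp (of_real (real (m N) / real N) * (g (z N) * (of_nat N * (z N - 1)))) = z N ^ m N"
    using eventually_gt_at_top[of 0] tendsto_imp_eventually_ne[OF z1 one_neq_zero]
  proof eventually_elim
    case (elim N)
    have eq: "of_real (real (m N) / real N) * (g (z N) * (of_nat N * (z N - 1))) = of_nat (m N) * Ln (z N)"
      using elim g(1)[of "z N"] by simp
    show ?case unfolding eq exp_of_nat_mult using elim by simp
  qed
  ultimately show ?thesis by (simp add: Lim_transform_eventually)
qed

lemma nat_floor_mult_over:
  assumes "R > 0"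
  shows "(\<lambda>N. real (nat \<lfloor>real N * R\<rfloor>) / real N) \<longlonglongrightarrow> R"
proof (rule tendsto_sandwich)
  have lim: "(\<lambda>N. R - 1 / real N) \<longlonglongrightarrow> R"
    using tendsto_diff[OF tendsto_const lim_inverse_n', of R] by simp
  show "(\<lambda>N. R - 1 / real N) \<longlonglongrightarrow> R" by (rule lim)
  have bd: "real N * R - 1 \<le> real (nat \<lfloor>real N * R\<rfloor>)" "real (nat \<lfloor>real N * R\<rfloor>) \<le> real N * R" for N
    using assms by (auto simp: of_nat_nat zero_le_mult_iff)
  show "\<forall>\<^sub>F N in sequentially. R - 1 / real N \<le> real (nat \<lfloor>real N * R\<rfloor>) / real N"
    using eventually_gt_at_top[of 0]
  proof eventually_elim
    case (elim N)
    then have "R - 1 / real N = (real N * R - 1) / real N" by (simp add: field_simps)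
    then show ?case using divide_right_mono[OF bd(1)[of N], of "real N"] by simp
  qed
  show "\<forall>\<^sub>F N in sequentially. real (nat \<lfloor>real N * R\<rfloor>) / real N \<le> R"
    using eventually_gt_at_top[of 0]
  proof eventually_elim
    case (elim N)
    then show ?case using divide_right_mono[OF bd(2)[of N], of "real N"] by simp
  qed
qed simp

text \<open>
  With \<open>u \<approx> \<psi> + P/\<surd>N\<close> and \<open>v \<approx> \<psi> + Q/\<surd>N\<close>, the first-order terms of the Bargmann invariant
  \<open>\<langle>\<psi>|u\<rangle>\<langle>u|v\<rangle>\<langle>v|\<psi>\<rangle>\<close> cancel up to \<open>2 Re \<langle>\<psi>|u - \<psi>\<rangle> = - \<parallel>u - \<psi>\<parallel>\<^sup>2\<close>, so that first-order
  information about \<open>u\<close> and \<open>v\<close> determines it up to \<open>o(1/N)\<close>.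
\<close>

definition bargmann_exponent :: "'a::complex_hilbert \<Rightarrow> 'a \<Rightarrow> 'a \<Rightarrow> complex" where
  "bargmann_exponent \<psi> P Q = - cinner P P - cinner Q Q + cinner P Q
     + cinner \<psi> P * (cinner P \<psi> + cinner \<psi> Q) + cinner \<psi> P * cinner Q \<psi>
     + (cinner P \<psi> + cinner \<psi> Q) * cinner Q \<psi>"

lemma bargmann_invariant_limit:
  fixes \<psi> :: "'a::complex_hilbert"
  assumes \<psi>: "norm \<psi> = 1" and nu: "\<And>N. norm (u N) = 1" and nv: "\<And>N. norm (v N) = 1"
    and u: "(\<lambda>N. sqrt (real N) *\<^sub>R (u N - \<psi>)) \<longlonglongrightarrow> P" and v: "(\<lambda>N. sqrt (real N) *\<^sub>R (v N - \<psi>)) \<longlonglongrightarrow> Q"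
  shows "(\<lambda>N. of_nat N * (cinner \<psi> (u N) * cinner (u N) (v N) * cinner (v N) \<psi> - 1))
    \<longlonglongrightarrow> bargmann_exponent \<psi> P Q"
proof -
  define p where "p = (\<lambda>N. sqrt (real N) *\<^sub>R (u N - \<psi>))"
  define q where "q = (\<lambda>N. sqrt (real N) *\<^sub>R (v N - \<psi>))"
  define e where "e = (\<lambda>N. 1 / sqrt (real N))"
  have p: "p \<longlonglongrightarrow> P" and q: "q \<longlonglongrightarrow> Q" using u v by (simp_all add: p_def q_def)
  have e: "(\<lambda>N. complex_of_real (e N)) \<longlonglongrightarrow> 0"
  proof -
    have "(\<lambda>N. sqrt (1 / real N)) \<longlonglongrightarrow> sqrt 0" by (intro tendsto_real_sqrt lim_inverse_n')
    then have "e \<longlonglongrightarrow> 0" by (simp add: e_def real_sqrt_divide)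
    then have "(\<lambda>N. complex_of_real (e N)) \<longlonglongrightarrow> complex_of_real 0" by (rule tendsto_of_real)
    then show ?thesis by simp
  qed
  \<comment> \<open>The rescaled deviation, exact for positive \<open>N\<close>: the terms with a
    remaining factor \<open>e N\<close>, which stands for \<open>1/\<surd>N\<close>, are kept here
    and vanish in the limit.\<close>
  let ?E = "\<lambda>N. - cinner (p N) (p N) - cinner (q N) (q N) + cinner (p N) (q N)
     + cinner \<psi> (p N) * (cinner (p N) \<psi> + cinner \<psi> (q N) + e N * cinner (p N) (q N)) + cinner \<psi> (p N) * cinner (q N) \<psi>
     + (cinner (p N) \<psi> + cinner \<psi> (q N) + e N * cinner (p N) (q N)) * cinner (q N) \<psi>
     + e N * (cinner \<psi> (p N) * (cinner (p N) \<psi> + cinner \<psi> (q N) + e N * cinner (p N) (q N)) * cinner (q N) \<psi>)"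
  have "?E \<longlonglongrightarrow> - cinner P P - cinner Q Q + cinner P Q
     + cinner \<psi> P * (cinner P \<psi> + cinner \<psi> Q + 0 * cinner P Q) + cinner \<psi> P * cinner Q \<psi>
     + (cinner P \<psi> + cinner \<psi> Q + 0 * cinner P Q) * cinner Q \<psi>
     + 0 * (cinner \<psi> P * (cinner P \<psi> + cinner \<psi> Q + 0 * cinner P Q) * cinner Q \<psi>)"
    by (intro tendsto_intros tendsto_cinner p q e)
  then have lim: "?E \<longlonglongrightarrow> bargmann_exponent \<psi> P Q" by (simp add: bargmann_exponent_def)
  have "\<forall>\<^sub>F N in sequentially. ?E N =
      of_nat N * (cinner \<psi> (u N) * cinner (u N) (v N) * cinner (v N) \<psi> - 1)"
    using eventually_gt_at_top[of 0]
  proof eventually_elim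
    case (elim N)
    define E where "E = complex_of_real (e N)"
    have N: "of_nat N * (E * E) = 1"
    proof -
      have "real N * (e N * e N) = 1" using elim by (simp add: e_def)
      then have "complex_of_real (real N * (e N * e N)) = 1" by simp
      then show ?thesis by (simp add: E_def)
    qed
    have uN: "u N = \<psi> + e N *\<^sub>R p N" and vN: "v N = \<psi> + e N *\<^sub>R q N"
      using elim by (simp_all add: p_def q_def e_def)
    have pp: "E * (cinner \<psi> (p N) + cinner (p N) \<psi>) = - (E * E * cinner (p N) (p N))"
    proof -
      have "cinner (u N) (u N) = 1 + (E * (cinner \<psi> (p N) + cinner (p N) \<psi>) + E * E * cinner (p N) (p N))"
        using \<psi> unfolding uN
        by (simp add: cinner_add_left cinner_add_right cinner_scaleR_left cinner_scaleR_right
            cinner_norm[of \<psi>] E_def[symmetric] algebra_simps)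
      then have "E * (cinner \<psi> (p N) + cinner (p N) \<psi>) + E * E * cinner (p N) (p N) = 0"
        using nu[of N] by (simp add: cinner_norm[of "u N"])
      then show ?thesis by (simp only: eq_neg_iff_add_eq_0)
    qed
    have qq: "E * (cinner \<psi> (q N) + cinner (q N) \<psi>) = - (E * E * cinner (q N) (q N))"
    proof -
      have "cinner (v N) (v N) = 1 + (E * (cinner \<psi> (q N) + cinner (q N) \<psi>) + E * E * cinner (q N) (q N))"
        using \<psi> unfolding vN
        by (simp add: cinner_add_left cinner_add_right cinner_scaleR_left cinner_scaleR_right
            cinner_norm[of \<psi>] E_def[symmetric] algebra_simps)
      then have "E * (cinner \<psi> (q N) + cinner (q N) \<psi>) + E * E * cinner (q N) (q N) = 0"
        using nv[of N] by (simp add: cinner_norm[of "v N"])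
      then show ?thesis by (simp only: eq_neg_iff_add_eq_0)
    qed
    define x x' y y' b where "x = cinner \<psi> (p N)" and "x' = cinner (p N) \<psi>"
      and "y = cinner \<psi> (q N)" and "y' = cinner (q N) \<psi>" and "b = cinner (p N) (q N)"
    \<comment> \<open>The coefficient of the middle overlap. Its parts \<open>x'\<close> and
      \<open>y\<close> complete \<open>x\<close> and \<open>y'\<close> to the real quantities that
      \<open>pp\<close> and \<open>qq\<close> reduce to second order.\<close>
    define s where "s = x' + y + E * b"
    have "cinner \<psi> (u N) = 1 + E * x" "cinner (v N) \<psi> = 1 + E * y'" "cinner (u N) (v N) = 1 + E * s"
      using \<psi> unfolding uN vN x_def x'_def y_def y'_def b_def s_def
      by (simp_all add: cinner_add_left cinner_add_right cinner_scaleR_left cinner_scaleR_right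
            cinner_norm[of \<psi>] E_def[symmetric] algebra_simps)
    then have "cinner \<psi> (u N) * cinner (u N) (v N) * cinner (v N) \<psi> - 1
        = E * (x + x') + E * (y + y') + E * E * b + E * E * (x * s + x * y' + s * y' + E * (x * s * y'))"
      by (simp add: s_def algebra_simps)
    also have "\<dots> = E * E * (- cinner (p N) (p N) - cinner (q N) (q N) + b + x * s + x * y' + s * y' + E * (x * s * y'))"
      using pp qq unfolding x_def x'_def y_def y'_def by (simp add: algebra_simps)
    finally have "of_nat N * (cinner \<psi> (u N) * cinner (u N) (v N) * cinner (v N) \<psi> - 1) = of_nat N * (E * E) *
        (- cinner (p N) (p N) - cinner (q N) (q N) + b + x * s + x * y' + s * y' + E * (x * s * y'))"
      by (simp only: mult.assoc)
    then show ?case unfolding N by (simp add: s_def x_def x'_def y_def y'_def b_def E_def)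
  qed
  with lim show ?thesis by (rule Lim_transform_eventually)
qed

section \<open>Positive semidefinite matrices and their three-cycles\<close>

lemma psd_matrix_diag:
  assumes c: "psd_matrix n c" and i: "i < n"
  shows "c i i \<in> \<real>\<^sub>\<ge>\<^sub>0"
proof -
    define f where "f = (\<lambda>k. if k = i then 1 else 0 :: complex)"
    have "(\<Sum>l<n. cnj (f k) * f l * c k l) = (if k = i then c i i else 0)" for k
      using i by (simp add: f_def if_distrib[of "\<lambda>x. x * _"] cong: if_cong)
    then have "(\<Sum>k<n. \<Sum>l<n. cnj (f k) * f l * c k l) = c i i" using i by simp
    then show ?thesis using c[unfolded psd_matrix_def, rule_format, of f] by simp
qed

lemma psd_matrix_hermitian:
  assumes c: "psd_matrix n c" and ij: "i < n" "j < n"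
  shows "c j i = cnj (c i j)" and "(cmod (c i j))\<^sup>2 \<le> Re (c i i) * Re (c j j)"
proof -
  have *: "cnj a * a * c i i + cnj a * b * c i j + cnj b * a * c j i + cnj b * b * c j j \<in> \<real>\<^sub>\<ge>\<^sub>0"
    if "i \<noteq> j" for a b
  proof -
    define f where "f = (\<lambda>k. if k = i then a else if k = j then b else 0)"
    have in_ij: "(\<Sum>k<n. f' k * g k) = f' i * g i + f' j * g j"
      if "\<And>k. k \<noteq> i \<Longrightarrow> k \<noteq> j \<Longrightarrow> f' k = 0" for f' g :: "nat \<Rightarrow> complex"
    proof -
      have "(\<Sum>k<n. f' k * g k) = (\<Sum>k\<in>{i, j}. f' k * g k)"
        by (rule sum.mono_neutral_right) (use ij that in auto)
      then show ?thesis using \<open>i \<noteq> j\<close> by simp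
    qed
    have "(\<Sum>k<n. \<Sum>l<n. cnj (f k) * f l * c k l) = (\<Sum>k<n. cnj (f k) * (\<Sum>l<n. f l * c k l))"
      by (simp add: sum_distrib_left mult.assoc)
    also have "\<dots> = cnj (f i) * (\<Sum>l<n. f l * c i l) + cnj (f j) * (\<Sum>l<n. f l * c j l)"
      by (rule in_ij) (simp add: f_def)
    also have "\<dots> = cnj (f i) * (f i * c i i + f j * c i j) + cnj (f j) * (f i * c j i + f j * c j j)"
      by (subst (1 2) in_ij) (simp_all add: f_def)
    finally show ?thesis
      using c[unfolded psd_matrix_def, rule_format, of f] \<open>i \<noteq> j\<close> by (simp add: f_def algebra_simps)
  qed
  note diag = psd_matrix_diag[OF c]
  show "c j i = cnj (c i j)"
    using psd2_cauchy_schwarz(1)[OF *] diag[OF ij(1)]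
    by (cases "i = j") (auto simp: complex_nonneg_Reals_iff complex_eq_iff)
  show "(cmod (c i j))\<^sup>2 \<le> Re (c i i) * Re (c j j)"
    using psd2_cauchy_schwarz(2)[OF *] diag[OF ij(1)]
  proof (cases "i = j")
    case True
    then show ?thesis using diag[OF ij(1)] cmod_power2[of "c i i"]
      by (simp add: complex_nonneg_Reals_iff) (simp add: power2_eq_square)
  qed simp
qed

lemma psd_matrix_entry_le_1:
  assumes c: "psd_matrix n c" and diag: "\<And>i. i < n \<Longrightarrow> Re (c i i) \<le> 1" and ij: "i < n" "j < n"
  shows "cmod (c i j) \<le> 1"
proof -
  have "0 \<le> Re (c i i)" "0 \<le> Re (c j j)"
    using psd_matrix_hermitian(2)[OF c ij(1) ij(1)] psd_matrix_hermitian(2)[OF c ij(2) ij(2)]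
      psd_matrix_diag[OF c] ij by (auto simp: complex_nonneg_Reals_iff)
  then have "Re (c i i) * Re (c j j) \<le> 1 * 1" using diag ij by (intro mult_mono) auto
  then have "(cmod (c i j))\<^sup>2 \<le> 1\<^sup>2" using psd_matrix_hermitian(2)[OF c ij] by simp
  then show ?thesis by (rule power2_le_imp_le) simp
qed

text \<open>
  For a positive semidefinite matrix with unit diagonal and unimodular entries the test vector
  \<open>(-2, c\<^sub>1\<^sub>0, c\<^sub>2\<^sub>0)\<close> forces \<open>c\<^sub>0\<^sub>1 c\<^sub>1\<^sub>2 c\<^sub>2\<^sub>0 = 1\<close>.
\<close>

lemma psd_matrix_three_cycle:
  assumes c: "psd_matrix 3 c" and diag: "\<And>i. i < 3 \<Longrightarrow> Re (c i i) \<le> 1"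
  shows "4 * (cmod (c 0 1))\<^sup>2 + 4 * (cmod (c 2 0))\<^sup>2 - 6 \<le> 2 * Re (c 0 1 * c 1 2 * c 2 0)"
proof -
  note herm = psd_matrix_hermitian[OF c]
  \<comment> \<open>For a rank-one matrix with unimodular entries this vector spans no mass: it lies
    in the kernel, as the two nonzero indices contribute 1 each against -2. In general the form then
    only leaves the deviation of the three-cycle from 1.\<close>
  define a where "a = (\<lambda>i::nat. if i = 0 then - 2 else cnj (c 0 i))"
  have h: "c 1 0 = cnj (c 0 1)" "c 2 0 = cnj (c 0 2)" "c 2 1 = cnj (c 1 2)"
    by (rule herm; simp)+
  have le: "(cmod (c 0 k))\<^sup>2 * Re (c k k) \<le> 1" if "k < 3" for k
  proof -
    have "(cmod (c 0 k))\<^sup>2 \<le> 1"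
      using psd_matrix_entry_le_1[OF c diag, of 0 k] that by (simp add: power_le_one)
    moreover have "0 \<le> Re (c k k)" using psd_matrix_diag[OF c that] by (simp add: complex_nonneg_Reals_iff)
    ultimately show ?thesis using diag[OF that] mult_mono[of "(cmod (c 0 k))\<^sup>2" 1 "Re (c k k)" 1] by simp
  qed
  have sq: "z * cnj z = of_real ((cmod z)\<^sup>2)" for z by (rule complex_norm_square[symmetric])
  have S3: "(\<Sum>i<3. f i) = f 0 + f 1 + f 2" for f :: "nat \<Rightarrow> complex"
    by (simp add: numeral_3_eq_3 numeral_2_eq_2)
  have "0 \<le> Re (\<Sum>i<3. \<Sum>j<3. cnj (a i) * a j * c i j)"
    using c[unfolded psd_matrix_def, rule_format, of a] unfolding complex_nonneg_Reals_iff by simp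
  also have "(\<Sum>i<3. \<Sum>j<3. cnj (a i) * a j * c i j) = 4 * c 0 0 + (c 0 1 * cnj (c 0 1)) * c 1 1
      + (c 0 2 * cnj (c 0 2)) * c 2 2 - 4 * (c 0 1 * cnj (c 0 1)) - 4 * (c 0 2 * cnj (c 0 2))
      + (c 0 1 * c 1 2 * c 2 0 + cnj (c 0 1 * c 1 2 * c 2 0))"
    unfolding S3 by (simp add: a_def h[simplified] algebra_simps)
  also have "Re \<dots> = 4 * Re (c 0 0) + (cmod (c 0 1))\<^sup>2 * Re (c 1 1) + (cmod (c 0 2))\<^sup>2 * Re (c 2 2)
      - 4 * (cmod (c 0 1))\<^sup>2 - 4 * (cmod (c 0 2))\<^sup>2 + 2 * Re (c 0 1 * c 1 2 * c 2 0)"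
  proof -
    have re: "Re (z + cnj z) = 2 * Re z" for z by simp
    show ?thesis unfolding sq minus_complex.simps plus_complex.simps(1)[of _ "_ + cnj _"] re
      by (simp del: of_real_power)
  qed
  also have "\<dots> \<le> 4 + 1 + 1 - 4 * (cmod (c 0 1))\<^sup>2 - 4 * (cmod (c 0 2))\<^sup>2 + 2 * Re (c 0 1 * c 1 2 * c 2 0)"
    using le[of 1] le[of 2] diag[of 0] by simp
  finally show ?thesis by (simp add: h[simplified])
qed

text \<open>Replacing the factors of the cycle one at a time, each error is a null sequence times
  bounded factors. The cycle of \<open>c\<close> has modulus at most 1, so passing from the cycle of
  \<open>H\<close> to that of \<open>G\<close> cannot increase the modulus.\<close>

lemma gram_three_cycle_le:
  fixes G H c :: "nat \<Rightarrow> nat \<Rightarrow> nat \<Rightarrow> complex"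
  assumes c: "\<And>N. psd_matrix 3 (c N)" and diag: "\<And>N i. i < 3 \<Longrightarrow> Re (c N i i) \<le> 1"
    and GH: "\<And>i j. i < 3 \<Longrightarrow> j < 3 \<Longrightarrow> (\<lambda>N. G N i j - c N i j * H N i j) \<longlonglongrightarrow> 0"
    and nG: "\<And>N i j. i < 3 \<Longrightarrow> j < 3 \<Longrightarrow> cmod (G N i j) \<le> 1" and nH: "\<And>N i j. i < 3 \<Longrightarrow> j < 3 \<Longrightarrow> cmod (H N i j) \<le> 1"
    and bG: "(\<lambda>N. G N 0 1 * G N 1 2 * G N 2 0) \<longlonglongrightarrow> \<beta>"
    and bH: "(\<lambda>N. H N 0 1 * H N 1 2 * H N 2 0) \<longlonglongrightarrow> \<beta>'"
  shows "(\<lambda>N. c N 0 1 * c N 1 2 * c N 2 0 * (H N 0 1 * H N 1 2 * H N 2 0)) \<longlonglongrightarrow> \<beta>"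
    and "cmod \<beta> \<le> cmod \<beta>'"
proof -
  have nc: "cmod (c N i j) \<le> 1" if "i < 3" "j < 3" for N i j
    by (rule psd_matrix_entry_le_1[OF c diag that])
  define K where "K = (\<lambda>N i j. c N i j * H N i j)"
  have nK: "cmod (K N i j) \<le> 1" if "i < 3" "j < 3" for N i j
    using mult_mono[OF nc[OF that] nH[OF that]] by (simp add: K_def norm_mult)
  have d: "(\<lambda>N. G N i j - K N i j) \<longlonglongrightarrow> 0" if "i < 3" "j < 3" for i j
    using GH[OF that] by (simp add: K_def)
  have z: "Zfun (\<lambda>N. G N i j - K N i j) sequentially" if "i < 3" "j < 3" for i j
    using d[OF that] by (simp add: tendsto_Zfun_iff)
  have Bf: "Bfun f sequentially" if "\<And>N. cmod (f N) \<le> 1" for f :: "nat \<Rightarrow> complex"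
    using that by (auto intro!: BfunI always_eventually)
  have m: "cmod (x * y) \<le> 1" if "cmod x \<le> 1" "cmod y \<le> 1" for x y
    using mult_mono[OF that] by (simp add: norm_mult)
  have "Zfun (\<lambda>N. (G N 0 1 - K N 0 1) * (G N 1 2 * G N 2 0)) sequentially"
    "Zfun (\<lambda>N. (G N 1 2 - K N 1 2) * (K N 0 1 * G N 2 0)) sequentially"
    "Zfun (\<lambda>N. (G N 2 0 - K N 2 0) * (K N 0 1 * K N 1 2)) sequentially"
    by (intro bounded_bilinear.Zfun_prod_Bfun[OF bounded_bilinear_mult] z Bf m nG nK; simp)+
  then have "(\<lambda>N. (G N 0 1 - K N 0 1) * (G N 1 2 * G N 2 0) + (G N 1 2 - K N 1 2) * (K N 0 1 * G N 2 0)
      + (G N 2 0 - K N 2 0) * (K N 0 1 * K N 1 2)) \<longlonglongrightarrow> 0 + 0 + 0"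
    by (intro tendsto_add) (simp_all add: tendsto_Zfun_iff)
  from tendsto_diff[OF bG this]
  have "(\<lambda>N. K N 0 1 * K N 1 2 * K N 2 0) \<longlonglongrightarrow> \<beta>"
    by (simp add: algebra_simps)
  then show lim: "(\<lambda>N. c N 0 1 * c N 1 2 * c N 2 0 * (H N 0 1 * H N 1 2 * H N 2 0)) \<longlonglongrightarrow> \<beta>"
    by (simp add: K_def mult_ac)
  show "cmod \<beta> \<le> cmod \<beta>'"
  proof (rule LIMSEQ_le[OF tendsto_norm[OF lim] tendsto_norm[OF bH]], intro exI allI impI)
    fix N
    have "cmod (c N 0 1 * c N 1 2 * c N 2 0) \<le> 1" by (intro m nc) simp_all
    then show "cmod (c N 0 1 * c N 1 2 * c N 2 0 * (H N 0 1 * H N 1 2 * H N 2 0)) \<le> cmod (H N 0 1 * H N 1 2 * H N 2 0)"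
      unfolding norm_mult[of "c N 0 1 * c N 1 2 * c N 2 0"] by (simp add: mult_left_le_one_le)
  qed
qed

text \<open>The cycle \<open>\<omega>\<close> of \<open>c\<close> converges to the quotient of the
  limits, which is unimodular here. All entries have modulus at most 1, so each factor of the cycle
  is at least \<open>cmod \<omega>\<close>, and the three-cycle inequality tends to 8 - 6 \<le> 2
  Re, forcing the quotient to be 1.\<close>

lemma gram_three_cycle_eq:
  fixes G H c :: "nat \<Rightarrow> nat \<Rightarrow> nat \<Rightarrow> complex"
  assumes c: "\<And>N. psd_matrix 3 (c N)" and diag: "\<And>N i. i < 3 \<Longrightarrow> Re (c N i i) \<le> 1"
    and GH: "\<And>i j. i < 3 \<Longrightarrow> j < 3 \<Longrightarrow> (\<lambda>N. G N i j - c N i j * H N i j) \<longlonglongrightarrow> 0"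
    and nG: "\<And>N i j. i < 3 \<Longrightarrow> j < 3 \<Longrightarrow> cmod (G N i j) \<le> 1" and nH: "\<And>N i j. i < 3 \<Longrightarrow> j < 3 \<Longrightarrow> cmod (H N i j) \<le> 1"
    and bG: "(\<lambda>N. G N 0 1 * G N 1 2 * G N 2 0) \<longlonglongrightarrow> \<beta>"
    and bH: "(\<lambda>N. H N 0 1 * H N 1 2 * H N 2 0) \<longlonglongrightarrow> \<beta>'"
    and eq: "cmod \<beta> = cmod \<beta>'" and nz: "\<beta>' \<noteq> 0"
  shows "\<beta> = \<beta>'"
proof -
  define \<omega> where "\<omega> = (\<lambda>N. c N 0 1 * c N 1 2 * c N 2 0)"
  have nc: "cmod (c N i j) \<le> 1" if "i < 3" "j < 3" for N i j
    by (rule psd_matrix_entry_le_1[OF c diag that])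
  have lim: "(\<lambda>N. \<omega> N * (H N 0 1 * H N 1 2 * H N 2 0)) \<longlonglongrightarrow> \<beta>"
    unfolding \<omega>_def by (rule gram_three_cycle_le(1)[OF c diag GH nG nH bG bH])
  from tendsto_divide[OF lim bH nz]
  have "(\<lambda>N. \<omega> N * (H N 0 1 * H N 1 2 * H N 2 0) / (H N 0 1 * H N 1 2 * H N 2 0)) \<longlonglongrightarrow> \<beta> / \<beta>'" .
  moreover have "\<forall>\<^sub>F N in sequentially. \<omega> N * (H N 0 1 * H N 1 2 * H N 2 0) / (H N 0 1 * H N 1 2 * H N 2 0) = \<omega> N"
    using tendsto_imp_eventually_ne[OF bH nz] by eventually_elim simp
  ultimately have \<omega>: "\<omega> \<longlonglongrightarrow> \<beta> / \<beta>'" by (rule Lim_transform_eventually)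
  have n1: "cmod (\<beta> / \<beta>') = 1" using eq nz by (simp add: norm_divide)
  have l1: "(\<lambda>N. 8 * (cmod (\<omega> N))\<^sup>2 - 6) \<longlonglongrightarrow> 8 * (cmod (\<beta> / \<beta>'))\<^sup>2 - 6"
    by (intro tendsto_intros \<omega>)
  have l2: "(\<lambda>N. 2 * Re (\<omega> N)) \<longlonglongrightarrow> 2 * Re (\<beta> / \<beta>')" by (intro tendsto_intros \<omega>)
  have l3: "8 * (cmod (\<omega> N))\<^sup>2 - 6 \<le> 2 * Re (\<omega> N)" for N
  proof -
    have "cmod (\<omega> N) \<le> cmod (c N 0 1)" "cmod (\<omega> N) \<le> cmod (c N 2 0)"
      unfolding \<omega>_def norm_mult mult.assoc using nc[of 0 1 N] nc[of 1 2 N] nc[of 2 0 N]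
      by (auto intro!: mult_left_le mult_le_one)
        (simp flip: mult.assoc, intro mult_left_le_one_le mult_le_one mult_nonneg_nonneg; simp)
    then have "(cmod (\<omega> N))\<^sup>2 \<le> (cmod (c N 0 1))\<^sup>2" "(cmod (\<omega> N))\<^sup>2 \<le> (cmod (c N 2 0))\<^sup>2"
      by (simp_all add: power_mono)
    moreover have "4 * (cmod (c N 0 1))\<^sup>2 + 4 * (cmod (c N 2 0))\<^sup>2 - 6 \<le> 2 * Re (\<omega> N)"
      unfolding \<omega>_def by (rule psd_matrix_three_cycle[OF c diag])
    ultimately show ?thesis by linarith
  qed
  have "8 * (cmod (\<beta> / \<beta>'))\<^sup>2 - 6 \<le> 2 * Re (\<beta> / \<beta>')"
    by (rule LIMSEQ_le[OF l1 l2]) (use l3 in blast)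
  then have "Re (\<beta> / \<beta>') \<ge> 1" using n1 by simp
  moreover have "(Re (\<beta> / \<beta>'))\<^sup>2 + (Im (\<beta> / \<beta>'))\<^sup>2 = 1" using n1 cmod_power2[of "\<beta> / \<beta>'"] by simp
  ultimately have "Re (\<beta> / \<beta>') = 1 \<and> Im (\<beta> / \<beta>') = 0"
    using complex_Re_le_cmod[of "\<beta> / \<beta>'"] n1 by (auto dest: antisym)
  then have "\<beta> / \<beta>' = 1" by (simp add: complex_eq_iff)
  then show ?thesis using nz by simp
qed

section \<open>Consequences of reversibility\<close>

text \<open>Both directions together equate the moduli of the limiting cycles: the forward one gives
  \<open>Re w \<le> R * Re w'\<close>, and the backward one, with about N/R output copies, gives the
  reverse after multiplication by \<open>R\<close>. The limits are exponentials, hence nonzero, so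
  equal moduli upgrade to equality.\<close>

lemma reversible_bargmann_exponent:
  fixes U :: "'g \<Rightarrow> 'h::complex_hilbert \<Rightarrow> 'h"
  assumes G: "group G" and U: "unitary_rep G T U" and \<psi>: "norm \<psi> = 1" and \<phi>: "norm \<phi> = 1"
    and R: "R > 0" and rev: "reversible_asymptotic_transformation G U \<psi> \<phi> R"
    and g: "\<And>N::nat. g N \<in> carrier G" and h: "\<And>N::nat. h N \<in> carrier G"
    and P: "(\<lambda>N. sqrt (real N) *\<^sub>R (U (g N) \<psi> - \<psi>)) \<longlonglongrightarrow> P"
    and Q: "(\<lambda>N. sqrt (real N) *\<^sub>R (U (h N) \<psi> - \<psi>)) \<longlonglongrightarrow> Q"
    and P': "(\<lambda>N. sqrt (real N) *\<^sub>R (U (g N) \<phi> - \<phi>)) \<longlonglongrightarrow> P'"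
    and Q': "(\<lambda>N. sqrt (real N) *\<^sub>R (U (h N) \<phi> - \<phi>)) \<longlonglongrightarrow> Q'"
  shows "exp (bargmann_exponent \<psi> P Q) = exp (of_real R * bargmann_exponent \<phi> P' Q')"
proof -
  interpret group G by (rule G)
  have fw: "asymptotic_transformation G U \<psi> \<phi> R" and bw: "asymptotic_transformation G U \<phi> \<psi> (inverse R)"
    using rev by (auto simp: reversible_asymptotic_transformation_def)
  \<comment> \<open>\<open>\<Gamma>\<close> reverses its indices, so \<open>h\<close> at index 1 and
    \<open>g\<close> at index 2 give the cycle through the base vector, \<open>g\<close> and
    \<open>h\<close> in the order used by \<open>bargmann_exponent\<close>.\<close>
  define k where "k = (\<lambda>(N::nat) (i::nat). if i = 0 then \<one>\<^bsub>G\<^esub> else if i = 1 then h N else g N)"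
  have k: "k N i \<in> carrier G" for N i using g h by (simp add: k_def)
  have nU: "norm (U a x) = norm x" if "a \<in> carrier G" for a x
    by (rule unitary_pair_norm[OF unitary_rep_pair[OF G U that]])
  note one = unitary_rep_one[OF G U]
  define \<Gamma> where "\<Gamma> = (\<lambda>x m N i j. cinner (U (k N j) x) (U (k N i) x) ^ (m N :: nat))"
  have n\<Gamma>: "cmod (\<Gamma> x m N i j) \<le> 1" if "norm x = 1" for x m N i j
    using cinner_bound[of "U (k N j) x" "U (k N i) x"] nU[OF k] that
    by (simp add: \<Gamma>_def norm_power power_le_one)
  have cyc: "(\<lambda>N. \<Gamma> x m N 0 1 * \<Gamma> x m N 1 2 * \<Gamma> x m N 2 0) \<longlonglongrightarrow> exp (of_real r * bargmann_exponent x p q)"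
    if x: "norm x = 1" and m: "(\<lambda>N. real (m N) / real N) \<longlonglongrightarrow> r"
      and p: "(\<lambda>N. sqrt (real N) *\<^sub>R (U (g N) x - x)) \<longlonglongrightarrow> p"
      and q: "(\<lambda>N. sqrt (real N) *\<^sub>R (U (h N) x - x)) \<longlonglongrightarrow> q" for x m r p q
  proof -
    have "(\<lambda>N. (cinner x (U (g N) x) * cinner (U (g N) x) (U (h N) x) * cinner (U (h N) x) x) ^ m N)
        \<longlonglongrightarrow> exp (of_real r * bargmann_exponent x p q)"
      by (rule power_tendsto_exp[OF bargmann_invariant_limit[OF x _ _ p q] m]) (simp_all add: nU g h x)
    then show ?thesis by (simp add: \<Gamma>_def k_def one power_mult_distrib mult_ac)
  qed
  have mid: "(\<lambda>N. real N / real N) \<longlonglongrightarrow> 1"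
    by (rule tendsto_eventually) (use eventually_gt_at_top[of 0] in eventually_elim, simp)
  define m m' where "m = (\<lambda>N::nat. nat \<lfloor>real N * R\<rfloor>)" and "m' = (\<lambda>N::nat. nat \<lfloor>real N * inverse R\<rfloor>)"
  have m: "(\<lambda>N. real (m N) / real N) \<longlonglongrightarrow> R" and m': "(\<lambda>N. real (m' N) / real N) \<longlonglongrightarrow> inverse R"
    unfolding m_def m'_def by (rule nat_floor_mult_over, simp add: R)+
  obtain c where c: "\<And>N. psd_matrix 3 (c N)" "\<And>N i. i < 3 \<Longrightarrow> Re (c N i i) \<le> 1"
    "\<And>i j. i < 3 \<Longrightarrow> j < 3 \<Longrightarrow> (\<lambda>N. \<Gamma> \<psi> (\<lambda>N. N) N i j - c N i j * \<Gamma> \<phi> m N i j) \<longlonglongrightarrow> 0"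
    unfolding \<Gamma>_def m_def by (rule asymptotic_transformation_gram[OF G U \<psi> \<phi> fw, of 3 k, OF k]) blast
  obtain c' where c': "\<And>N. psd_matrix 3 (c' N)" "\<And>N i. i < 3 \<Longrightarrow> Re (c' N i i) \<le> 1"
    "\<And>i j. i < 3 \<Longrightarrow> j < 3 \<Longrightarrow> (\<lambda>N. \<Gamma> \<phi> (\<lambda>N. N) N i j - c' N i j * \<Gamma> \<psi> m' N i j) \<longlonglongrightarrow> 0"
    unfolding \<Gamma>_def m'_def by (rule asymptotic_transformation_gram[OF G U \<phi> \<psi> bw, of 3 k, OF k]) blast
  let ?w = "bargmann_exponent \<psi> P Q" and ?w' = "bargmann_exponent \<phi> P' Q'"
  have "cmod (exp (of_real 1 * ?w)) \<le> cmod (exp (of_real R * ?w'))"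
    by (rule gram_three_cycle_le(2)[OF c n\<Gamma>[OF \<psi>] n\<Gamma>[OF \<phi>] cyc[OF \<psi> mid P Q] cyc[OF \<phi> m P' Q']])
  then have 1: "Re ?w \<le> R * Re ?w'" by simp
  have "cmod (exp (of_real 1 * ?w')) \<le> cmod (exp (of_real (inverse R) * ?w))"
    by (rule gram_three_cycle_le(2)[OF c' n\<Gamma>[OF \<phi>] n\<Gamma>[OF \<psi>] cyc[OF \<phi> mid P' Q'] cyc[OF \<psi> m' P Q]])
  then have 2: "R * Re ?w' \<le> Re ?w" using R by (simp add: field_simps)
  have "exp (of_real 1 * ?w) = exp (of_real R * ?w')"
    by (rule gram_three_cycle_eq[OF c n\<Gamma>[OF \<psi>] n\<Gamma>[OF \<phi>] cyc[OF \<psi> mid P Q] cyc[OF \<phi> m P' Q']])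
      (use 1 2 in auto)
  then show ?thesis by simp
qed

section \<open>Comparison of the symmetry groups\<close>

lemma rank1_self_eq_iff:
  assumes "norm a = 1" "norm b = 1"
  shows "rank1 a a = rank1 b b \<longleftrightarrow> cmod (cinner a b) = 1"
proof
  assume "rank1 a a = rank1 b b"
  then have "cinner a (rank1 a a a) = cinner a (rank1 b b a)" by simp
  then have "1 = cinner b a * cinner a b" using assms by (simp add: rank1_def cinner_scaleC_right cinner_norm)
  also have "\<dots> = of_real ((cmod (cinner a b))\<^sup>2)"
    using complex_norm_square[of "cinner a b"] cinner_commute[of b a] by (simp add: mult.commute)
  finally have "(cmod (cinner a b))\<^sup>2 = 1" by (metis of_real_1 of_real_eq_iff)
  then show "cmod (cinner a b) = 1" by (simp add: power2_eq_1_iff) (smt (verit) norm_ge_zero)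
next
  assume 1: "cmod (cinner a b) = 1"
  have sq: "cinner b a * cinner a b = 1"
    using complex_norm_square[of "cinner a b"] cinner_commute[of b a] 1 by (simp add: mult.commute)
  \<comment> \<open>The equality case of Cauchy-Schwarz: \<open>b\<close> is its own component along
    \<open>a\<close>, and the phase cancels in the projector.\<close>
  have "cinner (b - cinner a b *\<^sub>C a) (b - cinner a b *\<^sub>C a) = 0"
    using assms sq cinner_commute[of b a]
    by (simp add: cinner_diff_left cinner_diff_right cinner_scaleC_left cinner_scaleC_right
        cinner_norm[of a] cinner_norm[of b] mult_ac)
  then have b: "b = cinner a b *\<^sub>C a" by (simp add: cinner_self_eq_0_iff)
  show "rank1 a a = rank1 b b"
  proof
    fix x
    have "rank1 b b x = (cnj (cinner a b) * cinner a x * cinner a b) *\<^sub>C a"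
      by (subst (1 2) b) (simp add: rank1_def cinner_scaleC_left scaleC_scaleC mult_ac)
    also have "cnj (cinner a b) * cinner a x * cinner a b = cinner a x * (cinner b a * cinner a b)"
      using cinner_commute[of b a] by (simp add: mult_ac)
    also have "(cinner a x * (cinner b a * cinner a b)) *\<^sub>C a = rank1 a a x"
      by (simp add: sq rank1_def)
    finally show "rank1 a a x = rank1 b b x" ..
  qed
qed

lemma Sym_group_eq:
  assumes G: "group G" and U: "unitary_rep G T U" and \<psi>: "norm \<psi> = 1"
  shows "Sym_group G U \<psi> = {g \<in> carrier G. cmod (cinner (U g \<psi>) \<psi>) = 1}"
proof -
  have "U g \<circ> proj \<psi> \<circ> adj (U g) = proj \<psi> \<longleftrightarrow> cmod (cinner (U g \<psi>) \<psi>) = 1" if g: "g \<in> carrier G" for g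
  proof -
    note up = unitary_rep_pair[OF G U g]
    have "adj (U g) = U (inv\<^bsub>G\<^esub> g)" using up by (intro adj_eqI) (auto simp: unitary_pair_def)
    moreover have "bounded_clinear (U g)" using U g by (simp add: unitary_rep_def)
    ultimately have "U g \<circ> proj \<psi> \<circ> adj (U g) = rank1 (U g \<psi>) (U g \<psi>)"
      unfolding proj_eq_rank1 using up by (simp add: comp_rank1_adj unitary_pair_def)
    moreover have "norm (U g \<psi>) = 1"
      using unitary_pair_norm[OF up] \<psi> by simp
    ultimately show ?thesis using \<psi> by (simp add: proj_eq_rank1 rank1_self_eq_iff)
  qed
  then show ?thesis by (auto simp: Sym_group_def)
qed

text \<open>Apply the Gram comparison to the constant pair (1, g). The left overlaps keep modulus 1
  for all \<open>N\<close>, while the right ones are at most \<open>r ^ m N\<close>; since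
  \<open>m N\<close> tends to infinity, \<open>r < 1\<close> would be contradictory.\<close>

lemma Sym_group_mono:
  assumes G: "group G" and U: "unitary_rep G T U" and \<psi>: "norm \<psi> = 1" and \<phi>: "norm \<phi> = 1"
    and R: "R > 0" and asym: "asymptotic_transformation G U \<psi> \<phi> R"
  shows "Sym_group G U \<psi> \<subseteq> Sym_group G U \<phi>"
proof
  fix g assume "g \<in> Sym_group G U \<psi>"
  then have g: "g \<in> carrier G" and g\<psi>: "cmod (cinner (U g \<psi>) \<psi>) = 1"
    using Sym_group_eq[OF G U \<psi>] by auto
  interpret group G by (rule G)
  define k where "k = (\<lambda>(N::nat) (i::nat). if i = 0 then \<one>\<^bsub>G\<^esub> else g)"
  have k: "k N i \<in> carrier G" for N i using g by (simp add: k_def)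
  note one = unitary_rep_one[OF G U]
  have nU: "norm (U g x) = norm x" for x
    by (rule unitary_pair_norm[OF unitary_rep_pair[OF G U g]])
  define m where "m = (\<lambda>N::nat. nat \<lfloor>real N * R\<rfloor>)"
  define r where "r = cmod (cinner (U g \<phi>) \<phi>)"
  obtain c where c: "\<And>N. psd_matrix 2 (c N)" "\<And>N i. i < 2 \<Longrightarrow> Re (c N i i) \<le> 1"
    and lim: "\<And>i j. i < 2 \<Longrightarrow> j < 2 \<Longrightarrow> (\<lambda>N. cinner (U (k N j) \<psi>) (U (k N i) \<psi>) ^ N -
           c N i j * cinner (U (k N j) \<phi>) (U (k N i) \<phi>) ^ m N) \<longlonglongrightarrow> 0"
    unfolding m_def by (rule asymptotic_transformation_gram[OF G U \<psi> \<phi> asym, of 2 k, OF k]) blast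
  have le: "1 - r ^ m N \<le> cmod (cinner (U g \<psi>) \<psi> ^ N - c N 0 1 * cinner (U g \<phi>) \<phi> ^ m N)" for N
  proof -
    have "cmod (c N 0 1) \<le> 1" by (rule psd_matrix_entry_le_1[OF c]) simp_all
    then have "cmod (c N 0 1 * cinner (U g \<phi>) \<phi> ^ m N) \<le> r ^ m N"
      by (simp add: norm_mult norm_power r_def mult_left_le_one_le)
    moreover have "cmod (cinner (U g \<psi>) \<psi> ^ N) = 1" by (simp add: norm_power g\<psi>)
    ultimately show ?thesis using norm_triangle_ineq2 by (smt (verit))
  qed
  have l1: "(\<lambda>N. cmod (cinner (U g \<psi>) \<psi> ^ N - c N 0 1 * cinner (U g \<phi>) \<phi> ^ m N)) \<longlonglongrightarrow> 0"
    using tendsto_norm_zero[OF lim[of 0 1]] by (simp add: k_def one)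
  have "r \<le> 1" using cinner_bound[of "U g \<phi>" \<phi>] \<phi> nU by (simp add: r_def)
  moreover have "\<not> r < 1"
  proof
    assume r: "r < 1"
    have "filterlim (\<lambda>N. real N * R) at_top sequentially"
      using filterlim_tendsto_pos_mult_at_top[OF tendsto_const R filterlim_real_sequentially]
      by (simp add: mult.commute)
    then have "filterlim m at_top sequentially"
      unfolding m_def by (intro filterlim_compose[OF filterlim_nat_sequentially filterlim_compose[OF filterlim_floor_sequentially]])
    then have "(\<lambda>N. r ^ m N) \<longlonglongrightarrow> 0"
      by (rule filterlim_compose[OF LIMSEQ_realpow_zero, rotated 2]) (use r in \<open>auto simp: r_def\<close>)
    then have "(\<lambda>N. 1 - r ^ m N) \<longlonglongrightarrow> 1 - 0" by (intro tendsto_intros)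
    from LIMSEQ_le[OF this l1] le show False by auto
  qed
  ultimately show "g \<in> Sym_group G U \<phi>" using g by (simp add: Sym_group_eq[OF G U \<phi>] r_def)
qed

section \<open>From generators to the quantum geometric tensor\<close>

lemma generator_derivative:
  assumes G: "compact_lie_group G T \<A>" and c: "chart_at_one G \<A> c"
    and \<gamma>: "one_parameter_subgroup G T c X \<gamma>" and x: "x \<in> generator_dom G T c U X"
  shows "((\<lambda>t. U (\<gamma> t) x) has_vector_derivative \<i> *\<^sub>C generator G T c U X x) (at 0)"
proof -
  \<comment> \<open>\<open>generator_rel\<close> hides its subgroup behind an existential;
    uniqueness of one-parameter subgroups transfers the derivative to the given
    \<open>\<gamma>\<close>.\<close>
  from x obtain y \<gamma>' where y: "generator_rel G T c U X x y" and \<gamma>': "one_parameter_subgroup G T c X \<gamma>'"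
      "((\<lambda>t. U (\<gamma>' t) x) has_vector_derivative \<i> *\<^sub>C y) (at 0)"
    unfolding generator_dom_def generator_rel_def by blast
  then show ?thesis
    using generator_unique[OF G c y] one_parameter_subgroup_unique[OF G c \<gamma>'(1) \<gamma>] by simp
qed

lemma has_vector_derivative_at_0_iff:
  "(f has_vector_derivative D) (at 0) \<longleftrightarrow> ((\<lambda>t. (f t - f 0) /\<^sub>R t) \<longlongrightarrow> D) (at 0)"
proof -
  have "((\<lambda>t. norm (f t - f 0 - t *\<^sub>R D) / norm t) \<longlongrightarrow> 0) (at 0) \<longleftrightarrow>
      ((\<lambda>t. norm ((f t - f 0) /\<^sub>R t - D)) \<longlongrightarrow> 0) (at 0)"
  proof (rule filterlim_cong[OF refl refl])
    have "norm (f t - f 0 - t *\<^sub>R D) / norm t = norm ((f t - f 0) /\<^sub>R t - D)" if "t \<noteq> 0" for t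
    proof -
      have "(f t - f 0) /\<^sub>R t - D = (f t - f 0 - t *\<^sub>R D) /\<^sub>R t" using that by (simp add: scaleR_diff_right)
      then show ?thesis by (simp add: divide_inverse mult.commute)
    qed
    then show "\<forall>\<^sub>F t in at 0. norm (f t - f 0 - t *\<^sub>R D) / norm t = norm ((f t - f 0) /\<^sub>R t - D)"
      by (simp add: eventually_at_filter)
  qed
  then show ?thesis
    unfolding has_vector_derivative_def has_derivative_iff_norm
    by (simp add: bounded_linear_scaleR_left tendsto_norm_zero_iff LIM_zero_iff)
qed

lemma has_vector_derivative_sqrt_sequence:
  assumes "(f has_vector_derivative D) (at 0)"
  shows "(\<lambda>N. sqrt (real N) *\<^sub>R (f (s / sqrt (real N)) - f 0)) \<longlonglongrightarrow> s *\<^sub>R D"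
proof (cases "s = 0")
  case False
  have "((\<lambda>t. (f t - f 0) /\<^sub>R t) \<longlongrightarrow> D) (at 0)"
    using assms by (simp add: has_vector_derivative_at_0_iff)
  moreover have "filterlim (\<lambda>N. s / sqrt (real N)) (at 0) sequentially"
  proof -
    have "(\<lambda>N. s * sqrt (1 / real N)) \<longlonglongrightarrow> s * sqrt 0" by (intro tendsto_intros lim_inverse_n')
    moreover have "\<forall>\<^sub>F N in sequentially. s / sqrt (real N) \<noteq> 0"
      using eventually_gt_at_top[of 0] by eventually_elim (use False in simp)
    ultimately show ?thesis by (simp add: filterlim_at real_sqrt_divide)
  qed
  ultimately have "(\<lambda>N. (f (s / sqrt (real N)) - f 0) /\<^sub>R (s / sqrt (real N))) \<longlonglongrightarrow> D"
    by (rule filterlim_compose)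
  then have "(\<lambda>N. s *\<^sub>R ((f (s / sqrt (real N)) - f 0) /\<^sub>R (s / sqrt (real N)))) \<longlonglongrightarrow> s *\<^sub>R D"
    by (intro tendsto_intros)
  then show ?thesis using False by (simp add: field_simps)
qed simp

text \<open>
  The symmetric part of the quantum geometric tensor is the covariance matrix; its antisymmetric
  part gives the expectation values of commutators.
\<close>

definition geometric_tensor ::
  "'g monoid \<Rightarrow> 'g topology \<Rightarrow> ('g, 'e::banach) chart \<Rightarrow> ('g \<Rightarrow> 'h::complex_hilbert \<Rightarrow> 'h) \<Rightarrow>
     'h \<Rightarrow> 'e \<Rightarrow> 'e \<Rightarrow> complex" where
  "geometric_tensor G T c U \<psi> X Y =
     cinner (generator G T c U X \<psi>) (generator G T c U Y \<psi>)
       - expectation G T c U \<psi> X * expectation G T c U \<psi> Y"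

lemma expectation_real:
  assumes "compact_lie_group G T \<A>" "chart_at_one G \<A> c" "unitary_rep G T U" "\<psi> \<in> generator_dom G T c U X"
  shows "cnj (expectation G T c U \<psi> X) = expectation G T c U \<psi> X"
  using generator_symmetric[OF assms(1-3) assms(4,4)] cinner_commute[of "generator G T c U X \<psi>" \<psi>]
  by (simp add: expectation_def)

text \<open>The pure squares carry the negative variances, and the coefficient of
  \<open>s * t\<close> is the geometric tensor of the two generators.\<close>

lemma bargmann_exponent_generators:
  assumes A: "cinner A \<psi> = cinner \<psi> A" and B: "cinner B \<psi> = cinner \<psi> B"
  shows "bargmann_exponent \<psi> (s *\<^sub>R \<i> *\<^sub>C A) (t *\<^sub>R \<i> *\<^sub>C B) =
    of_real (s\<^sup>2) * ((cinner \<psi> A)\<^sup>2 - cinner A A) + of_real (t\<^sup>2) * ((cinner \<psi> B)\<^sup>2 - cinner B B)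
      + of_real (s * t) * (cinner A B - cinner \<psi> A * cinner \<psi> B)"
  unfolding bargmann_exponent_def cinner_scaleR_left cinner_scaleR_right cinner_scaleC_left cinner_scaleC_right A B
  by (simp add: power2_eq_square algebra_simps)

lemma exp_mult_eq_1_imp_0:
  fixes d :: real
  assumes "\<And>t. exp (\<i> * of_real (t * d)) = 1"
  shows "d = 0"
proof (rule ccontr)
  assume "d \<noteq> 0"
  then have "exp (\<i> * of_real (pi / d * d)) = -1" using exp_pi_i' by simp
  then show False using assms[of "pi / d"] by simp
qed

text \<open>Moduli of the exponentials give the real parts of the exponents, and polarisation
  isolates the real part of the tensor. The imaginary part of the exponent comes from the mixed term
  alone, so at s = 1 its difference is \<open>t\<close> times a constant that exp forces to
  vanish.\<close>

lemma reversible_geometric_tensor: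
  fixes c :: "('g, 'e::banach) chart" and U :: "'g \<Rightarrow> 'h::complex_hilbert \<Rightarrow> 'h"
  assumes G: "compact_lie_group G T \<A>" and c: "chart_at_one G \<A> c" and U: "unitary_rep G T U"
    and \<psi>: "norm \<psi> = 1" and \<phi>: "norm \<phi> = 1"
    and dom: "\<And>X. \<psi> \<in> generator_dom G T c U X" "\<And>X. \<phi> \<in> generator_dom G T c U X"
    and R: "R > 0" and rev: "reversible_asymptotic_transformation G U \<psi> \<phi> R"
  shows "geometric_tensor G T c U \<psi> X Y = of_real R * geometric_tensor G T c U \<phi> X Y"
proof -
  have gr: "group G" using G by (simp add: compact_lie_group_def)
  obtain \<gamma> where \<gamma>: "one_parameter_subgroup G T c X \<gamma>"
    using dom(1)[of X] by (auto simp: generator_dom_def generator_rel_def)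
  obtain \<delta> where \<delta>: "one_parameter_subgroup G T c Y \<delta>"
    using dom(1)[of Y] by (auto simp: generator_dom_def generator_rel_def)
  note o\<gamma> = one_parameter_subgroup_one[OF G \<gamma>] and o\<delta> = one_parameter_subgroup_one[OF G \<delta>]
  interpret group G by (rule gr)
  note one = unitary_rep_one[OF gr U]
  let ?A = "\<lambda>x. generator G T c U X x" and ?B = "\<lambda>x. generator G T c U Y x"
  have lim\<gamma>: "(\<lambda>N. sqrt (real N) *\<^sub>R (U (\<gamma> (s / sqrt (real N))) x - x)) \<longlonglongrightarrow> s *\<^sub>R \<i> *\<^sub>C ?A x"
    and lim\<delta>: "(\<lambda>N. sqrt (real N) *\<^sub>R (U (\<delta> (s / sqrt (real N))) x - x)) \<longlonglongrightarrow> s *\<^sub>R \<i> *\<^sub>C ?B x"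
    if "\<And>X. x \<in> generator_dom G T c U X" for x s
    using has_vector_derivative_sqrt_sequence[OF generator_derivative[OF G c \<gamma> that], of s]
      has_vector_derivative_sqrt_sequence[OF generator_derivative[OF G c \<delta> that], of s]
    by (simp_all add: o\<gamma> o\<delta> one)
  define W where "W = (\<lambda>x s t. bargmann_exponent x (s *\<^sub>R \<i> *\<^sub>C ?A x) (t *\<^sub>R \<i> *\<^sub>C ?B x))"
  have ex: "exp (W \<psi> s t) = exp (of_real R * W \<phi> s t)" for s t
    unfolding W_def
    by (rule reversible_bargmann_exponent[OF gr U \<psi> \<phi> R rev _ _
          lim\<gamma>[OF dom(1)] lim\<delta>[OF dom(1)] lim\<gamma>[OF dom(2)] lim\<delta>[OF dom(2)]]) (simp_all add: o\<gamma> o\<delta>)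
  define q where "q = (\<lambda>x. geometric_tensor G T c U x X Y)"
  define a b where "a = (\<lambda>x. (norm (?A x))\<^sup>2 - (Re (cinner x (?A x)))\<^sup>2)"
    and "b = (\<lambda>x. (norm (?B x))\<^sup>2 - (Re (cinner x (?B x)))\<^sup>2)"
  have W: "W x s t = of_real (s * t) * q x - of_real (s\<^sup>2 * a x + t\<^sup>2 * b x)"
    if "\<And>X. x \<in> generator_dom G T c U X" for x s t
  proof -
    have "cinner (generator G T c U Z x) x = cinner x (generator G T c U Z x)" for Z
      by (rule generator_symmetric[OF G c U that that])
    moreover have "cinner x (generator G T c U Z x) = of_real (Re (cinner x (generator G T c U Z x)))" for Z
      using expectation_real[OF G c U that[of Z]] unfolding expectation_def by (simp add: complex_eq_iff)
    ultimately show ?thesis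
      unfolding W_def a_def b_def q_def geometric_tensor_def expectation_def
      by (subst bargmann_exponent_generators)
        (simp_all add: cinner_norm[of "generator G T c U _ x"] algebra_simps)
  qed
  have "Re (W \<psi> s t) = R * Re (W \<phi> s t)" for s t
  proof -
    have "cmod (exp (W \<psi> s t)) = cmod (exp (of_real R * W \<phi> s t))" using ex by simp
    then show ?thesis by simp
  qed
  \<comment> \<open>Changing the sign of \<open>t\<close> keeps the squares and flips the mixed
    term.\<close>
  from this[of 1 1] this[of 1 "-1"] have Re: "Re (q \<psi>) = R * Re (q \<phi>)"
    by (simp add: W[OF dom(1)] W[OF dom(2)] algebra_simps)
  have "exp (\<i> * of_real (t * (Im (q \<psi>) - R * Im (q \<phi>)))) = 1" for t
  proof -
    have "exp (W \<psi> 1 t - of_real R * W \<phi> 1 t) = 1" using ex[of 1 t] by (simp add: exp_diff)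
    moreover have "Re (W \<psi> 1 t - of_real R * W \<phi> 1 t) = 0"
      using \<open>\<And>s t. Re (W \<psi> s t) = R * Re (W \<phi> s t)\<close>[of 1 t] by simp
    moreover have "Im (W \<psi> 1 t - of_real R * W \<phi> 1 t) = t * (Im (q \<psi>) - R * Im (q \<phi>))"
      by (simp add: W[OF dom(1)] W[OF dom(2)] algebra_simps)
    ultimately show ?thesis by (metis complex_eq add_0 of_real_0 mult.commute)
  qed
  then have "Im (q \<psi>) = R * Im (q \<phi>)" using exp_mult_eq_1_imp_0 by fastforce
  then show ?thesis using Re unfolding q_def by (simp add: complex_eq_iff)
qed

section \<open>Differentiable vectors and the Lie algebra\<close>

subsection \<open>Coordinates in finite-dimensional normed spaces\<close>

text \<open>Equivalence of norms on a finite-dimensional span. In the induction step the new vector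
  \<open>a\<close> has positive distance from \<open>span B\<close>: if combinations of
  \<open>B\<close> approached \<open>a\<close>, the bound for \<open>B\<close> would make their
  coefficients Cauchy and put \<open>a\<close> into the span.\<close>

lemma coefficients_bounded:
  fixes B :: "'e::real_normed_vector set"
  assumes "finite B" "independent B"
  shows "\<exists>K\<ge>0. \<forall>f. \<forall>b\<in>B. \<bar>f b\<bar> \<le> K * norm (\<Sum>b\<in>B. f b *\<^sub>R b)"
  using assms
proof (induction B rule: finite_induct)
  case empty
  then show ?case by auto
next
  case (insert a B)
  have indep: "independent B" and a: "a \<notin> span B"
    using insert.prems insert.hyps(2) by (auto simp: independent_insert)
  from insert.IH[OF indep] obtain K where K: "K \<ge> 0"
    "\<And>f b. b \<in> B \<Longrightarrow> \<bar>f b\<bar> \<le> K * norm (\<Sum>b\<in>B. f b *\<^sub>R b)" by blast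
  have "\<exists>\<delta>>0. \<forall>g. \<delta> \<le> norm (a - (\<Sum>b\<in>B. g b *\<^sub>R b))"
  proof (rule ccontr)
    assume "\<not> ?thesis"
    then have "\<forall>n. \<exists>g. norm (a - (\<Sum>b\<in>B. g b *\<^sub>R b)) < inverse (real (Suc n))"
      by (meson inverse_positive_iff_positive not_le of_nat_0_less_iff zero_less_Suc)
    then obtain g where g: "\<And>n. norm (a - (\<Sum>b\<in>B. g n b *\<^sub>R b)) < inverse (real (Suc n))" by metis
    define s where "s = (\<lambda>n. \<Sum>b\<in>B. g n b *\<^sub>R b)"
    have "(\<lambda>n. a - s n) \<longlonglongrightarrow> 0"
      by (rule LIMSEQ_norm_0) (use g in \<open>simp add: s_def inverse_eq_divide\<close>)
    from tendsto_diff[OF tendsto_const[of a] this] have s: "s \<longlonglongrightarrow> a" by simp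
    have "Cauchy (\<lambda>n. g n b)" if b: "b \<in> B" for b
    proof (rule metric_CauchyI)
      fix e :: real assume e: "e > 0"
      then have "e / (K + 1) > 0" using K(1) by simp
      then obtain M where M: "\<And>m n. m \<ge> M \<Longrightarrow> n \<ge> M \<Longrightarrow> dist (s m) (s n) < e / (K + 1)"
        using LIMSEQ_imp_Cauchy[OF s] metric_CauchyD by metis
      have "dist (g m b) (g n b) < e" if mn: "m \<ge> M" "n \<ge> M" for m n
      proof -
        have "\<bar>g m b - g n b\<bar> \<le> K * norm (s m - s n)"
          using K(2)[OF b, of "\<lambda>b. g m b - g n b"] by (simp add: s_def scaleR_diff_left sum_subtractf)
        also have "\<dots> \<le> (K + 1) * dist (s m) (s n)" by (simp add: dist_norm mult_right_mono)
        also have "\<dots> < e" using M[OF mn] K(1) by (simp add: pos_less_divide_eq mult.commute)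
        finally show ?thesis by (simp add: dist_norm)
      qed
      then show "\<exists>M. \<forall>m\<ge>M. \<forall>n\<ge>M. dist (g m b) (g n b) < e" by blast
    qed
    then have "\<exists>l. (\<lambda>n. g n b) \<longlonglongrightarrow> l" if "b \<in> B" for b
      using Cauchy_convergent that unfolding convergent_def by blast
    then obtain l where "\<And>b. b \<in> B \<Longrightarrow> (\<lambda>n. g n b) \<longlonglongrightarrow> l b" by metis
    then have "s \<longlonglongrightarrow> (\<Sum>b\<in>B. l b *\<^sub>R b)" unfolding s_def by (intro tendsto_intros)
    with s have "a = (\<Sum>b\<in>B. l b *\<^sub>R b)" using LIMSEQ_unique by blast
    also have "\<dots> \<in> span B" by (intro span_sum span_scale span_base)
    finally show False using a by blast
  qed
  then obtain \<delta> where \<delta>: "\<delta> > 0" "\<And>g. \<delta> \<le> norm (a - (\<Sum>b\<in>B. g b *\<^sub>R b))" by blast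
  \<comment> \<open>The first summand bounds the coefficient of \<open>a\<close> through its
    distance \<open>\<delta>\<close> from \<open>span B\<close>; the second bounds the others after
    subtracting \<open>f a *\<^sub>R a\<close>.\<close>
  define K' where "K' = 1 / \<delta> + K * (1 + norm a / \<delta>)"
  have "\<bar>f b\<bar> \<le> K' * norm (\<Sum>b\<in>insert a B. f b *\<^sub>R b)" if b: "b \<in> insert a B" for f b
  proof -
    define x where "x = (\<Sum>b\<in>insert a B. f b *\<^sub>R b)"
    have x: "x = f a *\<^sub>R a + (\<Sum>b\<in>B. f b *\<^sub>R b)" using insert.hyps by (simp add: x_def)
    have fa: "\<bar>f a\<bar> \<le> norm x / \<delta>"
    proof (cases "f a = 0")
      case False
      have "x = f a *\<^sub>R (a - (\<Sum>b\<in>B. (- f b / f a) *\<^sub>R b))"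
        using False by (simp add: x scaleR_diff_right scaleR_add_right scaleR_sum_right sum_negf)
      then have "norm x = \<bar>f a\<bar> * norm (a - (\<Sum>b\<in>B. (- f b / f a) *\<^sub>R b))" by simp
      also have "\<dots> \<ge> \<bar>f a\<bar> * \<delta>" by (intro mult_left_mono \<delta>(2)) simp
      finally show ?thesis using \<delta>(1) by (simp add: field_simps)
    qed (use \<delta> in simp)
    have fb: "\<bar>f b\<bar> \<le> K * ((1 + norm a / \<delta>) * norm x)" if "b \<in> B" for b
    proof -
      have "norm (\<Sum>b\<in>B. f b *\<^sub>R b) = norm (x - f a *\<^sub>R a)" by (simp add: x)
      also have "\<dots> \<le> norm x + \<bar>f a\<bar> * norm a" using norm_triangle_ineq4[of x "f a *\<^sub>R a"] by simp
      also have "\<dots> \<le> norm x + norm x / \<delta> * norm a" using mult_right_mono[OF fa norm_ge_zero[of a]] by simp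
      also have "\<dots> = (1 + norm a / \<delta>) * norm x" by (simp add: field_simps)
      finally show ?thesis using K(2)[OF that, of f] mult_left_mono[OF _ K(1)] by (meson order_trans)
    qed
    have nn: "0 \<le> 1 / \<delta> * norm x" "0 \<le> K * ((1 + norm a / \<delta>) * norm x)"
      using \<delta>(1) K(1) by simp_all
    have K': "K' * norm x = 1 / \<delta> * norm x + K * ((1 + norm a / \<delta>) * norm x)"
      by (simp add: K'_def distrib_right mult.assoc)
    show ?thesis
      using b fa fb nn unfolding x_def[symmetric] K' by fastforce
  qed
  moreover have "K' \<ge> 0" using \<delta>(1) K(1) by (simp add: K'_def)
  ultimately show ?case by blast
qed

lemma bounded_linear_representation:
  fixes B :: "'e::real_normed_vector set"
  assumes B: "finite B" "independent B" "span B = UNIV"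
  shows "bounded_linear (\<lambda>x. representation B x b)"
proof -
  have sum: "(\<Sum>b\<in>B. representation B x b *\<^sub>R b) = x" for x
    using sum_representation_eq[OF B(2), of x B] B by simp
  obtain K where K: "\<And>f b. b \<in> B \<Longrightarrow> \<bar>f b\<bar> \<le> K * norm (\<Sum>b\<in>B. f b *\<^sub>R b)"
    using coefficients_bounded[OF B(1,2)] by blast
  show ?thesis
  proof (cases "b \<in> B")
    case True
    then show ?thesis
      using K[OF True, of "representation B _"] B
      by (intro bounded_linear_intro[of _ K])
        (simp_all add: representation_add representation_scale sum mult.commute)
  next
    case False
    then have "representation B x b = 0" for x using representation_ne_zero by blast
    then show ?thesis by simp
  qed
qed

subsection \<open>Lipschitz continuity and differentiability of orbit maps\<close>

text \<open>
  Replaces the inverse function theorem: splitting off a product of one-parameter subgroups leaves a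
  group element whose coordinates \<open>r x\<close> are at most half as large, and this is iterated.
\<close>

lemma halving_iteration_bound:
  fixes F :: "'e::real_normed_vector \<Rightarrow> real"
  assumes F0: "(F \<longlongrightarrow> 0) (nhds 0)" and C: "C \<ge> 0"
    and ev: "\<forall>\<^sub>F x in nhds 0. norm (r x) \<le> norm x / 2 \<and> F x \<le> C * norm x + F (r x)"
  shows "\<forall>\<^sub>F x in nhds 0. F x \<le> 2 * C * norm x"
proof -
  obtain \<delta> where \<delta>: "\<delta> > 0" and near: "\<And>x. norm x < \<delta> \<Longrightarrow> norm (r x) \<le> norm x / 2 \<and> F x \<le> C * norm x + F (r x)"
    using ev by (auto simp: eventually_nhds_metric dist_norm)
  have "F x \<le> 2 * C * norm x" if "norm x < \<delta>" for x
  proof -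
    have small: "norm ((r ^^ n) y) \<le> norm y / 2 ^ n" if "norm y < \<delta>" for n y
      using that
    proof (induction n arbitrary: y)
      case (Suc n)
      have 1: "norm (r y) \<le> norm y / 2" using near[OF Suc.prems] by simp
      then have "norm (r y) < \<delta>" using Suc.prems norm_ge_zero[of y] by linarith
      from Suc.IH[OF this] have "norm ((r ^^ n) (r y)) \<le> norm (r y) / 2 ^ n" .
      also have "\<dots> \<le> norm y / 2 / 2 ^ n" using 1 by (intro divide_right_mono) auto
      finally show ?case by (simp add: funpow_swap1)
    qed simp
    \<comment> \<open>The factor 2 = 1 + 1/2 + 1/4 + ... reproduces itself:
      \<open>C * norm y\<close> plus twice \<open>C\<close> times half the norm is again
      \<open>2 * C * norm y\<close>.\<close>
    have step: "F y \<le> 2 * C * norm y + F ((r ^^ n) y)" if "norm y < \<delta>" for n y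
      using that
    proof (induction n arbitrary: y)
      case 0 then show ?case using C by simp
    next
      case (Suc n)
      have 1: "norm (r y) \<le> norm y / 2" using near[OF Suc.prems] by simp
      then have "norm (r y) < \<delta>" using Suc.prems norm_ge_zero[of y] by linarith
      from Suc.IH[OF this] near[OF Suc.prems]
      have "F y \<le> C * norm y + (2 * C * norm (r y) + F ((r ^^ n) (r y)))" by linarith
      also have "2 * C * norm (r y) \<le> 2 * C * (norm y / 2)" using 1 C by (intro mult_left_mono) auto
      finally show ?case by (simp add: funpow_swap1)
    qed
    have "(\<lambda>n. norm x * (1 / 2) ^ n) \<longlonglongrightarrow> norm x * 0"
      by (intro tendsto_mult tendsto_const LIMSEQ_realpow_zero) auto
    then have "(\<lambda>n. norm x / 2 ^ n) \<longlonglongrightarrow> 0" by (simp add: power_divide)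
    then have "(\<lambda>n. (r ^^ n) x) \<longlonglongrightarrow> 0"
      by (rule Lim_null_comparison[rotated]) (use small[OF that] in simp)
    then have "(\<lambda>n. F ((r ^^ n) x)) \<longlonglongrightarrow> 0" by (rule filterlim_compose[OF F0])
    then have "(\<lambda>n. 2 * C * norm x + F ((r ^^ n) x)) \<longlonglongrightarrow> 2 * C * norm x + 0" by (intro tendsto_intros)
    from LIMSEQ_le_const[OF this] step[OF that] show ?thesis by auto
  qed
  then show ?thesis using \<delta> by (auto simp: eventually_nhds_metric dist_norm)
qed

section \<open>The group law in a chart around the identity\<close>

locale lie_chart =
  fixes G :: "'g monoid" (structure) and T :: "'g topology" and \<A> :: "('g, 'e::banach) chart set"
    and c :: "('g, 'e) chart"
  assumes lie_group: "compact_lie_group G T \<A>" and chart_one: "chart_at_one G \<A> c"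

sublocale lie_chart \<subseteq> group G
  using lie_group by (simp add: compact_lie_group_def)

context lie_chart
begin

abbreviation "p \<equiv> coord c \<one>"

definition "mulc = (\<lambda>z. coord c (point c (fst z) \<otimes> point c (snd z)))"

definition "mulc_dom = {(x, y). x \<in> chart_img c \<and> y \<in> chart_img c \<and> point c x \<otimes> point c y \<in> chart_dom c}"

abbreviation "Dm z \<equiv> frechet_derivative mulc (at z)"

lemma topspace: "topspace T = carrier G"
  using lie_group by (simp add: compact_lie_group_def)

lemma one_in_dom: "\<one> \<in> chart_dom c" and c_in: "c \<in> \<A>"
  using chart_one by (auto simp: chart_at_one_def)

lemma open_dom: "openin T (chart_dom c)"
  and hom: "homeomorphic_map (subtopology T (chart_dom c)) (top_of_set (chart_img c)) (coord c)"
  and open_img: "open (chart_img c)"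
  and finite_span: "\<exists>B::'e set. finite B \<and> span B = UNIV"
  using lie_group c_in unfolding compact_lie_group_def smooth_atlas_def by auto

lemma dom_carrier: "chart_dom c \<subseteq> carrier G"
  using open_dom topspace openin_subset by fastforce

lemma point_coord: "g \<in> chart_dom c \<Longrightarrow> point c (coord c g) = g"
  using homeomorphic_imp_injective_map[OF hom] dom_carrier topspace
  by (simp add: Int_absorb1 point_def)

lemma coord_in_img: "g \<in> chart_dom c \<Longrightarrow> coord c g \<in> chart_img c"
  by (simp add: chart_img_def)

lemma point_in_dom: "x \<in> chart_img c \<Longrightarrow> point c x \<in> chart_dom c"
  by (auto simp: chart_img_def point_coord)

lemma coord_point: "x \<in> chart_img c \<Longrightarrow> coord c (point c x) = x"
  by (auto simp: chart_img_def point_coord)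

lemma eventually_point:
  assumes V: "openin T V" "\<one> \<in> V"
  shows "\<forall>\<^sub>F x in nhds p. x \<in> chart_img c \<and> point c x \<in> V"
proof -
  have "openin (subtopology T (chart_dom c)) (V \<inter> chart_dom c)"
    using V(1) by (auto simp: openin_subtopology)
  then have "openin (top_of_set (chart_img c)) (coord c ` (V \<inter> chart_dom c))"
    using homeomorphic_imp_open_map[OF hom] by (simp add: open_map_def)
  then have "open (coord c ` (V \<inter> chart_dom c))" using open_img openin_open_trans by blast
  moreover have "p \<in> coord c ` (V \<inter> chart_dom c)" using V(2) one_in_dom by blast
  ultimately have "\<forall>\<^sub>F x in nhds p. x \<in> coord c ` (V \<inter> chart_dom c)" by (rule eventually_nhds_in_open)
  then show ?thesis by eventually_elim (auto simp: point_coord coord_in_img)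
qed

lemma continuous_map_mult:
  assumes "continuous_map S T a" "continuous_map S T b"
  shows "continuous_map S T (\<lambda>t. a t \<otimes> b t)"
proof -
  have "continuous_map (prod_topology T T) T (\<lambda>(g, h). g \<otimes> h)"
    using lie_group by (simp add: compact_lie_group_def)
  from continuous_map_compose[OF continuous_map_pairedI[OF assms] this] show ?thesis
    by (simp add: o_def)
qed

lemma continuous_map_const_carrier: "g \<in> carrier G \<Longrightarrow> continuous_map S T (\<lambda>_. g)"
  using topspace by simp

lemma eventually_mulc_dom: "\<forall>\<^sub>F z in nhds (p, p). z \<in> mulc_dom"
proof -
  have "continuous_map (prod_topology T T) T (\<lambda>z. fst z \<otimes> snd z)"
    by (intro continuous_map_mult continuous_map_fst continuous_map_snd)
  from openin_continuous_map_preimage[OF this open_dom]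
  obtain V1 V2 where V: "openin T V1" "openin T V2" "\<one> \<in> V1" "\<one> \<in> V2"
    and sub: "V1 \<times> V2 \<subseteq> {z \<in> topspace (prod_topology T T). fst z \<otimes> snd z \<in> chart_dom c}"
    unfolding openin_prod_topology_alt using one_in_dom topspace
    by (auto dest!: spec[of _ \<one>])
  have "\<forall>\<^sub>F z in nhds p \<times>\<^sub>F nhds p. (fst z \<in> chart_img c \<and> point c (fst z) \<in> V1) \<and>
      (snd z \<in> chart_img c \<and> point c (snd z) \<in> V2)"
    using eventually_prodI[OF eventually_point[OF V(1,3)] eventually_point[OF V(2,4)]] by simp
  then show ?thesis
    unfolding nhds_prod by (rule eventually_mono) (use sub in \<open>auto simp: mulc_dom_def\<close>)
qed

lemma mulc_eq:
  "g \<in> chart_dom c \<Longrightarrow> h \<in> chart_dom c \<Longrightarrow> mulc (coord c g, coord c h) = coord c (g \<otimes> h)"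
  by (simp add: mulc_def point_coord)

lemma mulc_dom_coord:
  "g \<in> chart_dom c \<Longrightarrow> h \<in> chart_dom c \<Longrightarrow> g \<otimes> h \<in> chart_dom c \<Longrightarrow> (coord c g, coord c h) \<in> mulc_dom"
  by (simp add: mulc_dom_def coord_in_img point_coord)

lemma smooth_mulc: "smooth_on mulc_dom mulc"
proof -
  have "smooth_on mulc_dom (\<lambda>(x, y). coord c (point c x \<otimes> point c y))"
    using lie_group c_in unfolding compact_lie_group_def mulc_dom_def by blast
  then show ?thesis by (simp add: mulc_def case_prod_unfold)
qed

lemma mulc_has_derivative: "z \<in> mulc_dom \<Longrightarrow> (mulc has_derivative Dm z) (at z)"
proof -
  have "Ck_on (Suc 0) mulc_dom mulc" using smooth_mulc unfolding smooth_on_def by blast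
  then show "z \<in> mulc_dom \<Longrightarrow> ?thesis" by (simp add: frechet_derivative_works)
qed

text \<open>Second-order smoothness of the multiplication: the bracket differentiates
  \<open>Ad\<close>, which already consists of first derivatives of \<open>mulc\<close>.\<close>

lemma Dm_differentiable: "z \<in> mulc_dom \<Longrightarrow> (\<lambda>z. Dm z v) differentiable (at z)"
proof -
  have "Ck_on (Suc (Suc 0)) mulc_dom mulc" using smooth_mulc unfolding smooth_on_def by blast
  then show "z \<in> mulc_dom \<Longrightarrow> ?thesis" by (simp only: Ck_on.simps)
qed

lemma linear_Dm: "z \<in> mulc_dom \<Longrightarrow> linear (Dm z)"
  using mulc_has_derivative has_derivative_linear by blast

lemma p_p_dom: "(p, p) \<in> mulc_dom"
  by (rule mulc_dom_coord) (simp_all add: one_in_dom)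

text \<open>Multiplication by the identity on either side is the identity map near \<open>p\<close>,
  which determines both partial derivatives.\<close>

lemma Dm_one: "Dm (p, p) (a, b) = a + b"
proof -
  have ev: "\<forall>\<^sub>F x in nhds p. x \<in> chart_img c"
    by (rule eventually_nhds_in_open[OF open_img coord_in_img[OF one_in_dom]])
  have e: "mulc (x, p) = x" "mulc (p, x) = x" if "x \<in> chart_img c" for x
    using mulc_eq[OF point_in_dom[OF that] one_in_dom] mulc_eq[OF one_in_dom point_in_dom[OF that]]
      point_in_dom[OF that] dom_carrier by (auto simp: coord_point[OF that])
  have "((\<lambda>x. mulc (x, p)) has_derivative (\<lambda>v. Dm (p, p) (v, 0))) (at p)"
    using has_derivative_compose[of "\<lambda>x. (x, p)" "\<lambda>v. (v, 0)" p UNIV mulc "Dm (p, p)"]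
      mulc_has_derivative[OF p_p_dom]
    by (simp add: has_derivative_Pair)
  moreover have "((\<lambda>x. mulc (x, p)) has_derivative (\<lambda>v. v)) (at p)"
    by (rule has_derivative_transform_eventually[OF has_derivative_ident])
      (use ev in \<open>auto simp: eventually_at_filter e coord_in_img one_in_dom elim: eventually_mono\<close>)
  ultimately have 1: "Dm (p, p) (a, 0) = a" using has_derivative_unique by metis
  have "((\<lambda>x. mulc (p, x)) has_derivative (\<lambda>v. Dm (p, p) (0, v))) (at p)"
    using has_derivative_compose[of "\<lambda>x. (p, x)" "\<lambda>v. (0, v)" p UNIV mulc "Dm (p, p)"]
      mulc_has_derivative[OF p_p_dom]
    by (simp add: has_derivative_Pair)
  moreover have "((\<lambda>x. mulc (p, x)) has_derivative (\<lambda>v. v)) (at p)"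
    by (rule has_derivative_transform_eventually[OF has_derivative_ident])
      (use ev in \<open>auto simp: eventually_at_filter e coord_in_img one_in_dom elim: eventually_mono\<close>)
  ultimately have 2: "Dm (p, p) (0, b) = b" using has_derivative_unique by metis
  show ?thesis using linear_add[OF linear_Dm[OF p_p_dom], of "(a, 0)" "(0, b)"] 1 2 by simp
qed

lemma eventually_preimage:
  assumes a: "continuous_map euclidean T a" and V: "openin T V" "a x \<in> V"
  shows "\<forall>\<^sub>F y in nhds x. a y \<in> V"
proof -
  have "open {y. a y \<in> V}" using openin_continuous_map_preimage[OF a V(1)] by simp
  then show ?thesis using eventually_nhds_in_open[of "{y. a y \<in> V}" x] V(2) by simp
qed

end

text \<open>A product rule for operators that are only strongly continuous. Isometry passes the
  error of \<open>w\<close> on without enlarging it, and strong continuity is used at the single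
  vector \<open>v\<close>, the direction of the derivative of \<open>w\<close>.\<close>

lemma has_derivative_isometry_family:
  fixes w :: "'e::real_normed_vector \<Rightarrow> 'h::real_normed_vector"
  assumes V: "\<And>x. linear (V x)" "\<And>x v. norm (V x v) = norm v"
    and w: "(w has_derivative (\<lambda>x. l x *\<^sub>R v)) (at 0)" and l: "bounded_linear l"
    and u: "((\<lambda>x. V x (w 0)) has_derivative u') (at 0)" and V0: "V 0 (w 0) = w 0"
    and v: "((\<lambda>x. V x v) \<longlongrightarrow> v) (at 0)"
  shows "((\<lambda>x. V x (w x)) has_derivative (\<lambda>x. u' x + l x *\<^sub>R v)) (at 0)"
proof -
  obtain K where K: "K \<ge> 0" "\<And>x. norm (l x) \<le> norm x * K"
    using bounded_linear.nonneg_bounded[OF l] by blast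
  let ?e = "\<lambda>x. norm (V x (w 0) - w 0 - u' x) / norm x + norm (w x - w 0 - l x *\<^sub>R v) / norm x + K * norm (V x v - v)"
  have "((\<lambda>x. norm (V x (w 0) - w 0 - u' x) / norm x) \<longlongrightarrow> 0) (at 0)"
    using u V0 by (simp add: has_derivative_iff_norm)
  moreover have "((\<lambda>x. norm (w x - w 0 - l x *\<^sub>R v) / norm x) \<longlongrightarrow> 0) (at 0)"
    using w by (simp add: has_derivative_iff_norm)
  moreover have "((\<lambda>x. K * norm (V x v - v)) \<longlongrightarrow> 0) (at 0)"
    using tendsto_mult_right_zero[OF tendsto_norm_zero[OF LIM_zero[OF v]], of K] by simp
  ultimately have "(?e \<longlongrightarrow> 0 + 0 + 0) (at 0)" by (intro tendsto_add)
  then have e: "(?e \<longlongrightarrow> 0) (at 0)" by simp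
  have "norm (V x (w x) - w 0 - (u' x + l x *\<^sub>R v)) / norm x \<le> ?e x" if "x \<noteq> 0" for x
  proof -
    have "V x (w x) = V x (w 0) + V x (w x - w 0 - l x *\<^sub>R v) + l x *\<^sub>R V x v"
      by (simp add: linear_diff[OF V(1)] linear_scale[OF V(1)])
    then have "V x (w x) - w 0 - (u' x + l x *\<^sub>R v)
        = (V x (w 0) - w 0 - u' x) + V x (w x - w 0 - l x *\<^sub>R v) + l x *\<^sub>R (V x v - v)"
      by (simp add: scaleR_diff_right)
    then have "norm (V x (w x) - w 0 - (u' x + l x *\<^sub>R v))
        \<le> norm (V x (w 0) - w 0 - u' x) + norm (V x (w x - w 0 - l x *\<^sub>R v)) + norm (l x *\<^sub>R (V x v - v))"
      by (metis (no_types, opaque_lifting) norm_triangle_mono norm_triangle_ineq order_refl)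
    also have "\<dots> \<le> norm (V x (w 0) - w 0 - u' x) + norm (w x - w 0 - l x *\<^sub>R v) + norm x * K * norm (V x v - v)"
      using mult_right_mono[OF K(2)[of x] norm_ge_zero[of "V x v - v"]] by (simp add: V(2))
    finally have "norm (V x (w x) - w 0 - (u' x + l x *\<^sub>R v)) / norm x
        \<le> (norm (V x (w 0) - w 0 - u' x) + norm (w x - w 0 - l x *\<^sub>R v) + norm x * K * norm (V x v - v)) / norm x"
      by (rule divide_right_mono) simp
    also have "\<dots> = ?e x" using that by (simp add: add_divide_distrib)
    finally show ?thesis .
  qed
  then have "\<forall>\<^sub>F x in at 0. norm (norm (V x (w x) - w 0 - (u' x + l x *\<^sub>R v)) / norm x) \<le> ?e x"
    by (simp add: eventually_at_filter)
  from Lim_null_comparison[OF this e]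
  have "((\<lambda>x. norm (V x (w x) - w 0 - (u' x + l x *\<^sub>R v)) / norm x) \<longlongrightarrow> 0) (at 0)" .
  moreover have "bounded_linear (\<lambda>x. u' x + l x *\<^sub>R v)"
    using u l by (intro bounded_linear_add bounded_linear_scaleR_const) (auto simp: has_derivative_iff_norm)
  ultimately show ?thesis by (simp add: has_derivative_iff_norm V0)
qed

lemma has_derivative_along_curve:
  assumes "(f has_vector_derivative v) (at t)" "(g has_derivative D) (at (f t))"
  shows "((\<lambda>t. g (f t)) has_vector_derivative D v) (at t)"
  using vector_derivative_diff_chain_within[OF assms(1) has_derivative_at_withinI[OF assms(2)]]
  by (simp add: o_def)

lemma has_derivative_0_eventually_le:
  fixes r :: "'e::real_normed_vector \<Rightarrow> 'f::real_normed_vector"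
  assumes r: "(r has_derivative (\<lambda>_. 0)) (at 0)" and r0: "r 0 = 0" and e: "e > 0"
  shows "\<forall>\<^sub>F x in nhds 0. norm (r x) \<le> e * norm x"
proof -
  have "((\<lambda>x. norm (r x) / norm x) \<longlongrightarrow> 0) (at 0)" using r r0 by (simp add: has_derivative_iff_norm)
  then have "\<forall>\<^sub>F x in at 0. norm (r x) / norm x < e" using e by (rule order_tendstoD)
  then show ?thesis
    unfolding eventually_at_filter
    by eventually_elim (use r0 in \<open>auto simp: field_simps intro: less_imp_le\<close>)
qed

section \<open>The orbit map of a vector differentiable along one-parameter subgroups\<close>

locale lie_vector = lie_chart G T \<A> c
  for G :: "'g monoid" (structure) and T :: "'g topology" and \<A> :: "('g, 'e::banach) chart set"
    and c :: "('g, 'e) chart" +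
  fixes U :: "'g \<Rightarrow> 'h::complex_hilbert \<Rightarrow> 'h" and \<psi> :: 'h
  assumes rep: "unitary_rep G T U" and dom: "\<And>X. \<psi> \<in> generator_dom G T c U X"
begin

definition "gam X = (SOME \<gamma>. one_parameter_subgroup G T c X \<gamma>)"

abbreviation "gen X \<equiv> generator G T c U X"

text \<open>Existence of the exponential is read off the domain hypothesis: membership of
  \<open>\<psi>\<close> in \<open>generator_dom\<close> for \<open>X\<close> contains a
  one-parameter subgroup with velocity \<open>X\<close>.\<close>

lemma gam: "one_parameter_subgroup G T c X (gam X)"
proof -
  have "\<exists>\<gamma>. one_parameter_subgroup G T c X \<gamma>"
    using dom[of X] by (auto simp: generator_dom_def generator_rel_def)
  then show ?thesis unfolding gam_def by (rule someI_ex)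
qed

lemmas gam_carrier = one_parameter_subgroup_one(1)[OF lie_group gam]
  and gam_0 = one_parameter_subgroup_one(2)[OF lie_group gam]
  and gam_minus = one_parameter_subgroup_one(3)[OF lie_group gam]

lemma gam_continuous: "continuous_map euclidean T (gam X)"
  using gam by (simp add: one_parameter_subgroup_def)

lemma gam_derivative: "((\<lambda>t. coord c (gam X t)) has_vector_derivative X) (at 0)"
  using gam by (simp add: one_parameter_subgroup_def)

definition "basis = (SOME B::'e set. finite B \<and> independent B \<and> span B = UNIV)"

lemma basis: "finite basis" "independent basis" "span basis = UNIV"
proof -
  obtain S :: "'e set" where S: "finite S" "span S = UNIV" using finite_span by blast
  obtain B where B: "B \<subseteq> S" "independent B" "span B = span S"
    using maximal_independent_subset[of S] span_mono span_span span_superset by (metis subset_antisym)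
  then have "\<exists>B::'e set. finite B \<and> independent B \<and> span B = UNIV"
    using S finite_subset by metis
  then have "finite basis \<and> independent basis \<and> span basis = UNIV"
    unfolding basis_def by (rule someI_ex)
  then show "finite basis" "independent basis" "span basis = UNIV" by auto
qed

definition "coef b = (\<lambda>x. representation basis x b)"

lemma bounded_linear_coef: "bounded_linear (coef b)"
  unfolding coef_def by (rule bounded_linear_representation[OF basis])

lemma coef_0: "coef b 0 = 0"
  by (rule linear_0[OF bounded_linear.linear[OF bounded_linear_coef]])

lemma sum_coef: "(\<Sum>b\<in>basis. coef b x *\<^sub>R b) = x"
  unfolding coef_def using sum_representation_eq[OF basis(2), of x basis] basis by simp

lemma continuous_map_gam_linear:
  assumes "bounded_linear l"
  shows "continuous_map euclidean T (\<lambda>x. gam b (l x))"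
proof -
  have "continuous_map euclidean euclideanreal l" using assms by (simp add: linear_continuous_on)
  from continuous_map_compose[OF this gam_continuous] show ?thesis by (simp add: o_def)
qed

lemma coord_gam_linear_derivative:
  assumes "bounded_linear l"
  shows "((\<lambda>x. coord c (gam b (l x))) has_derivative (\<lambda>x. l x *\<^sub>R b)) (at 0)"
proof -
  have "(l has_derivative l) (at 0)" by (rule bounded_linear_imp_has_derivative[OF assms])
  moreover have "((\<lambda>t. coord c (gam b t)) has_derivative (\<lambda>t. t *\<^sub>R b)) (at (l 0))"
    using gam_derivative by (simp add: has_vector_derivative_def linear_0[OF bounded_linear.linear[OF assms]])
  ultimately show ?thesis by (rule has_derivative_compose)
qed

text \<open>
  Coordinates of the second kind: \<open>prodp bs x\<close> is the product of the \<open>exp (x\<^sub>b b)\<close>, and \<open>resid bs x\<close>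
  is what remains of the point with coordinates \<open>p + x\<close> after splitting off this product.
\<close>

primrec resid :: "'e list \<Rightarrow> 'e \<Rightarrow> 'g" where
  "resid [] x = point c (p + x)"
| "resid (b # bs) x = gam b (- coef b x) \<otimes> resid bs x"

primrec prodp :: "'e list \<Rightarrow> 'e \<Rightarrow> 'g" where
  "prodp [] x = \<one>"
| "prodp (b # bs) x = prodp bs x \<otimes> gam b (coef b x)"

lemma prodp_carrier: "prodp bs x \<in> carrier G"
  by (induction bs) (auto simp: gam_carrier)

lemma resid_carrier: "point c (p + x) \<in> carrier G \<Longrightarrow> resid bs x \<in> carrier G"
  by (induction bs) (auto simp: gam_carrier)

lemma prodp_resid:
  assumes x: "point c (p + x) \<in> carrier G"
  shows "prodp bs x \<otimes> resid bs x = point c (p + x)"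
proof (induction bs)
  case Nil
  then show ?case using x by simp
next
  case (Cons b bs)
  have "gam b (coef b x) \<otimes> (gam b (- coef b x) \<otimes> resid bs x) = resid bs x"
    using resid_carrier[OF x] gam_carrier by (simp add: gam_minus flip: m_assoc)
  then show ?case
    using Cons resid_carrier[OF x] prodp_carrier gam_carrier by (simp add: m_assoc)
qed

lemma resid_0: "resid bs 0 = \<one>"
  by (induction bs) (auto simp: point_coord one_in_dom coef_0 gam_0)

lemma prodp_0: "prodp bs 0 = \<one>"
  by (induction bs) (auto simp: coef_0 gam_0)

lemma eventually_point_shift:
  assumes "openin T V" "\<one> \<in> V"
  shows "\<forall>\<^sub>F x in nhds 0. p + x \<in> chart_img c \<and> point c (p + x) \<in> V"
proof -
  have "filterlim (\<lambda>x. p + x) (nhds (p + 0)) (nhds 0)"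
    by (intro tendsto_add tendsto_const) (simp add: filterlim_ident)
  then have "filterlim (\<lambda>x. p + x) (nhds p) (nhds 0)" by simp
  from eventually_compose_filterlim[OF eventually_point[OF assms] this] show ?thesis .
qed

text \<open>At the identity multiplication differentiates to addition, so each split-off factor
  removes one component of \<open>x\<close>. Over a full basis the derivative is 0, which makes the
  remainder much smaller than \<open>x\<close>. Staying in the chart is carried along to keep
  \<open>mulc\<close> applicable.\<close>

lemma resid_derivative:
  assumes "distinct bs"
  shows "(\<forall>\<^sub>F x in nhds 0. resid bs x \<in> chart_dom c) \<and>
    ((\<lambda>x. coord c (resid bs x)) has_derivative (\<lambda>x. x - (\<Sum>b\<in>set bs. coef b x *\<^sub>R b))) (at 0)"
  using assms
proof (induction bs)
  case Nil
  have ev: "\<forall>\<^sub>F x in nhds 0. p + x \<in> chart_img c \<and> point c (p + x) \<in> chart_dom c"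
    by (rule eventually_point_shift[OF open_dom one_in_dom])
  have "((\<lambda>x. p + x) has_derivative (\<lambda>x. x)) (at 0)" by (auto intro!: derivative_eq_intros)
  then have "((\<lambda>x. coord c (point c (p + x))) has_derivative (\<lambda>x. x)) (at 0)"
    by (rule has_derivative_transform_eventually)
      (use ev in \<open>auto simp: eventually_at_filter coord_point coord_in_img one_in_dom point_coord elim: eventually_mono\<close>)
  then show ?case using ev by (auto elim: eventually_mono)
next
  case (Cons b bs)
  define h where "h = (\<lambda>x. gam b (- coef b x))"
  have bl: "bounded_linear (\<lambda>x. - coef b x)" by (intro bounded_linear_minus bounded_linear_coef)
  have h1: "\<forall>\<^sub>F x in nhds 0. h x \<in> chart_dom c"
    unfolding h_def using continuous_map_gam_linear[OF bl]
    by (rule eventually_preimage[OF _ open_dom]) (simp add: coef_0 gam_0 one_in_dom)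
  have h2: "((\<lambda>x. coord c (h x)) has_derivative (\<lambda>x. - coef b x *\<^sub>R b)) (at 0)"
    unfolding h_def by (rule coord_gam_linear_derivative[OF bl])
  from Cons have r1: "\<forall>\<^sub>F x in nhds 0. resid bs x \<in> chart_dom c"
    and r2: "((\<lambda>x. coord c (resid bs x)) has_derivative (\<lambda>x. x - (\<Sum>b\<in>set bs. coef b x *\<^sub>R b))) (at 0)" by auto
  have pair: "((\<lambda>x. (coord c (h x), coord c (resid bs x))) has_derivative
      (\<lambda>x. (- coef b x *\<^sub>R b, x - (\<Sum>b\<in>set bs. coef b x *\<^sub>R b)))) (at 0)"
    by (rule has_derivative_Pair[OF h2 r2])
  have at0: "(coord c (h 0), coord c (resid bs 0)) = (p, p)" by (simp add: h_def coef_0 gam_0 resid_0)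
  have "filterlim (\<lambda>x. (coord c (h x), coord c (resid bs x))) (nhds (p, p)) (nhds 0)"
    using has_derivative_continuous[OF pair] tendsto_at_iff_tendsto_nhds[of "\<lambda>x. (coord c (h x), coord c (resid bs x))" 0]
    unfolding isCont_def at0 by simp
  from eventually_compose_filterlim[OF eventually_mulc_dom this]
  have "\<forall>\<^sub>F x in nhds 0. (coord c (h x), coord c (resid bs x)) \<in> mulc_dom" .
  with h1 r1 have ev: "\<forall>\<^sub>F x in nhds 0. h x \<in> chart_dom c \<and> resid bs x \<in> chart_dom c \<and> h x \<otimes> resid bs x \<in> chart_dom c"
    by eventually_elim (auto simp: mulc_dom_def point_coord)
  have "((\<lambda>x. mulc (coord c (h x), coord c (resid bs x))) has_derivative
      (\<lambda>x. Dm (p, p) (- coef b x *\<^sub>R b, x - (\<Sum>b\<in>set bs. coef b x *\<^sub>R b)))) (at 0)"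
    using has_derivative_compose[OF pair, of mulc "Dm (p, p)"] mulc_has_derivative[OF p_p_dom] at0 by simp
  then have "((\<lambda>x. coord c (h x \<otimes> resid bs x)) has_derivative
      (\<lambda>x. Dm (p, p) (- coef b x *\<^sub>R b, x - (\<Sum>b\<in>set bs. coef b x *\<^sub>R b)))) (at 0)"
    by (rule has_derivative_transform_eventually)
      (use ev eventually_nhds_x_imp_x[OF ev] in \<open>auto simp: eventually_at_filter mulc_eq elim: eventually_mono\<close>)
  then show ?case
    using ev Cons.prems by (auto simp: h_def Dm_one algebra_simps elim: eventually_mono)
qed

lemma continuous_map_prodp: "continuous_map euclidean T (prodp bs)"
proof (induction bs)
  case (Cons b bs)
  from continuous_map_mult[OF this continuous_map_gam_linear[OF bounded_linear_coef[of b], of b]]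
  show ?case by simp
qed (simp add: topspace)

lemma U_mult: "g \<in> carrier G \<Longrightarrow> h \<in> carrier G \<Longrightarrow> U (g \<otimes> h) v = U g (U h v)"
  using rep by (auto simp: unitary_rep_def)

lemma U_one: "U \<one> v = v"
  by (rule unitary_rep_one[OF is_group rep])

lemma U_norm: "g \<in> carrier G \<Longrightarrow> norm (U g v) = norm v"
  by (rule unitary_pair_norm[OF unitary_rep_pair[OF is_group rep]])

lemma U_clinear: "g \<in> carrier G \<Longrightarrow> bounded_clinear (U g)"
  using rep by (auto simp: unitary_rep_def)

lemma U_linear: "g \<in> carrier G \<Longrightarrow> linear (U g)"
  using U_clinear bounded_clinear_bounded_linear bounded_linear.linear by blast

lemma U_tendsto:
  fixes a :: "'b::t2_space \<Rightarrow> 'g"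
  assumes a: "continuous_map euclidean T a"
  shows "((\<lambda>x. U (a x) v) \<longlongrightarrow> U (a x0) v) (nhds x0)"
proof -
  have "continuous_map T euclidean (\<lambda>g. U g v)" using rep by (simp add: unitary_rep_def)
  from continuous_map_compose[OF a this] have "continuous_on UNIV (\<lambda>x. U (a x) v)" by (simp add: o_def)
  then have "isCont (\<lambda>x. U (a x) v) x0" by (simp add: continuous_on_eq_continuous_at)
  then show ?thesis using tendsto_at_iff_tendsto_nhds[of "\<lambda>x. U (a x) v" x0] by (simp add: isCont_def)
qed

lemma U_gam_derivative: "((\<lambda>t. U (gam X t) \<psi>) has_vector_derivative \<i> *\<^sub>C gen X \<psi>) (at 0)"
  by (rule generator_derivative[OF lie_group chart_one gam dom])

text \<open>\<open>prodp\<close> appends new factors on the right so that the newest one acts on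
  \<open>\<psi>\<close>, where its derivative is known; the earlier factors are then the isometries
  of the product rule.\<close>

lemma prodp_orbit_derivative:
  assumes "distinct bs"
  shows "((\<lambda>x. U (prodp bs x) \<psi>) has_derivative (\<lambda>x. \<Sum>b\<in>set bs. coef b x *\<^sub>R \<i> *\<^sub>C gen b \<psi>)) (at 0)"
  using assms
proof (induction bs)
  case Nil
  then show ?case by (simp add: U_one)
next
  case (Cons b bs)
  have w: "((\<lambda>x. U (gam b (coef b x)) \<psi>) has_derivative (\<lambda>x. coef b x *\<^sub>R \<i> *\<^sub>C gen b \<psi>)) (at 0)"
    using has_derivative_compose[OF bounded_linear_imp_has_derivative[OF bounded_linear_coef[of b]],
        of "\<lambda>t. U (gam b t) \<psi>" "\<lambda>t. t *\<^sub>R \<i> *\<^sub>C gen b \<psi>" 0 UNIV] U_gam_derivative[of b]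
    by (simp add: has_vector_derivative_def coef_0)
  have "((\<lambda>x. U (prodp bs x) (U (gam b (coef b x)) \<psi>)) has_derivative
      (\<lambda>x. (\<Sum>b\<in>set bs. coef b x *\<^sub>R \<i> *\<^sub>C gen b \<psi>) + coef b x *\<^sub>R \<i> *\<^sub>C gen b \<psi>)) (at 0)"
  proof (rule has_derivative_isometry_family[OF _ _ w bounded_linear_coef])
    show "((\<lambda>x. U (prodp bs x) (\<i> *\<^sub>C gen b \<psi>)) \<longlongrightarrow> \<i> *\<^sub>C gen b \<psi>) (at 0)"
      using U_tendsto[OF continuous_map_prodp[of bs], of "\<i> *\<^sub>C gen b \<psi>" 0]
        tendsto_at_iff_tendsto_nhds[of "\<lambda>x. U (prodp bs x) (\<i> *\<^sub>C gen b \<psi>)" 0]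
      by (simp add: prodp_0 U_one)
  qed (use Cons in \<open>auto simp: U_linear U_norm prodp_carrier coef_0 gam_0 U_one prodp_0\<close>)
  then show ?case
    using Cons.prems by (simp add: U_mult prodp_carrier gam_carrier add.commute)
qed

text \<open>A group element is a product \<open>prodp\<close> times a remainder with coordinates
  \<open>r x\<close>, and the orbit of the product is already differentiable. By unitarity the error
  is \<open>F (r x)\<close>, the displacement of \<open>\<psi>\<close> by the remainder. The halving
  iteration makes \<open>F\<close> Lipschitz at 0, and \<open>r\<close> has derivative 0, so the
  error is of smaller order than \<open>x\<close>.\<close>

lemma orbit_derivative:
  "((\<lambda>x. U (point c (p + x)) \<psi>) has_derivative (\<lambda>x. \<Sum>b\<in>basis. coef b x *\<^sub>R \<i> *\<^sub>C gen b \<psi>)) (at 0)"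
proof -
  obtain bs where bs: "set bs = basis" "distinct bs"
    using finite_distinct_list[OF basis(1)] by blast
  define r where "r = (\<lambda>x. coord c (resid bs x) - p)"
  define P where "P = (\<lambda>x. U (prodp bs x) \<psi>)"
  define D where "D = (\<lambda>x. \<Sum>b\<in>basis. coef b x *\<^sub>R \<i> *\<^sub>C gen b \<psi>)"
  define F where "F = (\<lambda>x. norm (U (point c (p + x)) \<psi> - \<psi>))"
  have res: "\<forall>\<^sub>F x in nhds 0. resid bs x \<in> chart_dom c"
    and "((\<lambda>x. coord c (resid bs x)) has_derivative (\<lambda>_. 0)) (at 0)"
    using resid_derivative[OF bs(2)] by (simp_all add: bs(1) sum_coef)
  then have r: "(r has_derivative (\<lambda>_. 0)) (at 0)"
    unfolding r_def using has_derivative_diff[OF _ has_derivative_const, of _ "\<lambda>_. 0"] by fastforce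
  have r0: "r 0 = 0" by (simp add: r_def resid_0)
  have P: "(P has_derivative D) (at 0)" and P0: "P 0 = \<psi>"
    using prodp_orbit_derivative[OF bs(2)] by (simp_all add: P_def D_def bs(1) prodp_0 U_one)
  obtain K where K: "K \<ge> 0" "\<And>x. norm (D x) \<le> norm x * K"
    using bounded_linear.nonneg_bounded[OF has_derivative_bounded_linear[OF P]] by blast
  have "((\<lambda>x. P x - \<psi> - D x) has_derivative (\<lambda>x. D x - 0 - D x)) (at 0)"
    by (intro has_derivative_diff P has_derivative_const bounded_linear_imp_has_derivative
        has_derivative_bounded_linear[OF P])
  then have "((\<lambda>x. P x - \<psi> - D x) has_derivative (\<lambda>_. 0)) (at 0)" by simp
  from has_derivative_0_eventually_le[OF this, of 1]
  have "\<forall>\<^sub>F x in nhds 0. norm (P x - \<psi> - D x) \<le> 1 * norm x"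
    using P0 linear_0[OF bounded_linear.linear[OF has_derivative_bounded_linear[OF P]]] by simp
  then have PL: "\<forall>\<^sub>F x in nhds 0. norm (P x - \<psi>) \<le> (K + 1) * norm x"
  proof eventually_elim
    case (elim x)
    have "norm (P x - \<psi>) \<le> norm (P x - \<psi> - D x) + norm (D x)"
      using norm_triangle_ineq[of "P x - \<psi> - D x" "D x"] by simp
    then show ?case using elim K(2)[of x] by (simp add: algebra_simps)
  qed
  have split: "U (point c (p + x)) \<psi> = U (prodp bs x) (U (point c (p + r x)) \<psi>) \<and> point c (p + r x) \<in> carrier G"
    if "point c (p + x) \<in> chart_dom c" "resid bs x \<in> chart_dom c" for x
    using that dom_carrier prodp_resid[of x bs] U_mult[OF prodp_carrier, of "resid bs x" bs x \<psi>]
    by (auto simp: r_def point_coord subset_iff)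
  have evc: "\<forall>\<^sub>F x in nhds 0. point c (p + x) \<in> chart_dom c"
    using eventually_point_shift[OF open_dom one_in_dom] by eventually_elim simp
  have FF: "\<forall>\<^sub>F x in nhds 0. norm (U (point c (p + x)) \<psi> - P x) = F (r x)"
    using evc res
  proof eventually_elim
    case (elim x)
    have "norm (U (point c (p + x)) \<psi> - P x) = norm (U (prodp bs x) (U (point c (p + r x)) \<psi> - \<psi>))"
      using split[OF elim] by (simp add: P_def linear_diff[OF U_linear[OF prodp_carrier]])
    then show ?case by (simp add: F_def U_norm prodp_carrier)
  qed
  \<comment> \<open>The constant \<open>K + 1\<close> is the Lipschitz bound \<open>PL\<close> of
    the product part, with \<open>K\<close> from its derivative and 1 from the remainder
    term.\<close>
  have "\<forall>\<^sub>F x in nhds 0. norm (r x) \<le> norm x / 2 \<and> F x \<le> (K + 1) * norm x + F (r x)"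
    using FF PL has_derivative_0_eventually_le[OF r r0, of "1/2", simplified]
  proof eventually_elim
    case (elim x)
    have "F x \<le> norm (U (point c (p + x)) \<psi> - P x) + norm (P x - \<psi>)"
      unfolding F_def using norm_triangle_ineq[of "U (point c (p + x)) \<psi> - P x" "P x - \<psi>"] by simp
    then show ?case using elim by simp
  qed
  moreover have "(F \<longlongrightarrow> 0) (nhds 0)"
  proof (rule tendstoI)
    fix e :: real assume e: "e > 0"
    define V where "V = {g \<in> topspace T. U g \<psi> \<in> ball \<psi> e}"
    have "continuous_map T euclidean (\<lambda>g. U g \<psi>)" using rep by (simp add: unitary_rep_def)
    from openin_continuous_map_preimage[OF this, of "ball \<psi> e"]
    have "openin T V" by (simp add: V_def)
    moreover have "\<one> \<in> V" using e by (simp add: V_def topspace U_one)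
    ultimately have "\<forall>\<^sub>F x in nhds 0. p + x \<in> chart_img c \<and> point c (p + x) \<in> V"
      by (rule eventually_point_shift)
    then show "\<forall>\<^sub>F x in nhds 0. dist (F x) 0 < e"
      by eventually_elim (simp add: V_def F_def dist_norm norm_minus_commute)
  qed
  ultimately have FL: "\<forall>\<^sub>F x in nhds 0. F x \<le> 2 * (K + 1) * norm x"
    using K(1) by (intro halving_iteration_bound[of F "K + 1" r]) auto
  have rlim: "filterlim r (nhds 0) (nhds 0)"
    using has_derivative_continuous[OF r] tendsto_at_iff_tendsto_nhds[of r 0] by (simp add: isCont_def r0)
  have "\<forall>\<^sub>F x in nhds 0. norm (U (point c (p + x)) \<psi> - P x) \<le> 2 * (K + 1) * norm (r x)"
    using FF eventually_compose_filterlim[OF FL rlim] by eventually_elim simp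
  then have ev: "\<forall>\<^sub>F x in at 0. norm (norm (U (point c (p + x)) \<psi> - P x) / norm x) \<le> 2 * (K + 1) * (norm (r x) / norm x)"
    unfolding eventually_at_filter by eventually_elim (simp add: divide_right_mono)
  have "((\<lambda>x. 2 * (K + 1) * (norm (r x) / norm x)) \<longlongrightarrow> 0) (at 0)"
    using r r0 by (intro tendsto_mult_right_zero) (simp add: has_derivative_iff_norm)
  from Lim_null_comparison[OF ev this]
  have "((\<lambda>x. U (point c (p + x)) \<psi> - P x) has_derivative (\<lambda>_. 0)) (at 0)"
    by (simp add: has_derivative_iff_norm P0 point_coord one_in_dom U_one)
  from has_derivative_add[OF P this] show ?thesis by (simp add: D_def)
qed

text \<open>Chain rule along \<open>gam X\<close> for the orbit map. The formula exhibits linearity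
  in \<open>X\<close> of the generator at the fixed vector \<open>\<psi>\<close>.\<close>

lemma gen_eq: "gen X \<psi> = (\<Sum>b\<in>basis. coef b X *\<^sub>R gen b \<psi>)"
proof -
  define D where "D = (\<lambda>x. \<Sum>b\<in>basis. coef b x *\<^sub>R \<i> *\<^sub>C gen b \<psi>)"
  have "((\<lambda>t. coord c (gam X t) - p) has_vector_derivative X) (at 0)"
    using has_vector_derivative_diff[OF gam_derivative has_vector_derivative_const, of X p] by simp
  then have "((\<lambda>t. U (point c (p + (coord c (gam X t) - p))) \<psi>) has_vector_derivative D X) (at 0)"
    by (rule has_derivative_along_curve) (simp add: gam_0 D_def orbit_derivative)
  moreover have "open {t. gam X t \<in> chart_dom c}"
    using openin_continuous_map_preimage[OF gam_continuous open_dom] by simp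
  ultimately have "((\<lambda>t. U (gam X t) \<psi>) has_vector_derivative D X) (at 0)"
    by (rule has_vector_derivative_transform_within_open) (auto simp: gam_0 one_in_dom point_coord)
  then have "\<i> *\<^sub>C gen X \<psi> = D X" using U_gam_derivative vector_derivative_unique_at by blast
  then have "(- \<i>) *\<^sub>C \<i> *\<^sub>C gen X \<psi> = (- \<i>) *\<^sub>C D X" by simp
  then show ?thesis
    by (simp add: D_def scaleC_scaleC scaleC_sum_right scaleR_scaleC mult.left_commute[of \<i>])
qed

lemma bounded_linear_gen: "bounded_linear (\<lambda>X. gen X \<psi>)"
  by (subst gen_eq) (intro bounded_linear_sum bounded_linear_scaleR_const bounded_linear_coef)

end

context lie_chart
begin

subsection \<open>The adjoint representation in the chart\<close>

definition "invc = (\<lambda>x. coord c (inv (point c x)))"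

definition "inv_in_chart x \<longleftrightarrow> x \<in> chart_img c \<and> inv (point c x) \<in> chart_dom c"

lemma eventually_inv_in_chart: "\<forall>\<^sub>F x in nhds p. inv_in_chart x"
proof -
  have "continuous_map T T (\<lambda>g. inv g)"
    using lie_group by (simp add: compact_lie_group_def)
  from openin_continuous_map_preimage[OF this open_dom]
  have "openin T {g \<in> carrier G. inv g \<in> chart_dom c}" by (simp add: topspace)
  then show ?thesis
    by (rule eventually_mono[OF eventually_point]) (auto simp: inv_in_chart_def one_in_dom)
qed

lemma inv_in_chart_p: "inv_in_chart p"
  by (simp add: inv_in_chart_def coord_in_img point_coord one_in_dom)

lemma invc_p: "invc p = p"
  by (simp add: invc_def point_coord one_in_dom)

lemma invc_differentiable: "invc differentiable (at p)"
proof -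
  have "smooth_on {x. inv_in_chart x} invc"
    using lie_group c_in unfolding compact_lie_group_def inv_in_chart_def invc_def by blast
  then have "Ck_on (Suc 0) {x. inv_in_chart x} invc" unfolding smooth_on_def by blast
  then show ?thesis using inv_in_chart_p by simp
qed

lemma point_carrier: "x \<in> chart_img c \<Longrightarrow> point c x \<in> carrier G"
  using point_in_dom dom_carrier by blast

lemma inv_in_chart_mulc_dom:
  assumes "inv_in_chart x"
  shows "(x, p) \<in> mulc_dom" "(x, invc x) \<in> mulc_dom" "mulc (x, p) = x"
proof -
  have x: "x \<in> chart_img c" "point c x \<in> chart_dom c" "point c x \<in> carrier G" "inv (point c x) \<in> chart_dom c"
    using assms by (auto simp: inv_in_chart_def point_in_dom point_carrier)
  show "(x, p) \<in> mulc_dom"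
    using mulc_dom_coord[OF x(2) one_in_dom] x by (simp add: coord_point)
  show "(x, invc x) \<in> mulc_dom"
    using mulc_dom_coord[OF x(2,4)] x one_in_dom by (simp add: coord_point invc_def)
  show "mulc (x, p) = x"
    using mulc_eq[OF x(2) one_in_dom] x by (simp add: coord_point)
qed

text \<open>Conjugation is two chart multiplications, \<open>mulc (mulc (x, y), invc x)\<close>; the
  neighbourhood \<open>V\<close> keeps the intermediate and the final product in the chart.\<close>

lemma conjugation_derivative:
  assumes x: "inv_in_chart x"
  shows "((\<lambda>y. coord c (point c x \<otimes> point c y \<otimes> inv (point c x))) has_derivative
    (\<lambda>v. Dm (x, invc x) (Dm (x, p) (0, v), 0))) (at p)"
proof -
  define g where "g = point c x"
  have g: "g \<in> chart_dom c" "g \<in> carrier G" "inv g \<in> chart_dom c" "coord c g = x" "coord c (inv g) = invc x"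
    using x by (auto simp: g_def inv_in_chart_def point_in_dom point_carrier coord_point invc_def)
  note md = inv_in_chart_mulc_dom[OF x]
  have 1: "((\<lambda>y. mulc (x, y)) has_derivative (\<lambda>v. Dm (x, p) (0, v))) (at p)"
    using has_derivative_compose[of "\<lambda>y. (x, y)" "\<lambda>v. (0, v)" p UNIV mulc "Dm (x, p)"]
      mulc_has_derivative[OF md(1)] by (simp add: has_derivative_Pair)
  have "((\<lambda>y. (mulc (x, y), invc x)) has_derivative (\<lambda>v. (Dm (x, p) (0, v), 0))) (at p)"
    by (rule has_derivative_Pair[OF 1 has_derivative_const])
  then have 2: "((\<lambda>y. mulc (mulc (x, y), invc x)) has_derivative
      (\<lambda>v. Dm (x, invc x) (Dm (x, p) (0, v), 0))) (at p)"
    using has_derivative_compose[of "\<lambda>y. (mulc (x, y), invc x)" "\<lambda>v. (Dm (x, p) (0, v), 0)" p UNIV mulc "Dm (x, invc x)"]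
      mulc_has_derivative[OF md(2)] by (simp add: md(3))
  define V where "V = chart_dom c \<inter> {h \<in> topspace T. g \<otimes> h \<in> chart_dom c} \<inter>
      {h \<in> topspace T. g \<otimes> h \<otimes> inv g \<in> chart_dom c}"
  have id: "continuous_map T T (\<lambda>h. h)" by (simp flip: id_def)
  have "openin T V"
    unfolding V_def
    by (intro openin_Int open_dom openin_continuous_map_preimage[OF _ open_dom] continuous_map_mult
        continuous_map_const_carrier id g inv_closed)
  moreover have "\<one> \<in> V" using g one_in_dom by (simp add: V_def topspace)
  ultimately have "\<forall>\<^sub>F y in nhds p. y \<in> chart_img c \<and> point c y \<in> V" by (rule eventually_point)
  then have ev: "\<forall>\<^sub>F y in nhds p. mulc (mulc (x, y), invc x) = coord c (g \<otimes> point c y \<otimes> inv g)"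
  proof eventually_elim
    case (elim y)
    then have "point c y \<in> chart_dom c" "g \<otimes> point c y \<in> chart_dom c" by (auto simp: V_def)
    then show ?case
      using mulc_eq[OF g(1), of "point c y"] mulc_eq[of "g \<otimes> point c y" "inv g"] g elim
      by (simp add: coord_point)
  qed
  show ?thesis
    unfolding g_def[symmetric]
    by (rule has_derivative_transform_eventually[OF 2])
      (use ev eventually_nhds_x_imp_x[OF ev] in \<open>auto simp: eventually_at_filter elim: eventually_mono\<close>)
qed

lemma Ad_eq: "inv_in_chart x \<Longrightarrow> Ad G c (point c x) = (\<lambda>v. Dm (x, invc x) (Dm (x, p) (0, v), 0))"
  unfolding Ad_def by (rule frechet_derivative_at[OF conjugation_derivative, symmetric])

lemma one_parameter_subgroup_conjugate:
  assumes x: "inv_in_chart x" and \<gamma>: "one_parameter_subgroup G T c X \<gamma>"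
  shows "one_parameter_subgroup G T c (Ad G c (point c x) X) (\<lambda>t. point c x \<otimes> \<gamma> t \<otimes> inv (point c x))"
  unfolding one_parameter_subgroup_def
proof (intro conjI allI)
  define g where "g = point c x"
  have g: "g \<in> carrier G" using x by (auto simp: g_def inv_in_chart_def point_carrier)
  note o = one_parameter_subgroup_one[OF lie_group \<gamma>]
  have cont: "continuous_map euclideanreal T \<gamma>" and add: "\<And>s t. \<gamma> (s + t) = \<gamma> s \<otimes> \<gamma> t"
    and der: "((\<lambda>t. coord c (\<gamma> t)) has_vector_derivative X) (at 0)"
    using \<gamma> by (auto simp: one_parameter_subgroup_def)
  show "continuous_map euclideanreal T (\<lambda>t. point c x \<otimes> \<gamma> t \<otimes> inv (point c x))"
    unfolding g_def[symmetric]
    by (intro continuous_map_mult continuous_map_const_carrier cont g inv_closed)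
  show "point c x \<otimes> \<gamma> (s + t) \<otimes> inv (point c x) =
      point c x \<otimes> \<gamma> s \<otimes> inv (point c x) \<otimes> (point c x \<otimes> \<gamma> t \<otimes> inv (point c x))" for s t
  proof -
    have "inv g \<otimes> (g \<otimes> (\<gamma> t \<otimes> inv g)) = \<gamma> t \<otimes> inv g" using g o(1) by (simp flip: m_assoc)
    then show ?thesis unfolding g_def[symmetric] using g o(1) by (simp add: add m_assoc)
  qed
  have "((\<lambda>t. coord c (g \<otimes> point c (coord c (\<gamma> t)) \<otimes> inv g)) has_vector_derivative Ad G c g X) (at 0)"
  proof -
    have "((\<lambda>y. coord c (g \<otimes> point c y \<otimes> inv g)) has_derivative Ad G c g) (at (coord c (\<gamma> 0)))"
      using conjugation_derivative[OF x] unfolding g_def Ad_eq[OF x] o(2) .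
    with der show ?thesis by (rule has_derivative_along_curve)
  qed
  moreover have "open {t. \<gamma> t \<in> chart_dom c}"
    using openin_continuous_map_preimage[OF cont open_dom] by simp
  ultimately show "((\<lambda>t. coord c (point c x \<otimes> \<gamma> t \<otimes> inv (point c x))) has_vector_derivative
      Ad G c (point c x) X) (at 0)"
    unfolding g_def by (rule has_vector_derivative_transform_within_open)
      (auto simp: o one_in_dom point_coord)
qed

end

section \<open>Expectation values of Lie brackets\<close>

context lie_vector
begin

text \<open>\<open>Dm\<close> is known to be differentiable only for a fixed direction, whereas the
  inner derivative in \<open>Ad_eq\<close> moves with \<open>x\<close>. Expanding it in the basis
  separates its coefficients from the fixed directions \<open>(b, 0)\<close>.\<close>

lemma Ad_differentiable: "(\<lambda>x. Ad G c (point c x) X) differentiable (at p)"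
proof -
  define \<iota> where "\<iota> = (\<lambda>x. (x, invc x))"
  have pair: "(\<lambda>x. (x, p)) differentiable (at p)" "\<iota> differentiable (at p)"
    unfolding \<iota>_def by (intro differentiable_Pair differentiable_ident differentiable_const invc_differentiable)+
  have d1: "(\<lambda>x. Dm (x, p) v) differentiable (at p)" for v
    using differentiable_chain_at[OF pair(1), of "\<lambda>z. Dm z v"] Dm_differentiable[OF p_p_dom]
    by (simp add: o_def)
  have d2: "(\<lambda>x. Dm (\<iota> x) v) differentiable (at p)" for v
    using differentiable_chain_at[OF pair(2), of "\<lambda>z. Dm z v"] Dm_differentiable[OF p_p_dom]
    by (simp add: o_def \<iota>_def invc_p)
  have d3: "(\<lambda>x. coef b (Dm (x, p) (0, X))) differentiable (at p)" for b
    using differentiable_chain_at[OF d1, of "coef b"] bounded_linear_imp_differentiable[OF bounded_linear_coef]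
    by (simp add: o_def)
  have "(\<lambda>x. \<Sum>b\<in>basis. coef b (Dm (x, p) (0, X)) *\<^sub>R Dm (\<iota> x) (b, 0)) differentiable (at p)"
    by (intro differentiable_sum basis(1) ballI differentiable_scaleR d2 d3)
  then obtain D where D: "((\<lambda>x. \<Sum>b\<in>basis. coef b (Dm (x, p) (0, X)) *\<^sub>R Dm (\<iota> x) (b, 0)) has_derivative D) (at p)"
    unfolding differentiable_def by blast
  have eq: "(\<Sum>b\<in>basis. coef b (Dm (x, p) (0, X)) *\<^sub>R Dm (\<iota> x) (b, 0)) = Ad G c (point c x) X" if x: "inv_in_chart x" for x
  proof -
    have lin: "linear (\<lambda>y. Dm (\<iota> x) (y, 0))"
      using linear_compose[OF _ linear_Dm[OF inv_in_chart_mulc_dom(2)[OF x]], of "\<lambda>y. (y, 0)"]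
      by (simp add: o_def \<iota>_def linear_iff)
    have "Ad G c (point c x) X = Dm (\<iota> x) (\<Sum>b\<in>basis. coef b (Dm (x, p) (0, X)) *\<^sub>R b, 0)"
      by (simp add: Ad_eq[OF x] sum_coef \<iota>_def)
    also have "\<dots> = (\<Sum>b\<in>basis. coef b (Dm (x, p) (0, X)) *\<^sub>R Dm (\<iota> x) (b, 0))"
      by (simp add: linear_sum[OF lin] linear_scale[OF lin])
    finally show ?thesis ..
  qed
  have "((\<lambda>x. Ad G c (point c x) X) has_derivative D) (at p)"
    by (rule has_derivative_transform_eventually[OF D])
      (use eventually_inv_in_chart in \<open>auto simp: eventually_at_filter eq inv_in_chart_p elim: eventually_mono\<close>)
  then show ?thesis unfolding differentiable_def by blast
qed

lemma eventually_gam_inv_in_chart: "\<forall>\<^sub>F s in nhds 0. gam Y s \<in> chart_dom c \<and> inv_in_chart (coord c (gam Y s))"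
proof -
  have "((\<lambda>t. coord c (gam Y t)) \<longlongrightarrow> coord c (gam Y 0)) (nhds 0)"
    using has_vector_derivative_continuous[OF gam_derivative[of Y]]
      tendsto_at_iff_tendsto_nhds[of "\<lambda>t. coord c (gam Y t)" 0] by (simp add: isCont_def)
  then have "filterlim (\<lambda>t. coord c (gam Y t)) (nhds p) (nhds 0)" by (simp add: gam_0)
  from eventually_compose_filterlim[OF eventually_inv_in_chart this]
    eventually_preimage[OF gam_continuous[of Y] open_dom, of 0]
  show ?thesis by (auto simp: gam_0 one_in_dom elim: eventually_elim2)
qed

lemma Ad_gam_derivative:
  "((\<lambda>s. Ad G c (gam Y s) X) has_vector_derivative lie_bracket G c Y X) (at 0)"
proof -
  define D where "D = frechet_derivative (\<lambda>x. Ad G c (point c x) X) (at p)"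
  have D: "((\<lambda>x. Ad G c (point c x) X) has_derivative D) (at (coord c (gam Y 0)))"
    using Ad_differentiable[of X] by (simp add: D_def frechet_derivative_works gam_0)
  have "((\<lambda>s. Ad G c (point c (coord c (gam Y s))) X) has_vector_derivative D Y) (at 0)"
    by (rule has_derivative_along_curve[OF gam_derivative D])
  moreover have "open {t. gam Y t \<in> chart_dom c}"
    using openin_continuous_map_preimage[OF gam_continuous open_dom] by simp
  ultimately have "((\<lambda>s. Ad G c (gam Y s) X) has_vector_derivative D Y) (at 0)"
    by (rule has_vector_derivative_transform_within_open) (auto simp: gam_0 one_in_dom point_coord)
  then show ?thesis by (simp add: D_def lie_bracket_def)
qed

text \<open>With g = exp(sY), the identity exp(tX) g^-1 = g^-1 (g exp(tX) g^-1) reduces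
  differentiation at the translated vector to differentiation at \<open>\<psi>\<close> along the
  conjugate subgroup, whose velocity is \<open>Ad G c g X\<close>.\<close>

lemma generator_on_translate:
  assumes g: "gam Y s \<in> chart_dom c" "inv_in_chart (coord c (gam Y s))"
  shows "generator_rel G T c U X (U (gam Y (- s)) \<psi>) (U (gam Y (- s)) (gen (Ad G c (gam Y s) X) \<psi>))"
proof -
  define g where "g = gam Y s"
  have gc: "g \<in> carrier G" and ig: "gam Y (- s) = inv g" by (simp_all add: g_def gam_carrier gam_minus)
  have pg: "point c (coord c g) = g" using g by (simp add: g_def point_coord)
  have "one_parameter_subgroup G T c (Ad G c g X) (\<lambda>t. g \<otimes> gam X t \<otimes> inv g)"
    using one_parameter_subgroup_conjugate[OF g(2) gam[of X]] pg by (simp add: g_def)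
  from generator_derivative[OF lie_group chart_one this dom]
  have "((\<lambda>t. U (inv g) (U (g \<otimes> gam X t \<otimes> inv g) \<psi>)) has_vector_derivative
      U (inv g) (\<i> *\<^sub>C gen (Ad G c g X) \<psi>)) (at 0)"
    by (intro bounded_linear.has_vector_derivative[OF bounded_clinear_bounded_linear[OF U_clinear]] inv_closed gc)
  moreover have "U (inv g) (U (g \<otimes> gam X t \<otimes> inv g) \<psi>) = U (gam X t) (U (inv g) \<psi>)" for t
  proof -
    have "inv g \<otimes> (g \<otimes> gam X t \<otimes> inv g) = gam X t \<otimes> inv g"
      using gc gam_carrier by (simp flip: m_assoc)
    then show ?thesis using gc gam_carrier by (metis U_mult inv_closed m_closed)
  qed
  ultimately have "((\<lambda>t. U (gam X t) (U (inv g) \<psi>)) has_vector_derivative \<i> *\<^sub>C U (inv g) (gen (Ad G c g X) \<psi>)) (at 0)"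
    using gc by (simp add: bounded_clinear_simps[OF U_clinear])
  then show ?thesis unfolding generator_rel_def ig g_def[symmetric] using gam by blast
qed

text \<open>Both sides are the derivative at s = 0 of the expectation of \<open>X\<close> in the
  translated vector \<open>\<psi>s s\<close>. Symmetry of the generator rewrites the increment so
  that only \<open>\<psi>s\<close> is differentiated, while \<open>a s\<close>, the generator
  applied to \<open>\<psi>s s\<close>, merely has to be continuous at 0.\<close>

lemma expectation_lie_bracket:
  "expectation G T c U \<psi> (lie_bracket G c Y X) =
     - \<i> * (cinner (gen X \<psi>) (gen Y \<psi>) - cinner (gen Y \<psi>) (gen X \<psi>))"
proof -
  define u where "u = (\<lambda>s. gen (Ad G c (gam Y s) X) \<psi>)"
  define \<psi>s where "\<psi>s = (\<lambda>s. U (gam Y (- s)) \<psi>)"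
  define a where "a = (\<lambda>s. U (gam Y (- s)) (u s))"
  define a0 where "a0 = gen X \<psi>"
  have \<psi>0: "\<psi>s 0 = \<psi>" by (simp add: \<psi>s_def gam_0 U_one)
  have rel: "generator_rel G T c U X (\<psi>s s) (a s)"
    if "gam Y s \<in> chart_dom c \<and> inv_in_chart (coord c (gam Y s))" for s
    using generator_on_translate that by (simp add: \<psi>s_def a_def u_def)
  have "generator_rel G T c U X \<psi> (a 0)"
    using rel[of 0] \<psi>0 by (simp add: gam_0 one_in_dom inv_in_chart_p)
  then have a_0: "a 0 = a0" unfolding a0_def by (rule generator_unique[OF lie_group chart_one, symmetric])
  then have u_0: "u 0 = a0" by (simp add: a_def gam_0 U_one)
  have du: "(u has_vector_derivative gen (lie_bracket G c Y X) \<psi>) (at 0)"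
    unfolding u_def by (rule bounded_linear.has_vector_derivative[OF bounded_linear_gen Ad_gam_derivative])
  have e_eq: "cinner \<psi> (u s) - cinner \<psi> (u 0) = cinner (\<psi>s s - \<psi>) (a s) + cinner a0 (\<psi>s s - \<psi>)"
    if s: "gam Y s \<in> chart_dom c \<and> inv_in_chart (coord c (gam Y s))" for s
  proof -
    have "\<psi>s s \<in> generator_dom G T c U X" and gs: "gen X (\<psi>s s) = a s"
      using rel[OF s] generator_unique[OF lie_group chart_one rel[OF s]] by (auto simp: generator_dom_def)
    then have sym: "cinner a0 (\<psi>s s) = cinner \<psi> (a s)"
      using generator_symmetric[OF lie_group chart_one rep dom, of "\<psi>s s" X] by (simp add: a0_def)
    have sym0: "cinner a0 \<psi> = cinner \<psi> a0"
      using generator_symmetric[OF lie_group chart_one rep dom dom] by (simp add: a0_def)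
    have "cinner \<psi> (u s) = cinner (\<psi>s s) (a s)"
      unfolding \<psi>s_def a_def
      by (rule unitary_pair_cinner[OF unitary_rep_pair[OF is_group rep gam_carrier], symmetric])
    then show ?thesis by (simp add: u_0 cinner_diff_left cinner_diff_right sym sym0)
  qed
  have "((\<lambda>s. - s) has_vector_derivative - 1) (at (0::real))"
    by (auto intro!: derivative_eq_intros)
  from vector_diff_chain_at[OF this, of "\<lambda>t. U (gam Y t) \<psi>" "\<i> *\<^sub>C gen Y \<psi>"] U_gam_derivative[of Y]
  have "(\<psi>s has_vector_derivative - (\<i> *\<^sub>C gen Y \<psi>)) (at 0)"
    by (simp add: o_def \<psi>s_def)
  then have q: "((\<lambda>s. (\<psi>s s - \<psi>) /\<^sub>R s) \<longlongrightarrow> - (\<i> *\<^sub>C gen Y \<psi>)) (at 0)"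
    by (simp add: has_vector_derivative_at_0_iff \<psi>0)
  have ulim: "(u \<longlongrightarrow> a0) (at 0)"
    using has_vector_derivative_continuous[OF du] by (simp add: isCont_def u_0)
  have "continuous_map euclidean T (\<lambda>s. gam Y (- s))"
    by (rule continuous_map_gam_linear[OF bounded_linear_minus[OF bounded_linear_ident]])
  from U_tendsto[OF this, of a0 0] have Ulim: "((\<lambda>s. U (gam Y (- s)) a0) \<longlongrightarrow> a0) (at 0)"
    using tendsto_at_iff_tendsto_nhds[of "\<lambda>s. U (gam Y (- s)) a0" 0] by (simp add: gam_0 U_one)
  \<comment> \<open>Norm convergence of \<open>u s\<close> passes through the isometries; strong
    continuity handles the limit vector \<open>a0\<close>.\<close>
  have alim: "(a \<longlongrightarrow> a0) (at 0)"
  proof (rule LIM_zero_cancel, rule Lim_null_comparison)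
    have "((\<lambda>s. norm (u s - a0) + norm (U (gam Y (- s)) a0 - a0)) \<longlongrightarrow> 0 + 0) (at 0)"
      by (intro tendsto_add tendsto_norm_zero LIM_zero ulim Ulim)
    then show "((\<lambda>s. norm (u s - a0) + norm (U (gam Y (- s)) a0 - a0)) \<longlongrightarrow> 0) (at 0)" by simp
    have "norm (a s - a0) \<le> norm (u s - a0) + norm (U (gam Y (- s)) a0 - a0)" for s
    proof -
      have "a s - a0 = U (gam Y (- s)) (u s - a0) + (U (gam Y (- s)) a0 - a0)"
        by (simp add: a_def linear_diff[OF U_linear[OF gam_carrier]])
      then show ?thesis using norm_triangle_ineq U_norm[OF gam_carrier] by metis
    qed
    then show "\<forall>\<^sub>F s in at 0. norm (a s - a0) \<le> norm (u s - a0) + norm (U (gam Y (- s)) a0 - a0)"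
      by simp
  qed
  have "((\<lambda>s. cinner ((\<psi>s s - \<psi>) /\<^sub>R s) (a s) + cinner a0 ((\<psi>s s - \<psi>) /\<^sub>R s)) \<longlongrightarrow>
      cinner (- (\<i> *\<^sub>C gen Y \<psi>)) a0 + cinner a0 (- (\<i> *\<^sub>C gen Y \<psi>))) (at 0)"
    by (intro tendsto_add tendsto_cinner q alim tendsto_const)
  moreover have "\<forall>\<^sub>F s in at 0. cinner ((\<psi>s s - \<psi>) /\<^sub>R s) (a s) + cinner a0 ((\<psi>s s - \<psi>) /\<^sub>R s)
      = cinner \<psi> ((u s - u 0) /\<^sub>R s)"
    unfolding eventually_at_filter using eventually_gam_inv_in_chart[of Y]
    by eventually_elim
      (simp only: cinner_scaleR_left cinner_scaleR_right distrib_left[symmetric] cinner_diff_right[of \<psi>] e_eq simp_thms)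
  ultimately have "((\<lambda>s. cinner \<psi> ((u s - u 0) /\<^sub>R s)) \<longlongrightarrow>
      cinner (- (\<i> *\<^sub>C gen Y \<psi>)) a0 + cinner a0 (- (\<i> *\<^sub>C gen Y \<psi>))) (at 0)"
    by (rule Lim_transform_eventually)
  moreover have "((\<lambda>s. cinner \<psi> ((u s - u 0) /\<^sub>R s)) \<longlongrightarrow> cinner \<psi> (gen (lie_bracket G c Y X) \<psi>)) (at 0)"
    using du by (intro tendsto_cinner tendsto_const) (simp add: has_vector_derivative_at_0_iff)
  ultimately have "cinner \<psi> (gen (lie_bracket G c Y X) \<psi>) =
      cinner (- (\<i> *\<^sub>C gen Y \<psi>)) a0 + cinner a0 (- (\<i> *\<^sub>C gen Y \<psi>))"
    using tendsto_unique[OF at_neq_bot] by blast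
  then show ?thesis
    by (simp add: expectation_def a0_def cinner_scaleC_left cinner_scaleC_right algebra_simps)
qed

lemma linear_expectation: "linear (expectation G T c U \<psi>)"
  using bounded_linear.linear[OF bounded_linear_compose[OF bounded_linear_cinner_right bounded_linear_gen]]
  by (simp add: expectation_def[abs_def])

end

theorem mainTheorem5:
  fixes G :: "'g monoid" and T :: "'g topology" and \<A> :: "('g, 'e::banach) chart set"
    and c :: "('g, 'e) chart" and d :: nat and L :: "nat \<Rightarrow> 'e"
    and U :: "'g \<Rightarrow> 'h::complex_hilbert \<Rightarrow> 'h"
    and \<psi> \<phi> :: 'h and R :: real
  assumes "compact_lie_group G T \<A>" and "chart_at_one G \<A> c" and "lie_algebra_basis d L"
    and "unitary_rep G T U" and "norm \<psi> = 1" and "norm \<phi> = 1"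
    and "\<And>X. \<psi> \<in> generator_dom G T c U X" and "\<And>X. \<phi> \<in> generator_dom G T c U X"
    and "R > 0" and "reversible_asymptotic_transformation G U \<psi> \<phi> R"
  shows "Sym_group G U \<psi> = Sym_group G U \<phi> \<and>
    (\<forall>k<d. \<forall>l<d. covariance_matrix G T c U L \<psi> k l =
       complex_of_real R * covariance_matrix G T c U L \<phi> k l) \<and>
    (\<forall>X \<in> commutator_subalgebra G c.
       expectation G T c U \<psi> X = complex_of_real R * expectation G T c U \<phi> X)"
proof (intro conjI allI impI ballI)
  have gr: "group G" using assms(1) by (simp add: compact_lie_group_def)
  have fw: "asymptotic_transformation G U \<psi> \<phi> R"
    and bw: "asymptotic_transformation G U \<phi> \<psi> (inverse R)"
    using assms(10) by (auto simp: reversible_asymptotic_transformation_def)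
  have "inverse R > 0" using assms(9) by simp
  then show "Sym_group G U \<psi> = Sym_group G U \<phi>"
    using Sym_group_mono[OF gr assms(4,5,6,9) fw] Sym_group_mono[OF gr assms(4,6,5) _ bw] by blast
  have Q: "geometric_tensor G T c U \<psi> X Y = of_real R * geometric_tensor G T c U \<phi> X Y" for X Y
    by (rule reversible_geometric_tensor[OF assms(1,2,4-10)])
  have cov: "covariance_matrix G T c U L v k l =
      (geometric_tensor G T c U v (L k) (L l) + geometric_tensor G T c U v (L l) (L k)) / 2" for v k l
    by (simp add: covariance_matrix_def geometric_tensor_def Let_def field_simps)
  show "covariance_matrix G T c U L \<psi> k l = complex_of_real R * covariance_matrix G T c U L \<phi> k l" for k l
    unfolding cov Q by (simp add: distrib_left)
  fix X assume "X \<in> commutator_subalgebra G c"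
  then have X: "X \<in> span {lie_bracket G c X Y | X Y. True}" by (simp add: commutator_subalgebra_def)
  interpret psi: lie_vector G T \<A> c U \<psi> using assms by unfold_locales auto
  interpret phi: lie_vector G T \<A> c U \<phi> using assms by unfold_locales auto
  \<comment> \<open>The product of the two expectations is symmetric in \<open>X\<close> and
    \<open>Y\<close>, so it drops out of the antisymmetric part.\<close>
  have br: "- \<i> * (cinner (generator G T c U X v) (generator G T c U Y v) - cinner (generator G T c U Y v) (generator G T c U X v))
      = - \<i> * (geometric_tensor G T c U v X Y - geometric_tensor G T c U v Y X)" for v X Y
    by (simp add: geometric_tensor_def)
  have lin: "linear (\<lambda>X. complex_of_real R * expectation G T c U \<phi> X)"
    using linear_compose[OF phi.linear_expectation, of "\<lambda>z. complex_of_real R * z"]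
    by (simp add: o_def linear_iff algebra_simps)
  show "expectation G T c U \<psi> X = complex_of_real R * expectation G T c U \<phi> X"
  proof (rule linear_eq_on_span[OF psi.linear_expectation lin _ X])
    fix Z assume "Z \<in> {lie_bracket G c X Y | X Y. True}"
    then obtain Y X where Z: "Z = lie_bracket G c Y X" by blast
    show "expectation G T c U \<psi> Z = complex_of_real R * expectation G T c U \<phi> Z"
      unfolding Z psi.expectation_lie_bracket phi.expectation_lie_bracket br Q by (simp add: algebra_simps)
  qed
qed

end
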